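(* For every integer $n\geq 2$, $$ \overline{\Upsilon}(n)>\frac{(n-1)\kappa_n}{n}\log n\,\log\log n+\frac{c_8(n-1)\kappa_n\log n}{n}-\frac{16381\,\kappa_n}{5000\log n}-\frac{6\kappa_n}{\log^2 n}-\frac{54281\,\kappa_n}{800\log^3 n}-\frac{c_{10}\kappa_n\log^2 n}{n}, $$ where $$ \kappa_n=\frac{5000\log n}{6381+5000\log n}. $$
   Context: Here $\log$ is the natural logarithm and $\log^k x$ means $(\log x)^k$. For a positive integer $n$ and a prime $p$, $v_p(n!)$ denotes the exponent of $p$ in the prime factorization of $n!$. Put $$\Upsilon(n)=\sum_{p\leq n}v_p(n!),\qquad \overline{\Upsilon}(n)=\frac{\Upsilon(n)}{\pi(n)},$$ the sum being over primes $p\le n$, where $\pi(n)$ is the number of primes not exceeding $n$ (so $\overline{\Upsilon}(n)$ is the mean of $v_p(n!)$ over primes $p\le n$). The exponential integral is $\mathrm{Ei}(a,z)=\int_1^\infty e^{-tz}t^{-a}\,dt$ for $\Re(z)>0$. The constant $c_8$ is $c_8=c_5+c_7+\mathcal{E}\approx -11.86870152$, where $$c_5=\frac{8337\log^2 2-3965\log 2-1586}{600\log^3 2}\approx -1.645482755,$$ $$c_6=\int_2^{e}\frac{1200x^3-7565x^2-2744x-407}{1200(x-1)^4\log x}\,dx\approx -8.600279758,$$ $$c_7=c_6-\left(\frac{1513}{240}\mathrm{Ei}(1,1)+\frac{343}{150}\mathrm{Ei}(1,2)+\frac{407}{1200}\mathrm{Ei}(1,3)\right)\approx -10.09955739,$$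 $$\mathcal{E}=-\frac{29\,(131874\log^2 29-238693\log 29-155428)}{3292800\log^3 29}\approx -0.1236613745.$$ The constant $c_{10}$ is $$c_{10}=\frac{3193\cdot 2}{2400\log 2}+\frac{3193\cdot 2}{2400\log^2 2}+\frac{793\cdot 2}{1200\log^3 2}+\frac{793\cdot 2}{400\log^4 2}\approx 30.52238614.$$ *)

theory Defs
  imports "HOL-Analysis.Analysis" "HOL-Computational_Algebra.Primes"
begin

definition prime_pi :: "nat \<Rightarrow> nat" where
  "prime_pi n = card {p. prime p \<and> p \<le> n}"

definition Upsilon :: "nat \<Rightarrow> nat" where
  "Upsilon n = (\<Sum>p | prime p \<and> p \<le> n. multiplicity p (fact n :: nat))"

definition Upsilon_mean :: "nat \<Rightarrow> real" where
  "Upsilon_mean n = real (Upsilon n) / real (prime_pi n)"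

text \<open>
  The generalised exponential integral \<open>Ei(a, z)\<close>, meaningful for \<open>Re z > 0\<close>
  (the integral is defaulted to \<open>0\<close> where it does not exist).
\<close>

definition Ei :: "complex \<Rightarrow> complex \<Rightarrow> complex" where
  "Ei a z = integral {1..} (\<lambda>t::real. exp (- (of_real t * z)) * of_real t powr (- a))"

definition c5 :: real where
  "c5 = (8337 * (ln 2)^2 - 3965 * ln 2 - 1586) / (600 * (ln 2)^3)"

definition c6 :: real where
  "c6 = integral {2..exp 1} (\<lambda>x::real.
     (1200 * x^3 - 7565 * x^2 - 2744 * x - 407) / (1200 * (x - 1)^4 * ln x))"

text \<open>
  \<open>Re\<close> only serves to regard the values \<open>Ei(1, 1)\<close>, \<open>Ei(1, 2)\<close>, \<open>Ei(1, 3)\<close>,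
  which are real, as elements of type \<^typ>\<open>real\<close>.
\<close>

definition c7 :: real where
  "c7 = c6 - (1513 / 240 * Re (Ei 1 1) + 343 / 150 * Re (Ei 1 2) + 407 / 1200 * Re (Ei 1 3))"

definition E_const :: real where
  "E_const = - (29 * (131874 * (ln 29)^2 - 238693 * ln 29 - 155428) / (3292800 * (ln 29)^3))"

definition c8 :: real where
  "c8 = c5 + c7 + E_const"

definition c10 :: real where
  "c10 = 3193 * 2 / (2400 * ln 2) + 3193 * 2 / (2400 * (ln 2)^2)
       + 793 * 2 / (1200 * (ln 2)^3) + 793 * 2 / (400 * (ln 2)^4)"

definition kappa :: "nat \<Rightarrow> real" where
  "kappa n = 5000 * ln (real n) / (6381 + 5000 * ln (real n))"

end

theory Submission
  imports Defs "HOL-Complex_Analysis.Complex_Analysis" "HOL-Number_Theory.Prime_Powers"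
begin

text \<open>
  Write \<open>l = ln n\<close> and \<open>L = ln l\<close>.  On the right-hand side every term after the first two is
  negative, \<open>0 < kappa n < 1\<close>, and \<open>c8\<close> is about \<open>-11.87\<close>; the bound \<open>c8 \<le> -10\<close> suffices
  (lemma \<open>c8_le\<close>).  So the right-hand side is smaller than \<open>l * (L - 10)\<close> if \<open>L > 10\<close>, and
  negative otherwise.  It remains to show \<open>\<pi>(n) * l * (L - 10) \<le> Upsilon n\<close> for \<open>L > 10\<close>.

  Since \<open>v\<^sub>p(n!) \<ge> n div p\<close>, the sum \<open>Upsilon n\<close> is at least \<open>n * (\<Sum>p\<le>n. 1/p) - \<pi>(n)\<close>, and Euler's
  comparison of the harmonic sum with \<open>\<Prod>p\<le>n. 1 / (1 - 1/p)\<close> gives \<open>(\<Sum>p\<le>n. 1/p) \<ge> L - 1/2\<close>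
  (lemma \<open>sum_inverse_primes_ge\<close>).  Hence it suffices to have \<open>\<pi>(n) * l \<le> n * (1 + \<delta>)\<close> with
  \<open>\<delta> * (L - 10)\<close> slightly below \<open>9.5\<close>.  The allowed error \<open>\<delta>\<close> shrinks like \<open>9.5 / L\<close>, that is, like
  a constant over \<open>ln (ln n)\<close>: this is a prime number theorem with a weak explicit error term.

  For \<open>L \<le> 95\<close> the bound \<open>\<theta>(n) \<le> 1.11 n + 10^10\<close> that Chebyshev obtained from
  \<open>(30m)! m! / ((15m)! (10m)! (6m)!)\<close> is good enough (lemma \<open>theta_le_chebyshev\<close>), because
  \<open>0.11 * 85 < 9.5\<close>.

  For \<open>L \<ge> 95\<close> the bound \<open>\<theta>(x) \<le> x * (1 + 9.2 / L)\<close> for \<open>ln (ln x) = L\<close> (lemma \<open>theta_le_sharp\<close>) comes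
  from a Wiener-Ikehara argument with all constants tracked.  For \<open>Re s > 1\<close> write
  \<open>-\<zeta>'/\<zeta>(s) = 1/(s-1) - H(s)\<close> where \<open>H = G'/G\<close> and \<open>G(s) = (s-1) \<zeta>(s)\<close>.  Multiplying by the
  Fejer weight \<open>(1 - \<bar>t\<bar>/T) e^{ity}\<close> and integrating over \<open>\<bar>t\<bar> \<le> T\<close> turns the left-hand side into a sum
  of \<open>\<Lambda>(n)/n\<close> weighted by a nonnegative kernel that concentrates near \<open>ln n = y\<close>, turns
  the pole into (at most) the mass of that kernel, and makes the contribution of \<open>H\<close> small: one
  integration by parts bounds it by \<open>O(T sup \<bar>H'\<bar> / y)\<close>, and \<open>y\<close> is of size \<open>e^L\<close> whereas \<open>T\<close> is only of
  size \<open>L^2\<close>.  Therefore a bound for \<open>H\<close> and \<open>H'\<close> that is polynomial in \<open>T\<close> is enough, and such a bound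
  follows from the classical inequality \<open>\<zeta>(\<sigma>)^3 \<bar>\<zeta>(\<sigma>+it)\<bar>^4 \<bar>\<zeta>(\<sigma>+2it)\<bar> \<ge> 1\<close> together with Cauchy's
  inequalities for the derivatives of \<open>G\<close>, which is holomorphic for \<open>Re s > 3/4\<close>
  (lemma \<open>zeta_logderiv_le\<close>).  Averaging the smoothed estimate against \<open>e^y\<close> gives the bound
  for \<open>\<theta>\<close>; the width \<open>w\<close> of the smoothing window and the height \<open>T\<close> are chosen so that both
  losses, \<open>2w\<close> from the window and \<open>O(1/(Tw))\<close> from the tail of the kernel, are of size \<open>1/L\<close>.
\<close>

section \<open>Dirichlet series and the 3-4-1 inequality\<close>

definition dirichlet :: "(nat \<Rightarrow> complex) \<Rightarrow> complex \<Rightarrow> complex" where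
  "dirichlet a s = (\<Sum>n. a n * of_nat n powr (-s))"

lemma norm_nat_powr: "norm (of_nat n powr (-s) :: complex) = real n powr (- Re s)"
  by (simp add: norm_powr_real_powr)

lemma summable_nat_powr: "c > 1 \<Longrightarrow> summable (\<lambda>n. real n powr (-c))"
  by (simp add: summable_real_powr_iff)

lemma has_field_derivative_nat_powr:
  "((\<lambda>s. of_nat n powr (-s) :: complex) has_field_derivative
     - of_real (ln (real n)) * of_nat n powr (-s)) (at s)"
proof (cases "n = 0")
  case False
  then have "(\<lambda>s. of_nat n powr (-s) :: complex) = (\<lambda>s. exp (- s * of_real (ln (real n))))"
    by (simp add: powr_def Ln_of_nat)
  then show ?thesis
    using False by (auto intro!: derivative_eq_intros simp: fun_eq_iff dest: fun_cong[where x = s])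
qed simp

lemma dirichlet_abs_summable:
  assumes "\<And>n. norm (a n) \<le> 1" "Re s > 1"
  shows "summable (\<lambda>n. norm (a n * of_nat n powr (-s) :: complex))"
proof (rule summable_comparison_test[OF _ summable_nat_powr[OF assms(2)]], intro exI allI impI)
  fix n show "norm (norm (a n * of_nat n powr (-s))) \<le> real n powr - Re s"
    using mult_right_mono[OF assms(1)[of n], of "real n powr - Re s"]
    by (simp add: norm_mult norm_nat_powr)
qed

lemma dirichlet_sums:
  assumes "\<And>n. norm (a n) \<le> 1" "Re s > 1"
  shows "(\<lambda>n. a n * of_nat n powr (-s)) sums dirichlet a s"
  unfolding dirichlet_def by (rule summable_sums[OF summable_norm_cancel[OF dirichlet_abs_summable[OF assms]]])

text \<open>
  Termwise differentiation: on \<open>Re z > c\<close> with \<open>c > 1\<close> the series is dominated by \<open>\<Sum> n^{-c}\<close>, and locally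
  uniform convergence of holomorphic functions passes to derivatives.
\<close>

lemma dirichlet_deriv:
  assumes a: "\<And>n. norm (a n) \<le> 1" and s: "Re s > 1"
  obtains D where "(\<lambda>n. a n * (- of_real (ln (real n)) * of_nat n powr (-s))) sums D"
    "(dirichlet a has_field_derivative D) (at s)"
proof -
  define c where "c = (1 + Re s) / 2"
  have c: "c > 1" "c < Re s" using s by (auto simp: c_def)
  define S where "S = {z. Re z > c}"
  have S: "open S" unfolding S_def by (rule open_halfspace_Re_gt)
  have sS: "s \<in> S" using c by (simp add: S_def)
  obtain g g' where g: "\<forall>x \<in> S. ((\<lambda>n. a n * of_nat n powr (-x)) sums g x) \<and>
     ((\<lambda>n. a n * (- of_real (ln (real n)) * of_nat n powr (-x))) sums g' x) \<and>
     (g has_field_derivative g' x) (at x)"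
  proof (rule series_and_derivative_comparison[OF S summable_nat_powr[OF c(1)]])
    fix n x assume "x \<in> S"
    show "((\<lambda>x. a n * of_nat n powr (-x)) has_field_derivative
       a n * (- of_real (ln (real n)) * of_nat n powr (-x))) (at x)"
      by (rule DERIV_cmult[OF has_field_derivative_nat_powr])
  next
    show "\<forall>\<^sub>F n in sequentially. \<forall>x\<in>S. cmod (a n * of_nat n powr - x) \<le> real n powr - c"
    proof (rule always_eventually, intro allI ballI)
      fix n x assume x: "x \<in> S"
      have "cmod (a n * of_nat n powr - x) \<le> 1 * (real n powr - Re x)"
        unfolding norm_mult norm_nat_powr by (rule mult_right_mono[OF a]) simp
      also have "\<dots> \<le> real n powr - c"
        using x by (cases "n = 0") (auto simp: S_def intro!: powr_mono)
      finally show "cmod (a n * of_nat n powr - x) \<le> real n powr - c" .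
    qed
  qed (rule that)
  have eq: "g z = dirichlet a z" if "z \<in> S" for z
    using g that unfolding dirichlet_def by (simp add: sums_iff)
  have "(dirichlet a has_field_derivative g' s) (at s)"
    using g sS by (intro has_field_derivative_transform_within_open[OF _ S sS eq]) auto
  with g sS that show ?thesis by blast
qed

definition zeta_series :: "complex \<Rightarrow> complex" where "zeta_series = dirichlet (\<lambda>_. 1)"

definition mangoldt_series :: "complex \<Rightarrow> complex" where "mangoldt_series = dirichlet mangoldt"

text \<open>
  The series \<open>\<Sum> \<Lambda>(n) / ln n * n^{-s}\<close>.  It is introduced before it is known to be a logarithm of
  \<open>\<zeta>\<close>; working with it avoids Euler products and branches of the complex logarithm.
\<close>

definition log_zeta :: "complex \<Rightarrow> complex" where
  "log_zeta = dirichlet (\<lambda>n. mangoldt n / of_real (ln (real n)))"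

lemma mangoldt_over_ln_le: "norm (mangoldt n / of_real (ln (real n)) :: complex) \<le> 1"
proof (cases "n \<le> 1")
  case False
  then show ?thesis using mangoldt_le[of n] by (simp add: norm_divide divide_le_eq)
next
  case True
  then have "n = 0 \<or> n = 1" by auto
  then show ?thesis by auto
qed

text \<open>
  Differentiating cancels the factor \<open>1 / ln n\<close>.  The convergence of \<open>\<Sum> \<Lambda>(n) n^{-s}\<close>, whose
  coefficients are unbounded, comes for free from the termwise differentiation.
\<close>

lemma log_zeta_deriv:
  assumes s: "Re s > 1"
  shows "(log_zeta has_field_derivative - mangoldt_series s) (at s)"
    and "(\<lambda>n. mangoldt n * of_nat n powr (-s)) sums mangoldt_series s"
proof -
  obtain D where D: "(\<lambda>n. mangoldt n / of_real (ln (real n)) * (- of_real (ln (real n)) * of_nat n powr (-s))) sums D"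
    "(log_zeta has_field_derivative D) (at s)"
    using dirichlet_deriv[of "\<lambda>n. mangoldt n / of_real (ln (real n))", OF mangoldt_over_ln_le s]
    unfolding log_zeta_def by blast
  have "mangoldt n / of_real (ln (real n)) * (- of_real (ln (real n)) * of_nat n powr (-s)) =
      - (mangoldt n * of_nat n powr (-s) :: complex)" for n
  proof (cases "n \<le> 1")
    case True
    then have "n = 0 \<or> n = 1" by auto
    then show ?thesis by auto
  qed simp
  with D(1) have "(\<lambda>n. - (mangoldt n * of_nat n powr (-s) :: complex)) sums D" by simp
  from sums_minus[OF this] have *: "(\<lambda>n. mangoldt n * of_nat n powr (-s) :: complex) sums (- D)" by simp
  then have "- D = mangoldt_series s" unfolding mangoldt_series_def dirichlet_def by (simp add: sums_iff)
  then have "D = - mangoldt_series s" by (metis minus_minus)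
  with * D(2) \<open>- D = _\<close> show "(log_zeta has_field_derivative - mangoldt_series s) (at s)"
    and "(\<lambda>n. mangoldt n * of_nat n powr (-s)) sums mangoldt_series s" by simp_all
qed

lemma mangoldt_series_abs_summable:
  assumes "Re s > 1"
  shows "summable (\<lambda>n. norm (mangoldt n * of_nat n powr (-s) :: complex))"
proof -
  have "(\<lambda>n. mangoldt n * of_nat n powr (- of_real (Re s)) :: complex) sums mangoldt_series (of_real (Re s))"
    using log_zeta_deriv(2)[of "of_real (Re s)"] assms by simp
  then have "summable (\<lambda>n. Re (mangoldt n * of_nat n powr (- of_real (Re s)) :: complex))"
    using summable_Re sums_summable by blast
  moreover have "Re (mangoldt n * of_nat n powr (- of_real (Re s)) :: complex) =
      norm (mangoldt n * of_nat n powr (-s) :: complex)" for n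
  proof -
    have "(of_nat n powr (- of_real (Re s)) :: complex) = of_real (real n powr (- Re s))"
      by (simp add: powr_of_real[symmetric])
    moreover have "(mangoldt n :: complex) = of_real (mangoldt n)" by simp
    ultimately have "(mangoldt n * of_nat n powr (- of_real (Re s)) :: complex) = of_real (mangoldt n * real n powr (- Re s))"
      by (metis of_real_mult)
    then have "Re (mangoldt n * of_nat n powr (- of_real (Re s)) :: complex) = mangoldt n * real n powr (- Re s)"
      by (metis Re_complex_of_real)
    then show ?thesis by (simp only: norm_mult norm_nat_powr norm_mangoldt)
  qed
  ultimately show ?thesis by simp
qed

text \<open>
  The identity \<open>\<Sum>d | n. \<Lambda>(d) = ln n\<close> in terms of Dirichlet series: the absolutely convergent
  double series over \<open>(d, k)\<close> is regrouped according to \<open>n = d * k\<close>.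
\<close>

lemma zeta_mult_mangoldt:
  assumes s: "Re s > 1"
  shows "(\<lambda>n. of_real (ln (real n)) * of_nat n powr (-s)) sums (mangoldt_series s * zeta_series s)"
proof -
  let ?x = "\<lambda>d. mangoldt d * of_nat d powr (-s) :: complex"
  let ?y = "\<lambda>k. of_nat k powr (-s) :: complex"
  let ?f = "\<lambda>(d,k). ?x d * ?y k"
  have xs: "(\<lambda>n. norm (?x n)) summable_on UNIV" "(?x has_sum mangoldt_series s) UNIV"
    using norm_summable_imp_summable_on[of "\<lambda>n. norm (?x n)"] mangoldt_series_abs_summable[OF s]
      norm_summable_imp_has_sum[OF mangoldt_series_abs_summable[OF s] log_zeta_deriv(2)[OF s]] by auto
  have sy: "summable (\<lambda>n. norm (?y n))" "?y sums zeta_series s"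
    using dirichlet_abs_summable[of "\<lambda>_. 1" s] dirichlet_sums[of "\<lambda>_. 1" s] s by (auto simp: zeta_series_def)
  have ys: "(\<lambda>n. norm (?y n)) summable_on UNIV" "(?y has_sum zeta_series s) UNIV"
    using norm_summable_imp_summable_on[of "\<lambda>n. norm (?y n)"] sy norm_summable_imp_has_sum[OF sy] by auto
  have "(\<lambda>z. norm (?f z)) summable_on (UNIV \<times> UNIV)"
    unfolding Infinite_Sum.abs_summable_on_Sigma_iff
  proof (intro conjI ballI)
    fix d show "(\<lambda>k. norm (?f (d, k))) summable_on UNIV"
      using summable_on_cmult_right[OF ys(1), of "norm (?x d)"] by (simp add: norm_mult)
  next
    have eq: "(\<lambda>d. infsum (\<lambda>k. norm (?f (d, k))) UNIV) = (\<lambda>d. norm (?x d) * infsum (\<lambda>k. norm (?y k)) UNIV)"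
      by (simp add: norm_mult infsum_cmult_right')
    have "(\<lambda>d. norm (?x d) * infsum (\<lambda>k. norm (?y k)) UNIV) summable_on UNIV"
      using summable_on_cmult_left[OF xs(1)] by simp
    then have "(\<lambda>d. norm (norm (?x d) * infsum (\<lambda>k. norm (?y k)) UNIV)) summable_on UNIV"
      by (simp add: abs_mult infsum_nonneg)
    then show "(\<lambda>d. norm (infsum (\<lambda>k. norm (?f (d, k))) UNIV)) summable_on UNIV"
      using fun_cong[OF eq] by (simp only:)
  qed
  then obtain S where S: "(?f has_sum S) (UNIV \<times> UNIV)"
    using Infinite_Sum.abs_summable_summable summable_on_def by blast
  have "((\<lambda>d. ?x d * zeta_series s) has_sum S) UNIV"
  proof (rule has_sum_SigmaD[OF S])
    fix d show "((\<lambda>k. ?f (d, k)) has_sum ?x d * zeta_series s) UNIV"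
      using has_sum_cmult_right[OF ys(2)] by simp
  qed
  moreover have "((\<lambda>d. ?x d * zeta_series s) has_sum (mangoldt_series s * zeta_series s)) UNIV"
    by (rule has_sum_cmult_left[OF xs(2)])
  ultimately have "S = mangoldt_series s * zeta_series s" by (rule has_sum_unique)
  let ?B = "{1::nat..} \<times> {1::nat..}"
  let ?A = "SIGMA n:{1::nat..}. {d. d dvd n}"
  have "(?f has_sum S) ?B"
    using S by (subst (asm) has_sum_cong_neutral[where g = ?f and T = ?B]) (auto simp: not_le)
  moreover have "bij_betw (\<lambda>(n,d). (d, n div d)) ?A ?B"
    by (rule bij_betwI[where g = "\<lambda>(d,k). (d * k, d)"]) (auto elim!: dvdE)
  ultimately have "((\<lambda>z. ?f ((\<lambda>(n,d). (d, n div d)) z)) has_sum S) ?A"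
    by (subst has_sum_reindex_bij_betw) auto
  then have "((\<lambda>(n,d). mangoldt d * of_nat n powr (-s)) has_sum S) ?A"
  proof (rule has_sum_cong[THEN iffD1, rotated])
    fix z assume "z \<in> ?A"
    then obtain n d where z: "z = (n, d)" "n \<ge> 1" "d dvd n" by auto
    then obtain k where k: "n = d * k" by (auto elim: dvdE)
    have "d > 0" "k > 0" using k z by (auto intro: Nat.gr0I)
    then show "?f ((\<lambda>(n,d). (d, n div d)) z) = (\<lambda>(n,d). mangoldt d * of_nat n powr (-s)) z"
      by (simp add: z k powr_times_real)
  qed
  then have "((\<lambda>n. of_real (ln (real n)) * of_nat n powr (-s)) has_sum S) {1::nat..}"
  proof (rule has_sum_SigmaD)
    fix n :: nat assume n: "n \<in> {1..}"
    have "(of_real (ln (real n)) * of_nat n powr (-s) :: complex) = (\<Sum>d | d dvd n. mangoldt d * of_nat n powr (-s))"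
      using mangoldt_sum[of n, where 'a = complex] n by (simp add: sum_distrib_right[symmetric])
    moreover have "finite {d. d dvd n}" using n by simp
    ultimately show "((\<lambda>y. (\<lambda>(n,d). mangoldt d * of_nat n powr (-s)) (n, y)) has_sum (of_real (ln (real n)) * of_nat n powr (-s) :: complex)) {d. d dvd n}"
      using has_sum_finite[of "{d. d dvd n}"] by simp
  qed
  then have "((\<lambda>n. of_real (ln (real n)) * of_nat n powr (-s)) has_sum S) (UNIV :: nat set)"
    by (subst (asm) has_sum_cong_neutral[where g = "\<lambda>n. of_real (ln (real n)) * of_nat n powr (-s)" and T = UNIV]) auto
  then show ?thesis using has_sum_imp_sums \<open>S = _\<close> by simp
qed

lemma zeta_deriv:
  assumes s: "Re s > 1"
  shows "(zeta_series has_field_derivative - (mangoldt_series s * zeta_series s)) (at s)"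
proof -
  obtain D where D: "(\<lambda>n. 1 * (- of_real (ln (real n)) * of_nat n powr (-s))) sums D"
    "(zeta_series has_field_derivative D) (at s)"
    using dirichlet_deriv[of "\<lambda>_. 1", OF _ s] unfolding zeta_series_def by auto
  have "(\<lambda>n. - (of_real (ln (real n)) * of_nat n powr (-s))) sums D" using D(1) by simp
  moreover have "(\<lambda>n. - (of_real (ln (real n)) * of_nat n powr (-s))) sums (- (mangoldt_series s * zeta_series s))"
    by (rule sums_minus[OF zeta_mult_mangoldt[OF s]])
  ultimately have "D = - (mangoldt_series s * zeta_series s)" by (rule sums_unique2)
  with D(2) show ?thesis by simp
qed

text \<open>
  Far to the right only the first term survives, as \<open>n^{-x} \<le> 2^{2-x} n^{-2}\<close> for \<open>n \<ge> 2\<close>.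
\<close>

lemma dirichlet_tendsto:
  assumes a: "\<And>n. norm (a n) \<le> 1"
  shows "((\<lambda>x. dirichlet a (of_real x)) \<longlongrightarrow> a 1) at_top"
proof -
  obtain C where C: "(\<lambda>n. real n powr (-2)) sums C"
    using summable_nat_powr[of 2] by (auto simp: summable_def)
  have bound: "norm (dirichlet a (of_real x) - a 1) \<le> 2 powr (2 - x) * C" if x: "x \<ge> 2" for x
  proof -
    let ?f = "\<lambda>n. a n * of_nat n powr (- of_real x) :: complex"
    have "?f sums dirichlet a (of_real x)" using dirichlet_sums[OF a, of "of_real x"] x by simp
    then have "(\<lambda>n. ?f n - (if n = 1 then a 1 else 0)) sums (dirichlet a (of_real x) - a 1)"
      by (intro sums_diff sums_single)
    moreover have "norm (?f n - (if n = 1 then a 1 else 0)) \<le> 2 powr (2 - x) * real n powr (-2)" for n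
    proof (cases "n \<le> 1")
      case True
      then have "n = 0 \<or> n = 1" by auto
      then show ?thesis by auto
    next
      case False
      have "norm (?f n) \<le> 1 * real n powr (-x)"
        unfolding norm_mult norm_nat_powr by (rule mult_mono) (use a in auto)
      also have "real n powr (-x) = real n powr (2 - x) * real n powr (-2)"
        by (simp add: powr_add[symmetric])
      also have "real n powr (2 - x) \<le> 2 powr (2 - x)"
        using False x by (intro powr_mono2') auto
      finally show ?thesis using False by (simp add: mult_right_mono)
    qed
    moreover have "(\<lambda>n. 2 powr (2 - x) * real n powr (-2)) sums (2 powr (2 - x) * C)"
      by (rule sums_mult[OF C])
    ultimately show ?thesis
      by (smt (verit) norm_suminf_le sums_iff)
  qed
  have "((\<lambda>x::real. 2 powr (2 - x) * C) \<longlongrightarrow> 0) at_top" by real_asymp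
  then have "((\<lambda>x. dirichlet a (of_real x) - a 1) \<longlongrightarrow> 0) at_top"
    by (rule Lim_null_comparison[rotated]) (use bound in \<open>auto intro: eventually_at_top_linorderI[of 2]\<close>)
  then show ?thesis by (simp add: LIM_zero_iff)
qed

text \<open>
  The function \<open>\<zeta> e^{-log_zeta}\<close> has derivative zero by \<open>zeta_deriv\<close> and \<open>log_zeta_deriv\<close>, and it tends
  to \<open>1\<close> along the positive real axis.  In particular \<open>\<zeta>\<close> has no zeros with \<open>Re s > 1\<close>.
\<close>

lemma zeta_eq_exp_log_zeta:
  assumes s: "Re s > 1"
  shows "zeta_series s = exp (log_zeta s)"
proof -
  let ?S = "{z::complex. Re z > 1}"
  let ?F = "\<lambda>s. zeta_series s * exp (- log_zeta s)"
  have "\<exists>c. \<forall>z\<in>?S. ?F z = c"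
  proof (rule has_field_derivative_zero_constant)
    show "convex ?S" by (rule convex_halfspace_Re_gt)
    fix z assume "z \<in> ?S"
    then have z: "Re z > 1" by simp
    have "(?F has_field_derivative 0) (at z)"
      by (rule derivative_eq_intros zeta_deriv[OF z] log_zeta_deriv(1)[OF z] refl)+ (simp add: algebra_simps)
    then show "(?F has_field_derivative 0) (at z within ?S)" by (rule has_field_derivative_at_within)
  qed
  then obtain c where c: "\<And>z. Re z > 1 \<Longrightarrow> ?F z = c" by auto
  have "((\<lambda>x. ?F (of_real x)) \<longlongrightarrow> 1 * exp (- (mangoldt 1 / of_real (ln (real 1))))) at_top"
    unfolding zeta_series_def log_zeta_def
    by (intro tendsto_intros dirichlet_tendsto mangoldt_over_ln_le) auto
  moreover have "((\<lambda>x. ?F (of_real x)) \<longlongrightarrow> c) at_top"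
    by (rule tendsto_eventually, rule eventually_at_top_linorderI[of 2]) (simp add: c)
  ultimately have "1 * exp (- (mangoldt 1 / of_real (ln (real 1)))) = c"
    by (rule tendsto_unique[OF trivial_limit_at_top_linorder])
  then have "c = 1" by simp
  with c[OF s] show ?thesis by (simp add: exp_minus field_simps)
qed

text \<open>
  The logarithm of the left-hand side is \<open>\<Sum> \<Lambda>(n) / ln n * n^{-x} (3 + 4 cos \<phi> + cos 2\<phi>)\<close> with
  \<open>\<phi> = t ln n\<close>, and \<open>3 + 4 cos \<phi> + cos 2\<phi> = 2 (1 + cos \<phi>)\<^sup>2\<close>.
\<close>

lemma zeta_3_4_1:
  assumes x: "x > 1"
  shows "norm (zeta_series (of_real x)) ^ 3 * norm (zeta_series (Complex x t)) ^ 4 *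
           norm (zeta_series (Complex x (2 * t))) \<ge> 1"
proof -
  let ?a = "\<lambda>n. mangoldt n / of_real (ln (real n)) :: complex"
  have Re_sums: "(\<lambda>n. mangoldt n / ln (real n) * (real n powr (-x) * cos (u * ln (real n)))) sums Re (log_zeta (Complex x u))" for u
  proof -
    have "(\<lambda>n. Re (?a n * of_nat n powr (- Complex x u))) sums Re (log_zeta (Complex x u))"
      unfolding log_zeta_def by (intro sums_Re dirichlet_sums mangoldt_over_ln_le) (use x in simp)
    moreover have "Re (?a n * of_nat n powr (- Complex x u)) =
       mangoldt n / ln (real n) * (real n powr (-x) * cos (u * ln (real n)))" for n
    proof (cases "n = 0")
      case False
      have "?a n = of_real (mangoldt n / ln (real n))" by simp
      moreover have "Re (of_nat n powr (- Complex x u)) = real n powr (-x) * cos (u * ln (real n))"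
        using False by (simp add: powr_def Re_exp mult.commute)
      ultimately show ?thesis by (metis Re_complex_of_real Im_complex_of_real times_complex.sel(1) mult_zero_left diff_zero)
    qed simp
    ultimately show ?thesis by (simp only:)
  qed
  have "0 \<le> 3 * Re (log_zeta (Complex x 0)) + 4 * Re (log_zeta (Complex x t)) + Re (log_zeta (Complex x (2 * t)))"
  proof (rule sums_le[OF _ sums_zero])
    show "(\<lambda>n. 3 * (mangoldt n / ln (real n) * (real n powr (-x) * cos (0 * ln (real n)))) +
       4 * (mangoldt n / ln (real n) * (real n powr (-x) * cos (t * ln (real n)))) +
       mangoldt n / ln (real n) * (real n powr (-x) * cos (2 * t * ln (real n)))) sums
       (3 * Re (log_zeta (Complex x 0)) + 4 * Re (log_zeta (Complex x t)) + Re (log_zeta (Complex x (2 * t))))"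
      by (intro sums_add sums_mult Re_sums)
    fix n :: nat
    let ?\<theta> = "t * ln (real n)"
    have poly: "3 * (q * (r * 1)) + 4 * (q * (r * c)) + q * (r * (2 * c\<^sup>2 - 1)) = q * r * (2 * (1 + c)^2)" for q r c :: real
      by (simp add: power2_eq_square algebra_simps)
    have "3 * (mangoldt n / ln (real n) * (real n powr (-x) * cos (0 * ln (real n)))) +
       4 * (mangoldt n / ln (real n) * (real n powr (-x) * cos ?\<theta>)) +
       mangoldt n / ln (real n) * (real n powr (-x) * cos (2 * t * ln (real n))) =
       mangoldt n / ln (real n) * (real n powr (-x)) * (2 * (1 + cos ?\<theta>)^2)"
      using poly[of "mangoldt n / ln (real n)" "real n powr (-x)" "cos ?\<theta>"] cos_double_cos[of ?\<theta>]
      by (simp only: mult.assoc mult_zero_left cos_zero)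
    also have "\<dots> \<ge> 0"
    proof -
      have "ln (real n) \<ge> 0" by (cases "n = 0") auto
      then show ?thesis by (intro mult_nonneg_nonneg divide_nonneg_nonneg) (auto simp: mangoldt_nonneg)
    qed
    finally show "0 \<le> 3 * (mangoldt n / ln (real n) * (real n powr (-x) * cos (0 * ln (real n)))) +
       4 * (mangoldt n / ln (real n) * (real n powr (-x) * cos ?\<theta>)) +
       mangoldt n / ln (real n) * (real n powr (-x) * cos (2 * t * ln (real n)))" .
  qed
  then have "1 \<le> exp (3 * Re (log_zeta (Complex x 0)) + 4 * Re (log_zeta (Complex x t)) + Re (log_zeta (Complex x (2 * t))))"
    by simp
  also have "\<dots> = norm (zeta_series (Complex x 0)) ^ 3 * norm (zeta_series (Complex x t)) ^ 4 *
           norm (zeta_series (Complex x (2 * t)))"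
    using x by (simp add: zeta_eq_exp_log_zeta norm_exp_eq_Re exp_add exp_of_nat_mult[symmetric])
  finally show ?thesis by (simp add: complex_of_real_def)
qed

section \<open>The regularised zeta function (s - 1) \<zeta>(s)\<close>

lemma vector_differentiable_bound:
  fixes f :: "real \<Rightarrow> 'a :: real_normed_vector"
  assumes "\<And>x. x \<in> {a..b} \<Longrightarrow> (f has_vector_derivative f' x) (at x within {a..b})"
    and B: "\<And>x. x \<in> {a..b} \<Longrightarrow> norm (f' x) \<le> B" and "x \<in> {a..b}" "y \<in> {a..b}"
  shows "norm (f x - f y) \<le> B * norm (x - y)"
proof (rule differentiable_bound[where S = "{a..b}" and f' = "\<lambda>x h. h *\<^sub>R f' x"])
  fix x assume x: "x \<in> {a..b}"
  show "(f has_derivative (\<lambda>h. h *\<^sub>R f' x)) (at x within {a..b})"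
    using assms(1)[OF x] by (simp add: has_vector_derivative_def)
  show "onorm (\<lambda>h. h *\<^sub>R f' x) \<le> B"
    using B[OF x] by (intro onorm_le) (metis mult.commute mult_right_mono norm_ge_zero norm_scaleR real_norm_def)
qed (use assms in auto)

text \<open>
  Two bounds for the same difference: the first is the triangle inequality, the second the mean
  value inequality.  Their geometric mean is what makes the bounds for \<open>\<zeta>\<close> below grow only like
  the square root of \<open>\<bar>s\<bar>\<close>.
\<close>

lemma norm_powr_diff_le:
  assumes n: "n > 0" and u: "u \<in> {real n..real n + 1}" and s: "Re s > 0"
  shows "norm (of_nat n powr (-s) - of_real u powr (-s) :: complex) \<le> 2 * real n powr (- Re s)"
    and "norm (of_nat n powr (-s) - of_real u powr (-s) :: complex) \<le> norm s * real n powr (- Re s - 1)"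
proof -
  have nu: "norm (of_real u powr (-s) :: complex) \<le> real n powr (- Re s)"
    using u n s by (simp add: norm_powr_real_powr powr_mono2')
  have "norm (of_nat n powr (-s) - of_real u powr (-s) :: complex) \<le> real n powr (- Re s) + real n powr (- Re s)"
    by (rule order_trans[OF norm_triangle_ineq4 add_mono[OF _ nu]]) (simp add: norm_powr_real_powr)
  then show "norm (of_nat n powr (-s) - of_real u powr (-s) :: complex) \<le> 2 * real n powr (- Re s)" by simp
  have "norm (of_real (real n) powr (-s) - of_real u powr (-s) :: complex) \<le> norm s * real n powr (- Re s - 1) * norm (real n - u)"
  proof (rule vector_differentiable_bound)
    fix x assume x: "x \<in> {real n..real n + 1}"
    have xp: "x > 0" using x n by simp
    show "((\<lambda>x. of_real x powr (-s)) has_vector_derivative (-s * of_real x powr (-s - 1) :: complex)) (at x within {real n..real n + 1})"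
      by (rule has_vector_derivative_real_field has_vector_derivative_at_within)+ 
         (use xp in \<open>auto intro!: derivative_eq_intros\<close>)
    show "norm (-s * of_real x powr (-s - 1) :: complex) \<le> norm s * real n powr (- Re s - 1)"
      using x xp n s by (auto simp: norm_mult norm_powr_real_powr intro!: mult_left_mono powr_mono2')
  qed (use u in auto)
  also have "\<dots> \<le> norm s * real n powr (- Re s - 1) * 1"
    by (rule mult_left_mono) (use u in auto)
  finally show "norm (of_nat n powr (-s) - of_real u powr (-s) :: complex) \<le> norm s * real n powr (- Re s - 1)" by simp
qed

text \<open>
  This is \<open>(s - 1) * integral {n..n+1} (\<lambda>u. n^{-s} - u^{-s})\<close>, written without the integral so that it is
  visibly entire; multiplying by \<open>s - 1\<close> removes the pole from the outset.
\<close>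

definition zeta_corr :: "nat \<Rightarrow> complex \<Rightarrow> complex" where
  "zeta_corr n s = (s - 1) * of_nat n powr (-s) - of_nat n powr (1 - s) + of_nat (Suc n) powr (1 - s)"

lemma norm_zeta_corr_le:
  assumes n: "n > 0" and s: "Re s > 0"
  shows "norm (zeta_corr n s) \<le> norm (s - 1) * sqrt (2 * norm s) * real n powr (- Re s - 1 / 2)"
proof -
  define B where "B = sqrt (2 * norm s) * real n powr (- Re s - 1 / 2)"
  let ?f = "\<lambda>u::real. of_real u * ((s - 1) * of_nat n powr (-s)) + of_real u powr (1 - s) :: complex"
  have le: "norm (of_nat n powr (-s) - of_real u powr (-s) :: complex) \<le> B" if "u \<in> {real n..real n + 1}" for u
  proof (rule power2_le_imp_le)
    have "norm (of_nat n powr (-s) - of_real u powr (-s) :: complex) ^ 2 \<le> (2 * real n powr (- Re s)) * (norm s * real n powr (- Re s - 1))"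
      unfolding power2_eq_square by (rule mult_mono norm_powr_diff_le that n s)+ auto
    also have "\<dots> = 2 * norm s * (real n powr (- Re s) * real n powr (- Re s - 1))" by simp
    also have "real n powr (- Re s) * real n powr (- Re s - 1) = (real n powr (- Re s - 1 / 2)) ^ 2"
      by (simp add: power2_eq_square powr_add[symmetric])
    finally show "norm (of_nat n powr (-s) - of_real u powr (-s) :: complex) ^ 2 \<le> B ^ 2"
      by (simp add: B_def power_mult_distrib)
  qed (simp add: B_def)
  have "norm (?f (real n + 1) - ?f (real n)) \<le> (norm (s - 1) * B) * norm (real n + 1 - real n)"
  proof (rule vector_differentiable_bound)
    fix x assume x: "x \<in> {real n..real n + 1}"
    have xp: "x > 0" using x n by simp
    show "(?f has_vector_derivative (s - 1) * (of_nat n powr (-s) - of_real x powr (-s))) (at x within {real n..real n + 1})"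
      by (rule has_vector_derivative_real_field has_vector_derivative_at_within)+ 
         (use xp in \<open>auto intro!: derivative_eq_intros simp: algebra_simps\<close>)
    show "norm ((s - 1) * (of_nat n powr (-s) - of_real x powr (-s))) \<le> norm (s - 1) * B"
      unfolding norm_mult by (intro mult_left_mono le x) auto
  qed auto
  moreover have "?f (real n + 1) - ?f (real n) = zeta_corr n s"
    by (simp add: zeta_corr_def algebra_simps)
  ultimately show ?thesis by (simp add: B_def)
qed

lemma zeta_corr_holomorphic: "zeta_corr n holomorphic_on A" if "n > 0"
  unfolding zeta_corr_def using that by (auto intro!: holomorphic_intros)

text \<open>
  Mean value theorem for \<open>u^{-1/4}\<close>; this makes \<open>\<Sum> n^{-5/4}\<close> comparable to a telescoping sum.
\<close>

lemma powr_five_quarters_le: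
  assumes n: "n > 0"
  shows "real (Suc n) powr (- 5 / 4) \<le> 4 * real n powr (- 1 / 4) - 4 * real (Suc n) powr (- 1 / 4)"
proof -
  have "\<exists>z>real n. z < real (Suc n) \<and> real (Suc n) powr (-1/4) - real n powr (-1/4) = (real (Suc n) - real n) * (-1/4 * z powr (-1/4 - 1))"
    by (rule MVT2) (use n in \<open>auto intro!: derivative_eq_intros simp: field_simps\<close>)
  then obtain z where z: "z > real n" "z < real (Suc n)" "real (Suc n) powr (-1/4) - real n powr (-1/4) = -1/4 * z powr (-1/4 - 1)"
    by auto
  have "real (Suc n) powr (- 5 / 4) \<le> z powr (- 5 / 4)" using z n by (intro powr_mono2') auto
  then show ?thesis using z by simp
qed

lemma sum_powr_five_quarters_le: "(\<Sum>n<N. real (Suc n) powr (- 5 / 4)) \<le> 5"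
proof -
  have "(\<Sum>n<Suc N. real (Suc n) powr (- 5 / 4)) \<le> 5 - 4 * real (Suc N) powr (- 1 / 4)" for N
  proof (induction N)
    case (Suc N)
    then show ?case using powr_five_quarters_le[of "Suc N"] by simp
  qed simp
  from this[of N] show ?thesis
    using powr_ge_zero[of "real (Suc N)" "- 1 / 4"] powr_ge_zero[of "real (Suc N)" "- 5 / 4"]
    unfolding sum.lessThan_Suc by linarith
qed

lemma summable_powr_five_quarters: "summable (\<lambda>n. real (Suc n) powr (- 5 / 4))"
  using summable_nat_powr[of "5/4"] by (subst summable_Suc_iff) simp

text \<open>
  The function \<open>(s - 1) \<zeta>(s)\<close> (see \<open>zeta_reg_eq\<close>), in a form that makes sense for \<open>Re s > 3/4\<close>.
\<close>

definition zeta_reg :: "complex \<Rightarrow> complex" where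
  "zeta_reg s = 1 + (\<Sum>n. zeta_corr (Suc n) s)"

lemma norm_zeta_corr_le':
  assumes s: "Re s > 3 / 4"
  shows "norm (zeta_corr (Suc n) s) \<le> norm (s - 1) * sqrt (2 * norm s) * real (Suc n) powr (- 5 / 4)"
proof -
  have "norm (zeta_corr (Suc n) s) \<le> norm (s - 1) * sqrt (2 * norm s) * real (Suc n) powr (- Re s - 1 / 2)"
    using s by (intro norm_zeta_corr_le) auto
  also have "\<dots> \<le> norm (s - 1) * sqrt (2 * norm s) * real (Suc n) powr (- 5 / 4)"
    using s by (intro mult_left_mono powr_mono) auto
  finally show ?thesis .
qed

text \<open>
  The constant is \<open>5 * sqrt 2\<close>, with \<open>5\<close> from \<open>\<Sum> n^{-5/4} \<le> 5\<close>.
\<close>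

lemma zeta_reg_minus_1_le:
  assumes s: "Re s > 3 / 4"
  shows "norm (zeta_reg s - 1) \<le> 7.1 * norm (s - 1) * sqrt (norm s)"
proof -
  have "norm (\<Sum>n. zeta_corr (Suc n) s) \<le> (\<Sum>n. norm (s - 1) * sqrt (2 * norm s) * real (Suc n) powr (- 5 / 4))"
    by (rule norm_suminf_le[OF norm_zeta_corr_le'[OF s] summable_mult[OF summable_powr_five_quarters]])
  also have "\<dots> = norm (s - 1) * sqrt (2 * norm s) * (\<Sum>n. real (Suc n) powr (- 5 / 4))"
    by (rule suminf_mult[OF summable_powr_five_quarters])
  also have "\<dots> \<le> norm (s - 1) * sqrt (2 * norm s) * 5"
    by (intro mult_left_mono suminf_le_const[OF summable_powr_five_quarters sum_powr_five_quarters_le]) auto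
  also have "\<dots> = (5 * sqrt 2) * (norm (s - 1) * sqrt (norm s))" by (simp add: real_sqrt_mult)
  also have "\<dots> \<le> 7.1 * (norm (s - 1) * sqrt (norm s))"
  proof (rule mult_right_mono)
    have "sqrt 2 \<le> 1.42" by (rule real_le_lsqrt) (auto simp: power2_eq_square)
    then show "5 * sqrt 2 \<le> 7.1" by simp
  qed auto
  finally show ?thesis by (simp add: zeta_reg_def)
qed

lemma zeta_reg_holomorphic: "zeta_reg holomorphic_on {s. Re s > 3 / 4}"
proof -
  let ?S = "{s::complex. Re s > 3 / 4}"
  have S: "open ?S" by (rule open_halfspace_Re_gt)
  have "\<exists>g g'. \<forall>x\<in>?S. ((\<lambda>n. zeta_corr (Suc n) x) sums g x) \<and> ((\<lambda>n. deriv (zeta_corr (Suc n)) x) sums g' x) \<and> (g has_field_derivative g' x) (at x)"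
  proof (rule series_and_derivative_comparison_local[OF S])
    fix n x assume "x \<in> ?S"
    show "(zeta_corr (Suc n) has_field_derivative deriv (zeta_corr (Suc n)) x) (at x)"
      by (rule holomorphic_derivI[OF zeta_corr_holomorphic[of "Suc n" UNIV]]) auto
  next
    fix x assume x: "x \<in> ?S"
    define C where "C = (norm (x - 1) + 1) * sqrt (2 * (norm x + 1))"
    have "norm (zeta_corr (Suc n) y) \<le> C * real (Suc n) powr (- 5 / 4)" if y: "y \<in> ball x 1 \<inter> ?S" for n y
    proof -
      have d: "norm (y - x) < 1" using y by (simp add: dist_norm norm_minus_commute)
      have n1: "norm y \<le> norm x + 1" using d norm_triangle_ineq[of "y - x" x] by simp
      have n2: "norm (y - 1) \<le> norm (x - 1) + 1" using d norm_triangle_ineq[of "y - x" "x - 1"] by simp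
      have "norm (zeta_corr (Suc n) y) \<le> norm (y - 1) * sqrt (2 * norm y) * real (Suc n) powr (- 5 / 4)"
        using y by (intro norm_zeta_corr_le') auto
      also have "\<dots> \<le> C * real (Suc n) powr (- 5 / 4)"
        unfolding C_def using n1 n2 by (intro mult_right_mono mult_mono real_sqrt_le_mono) auto
      finally show ?thesis .
    qed
    moreover have "summable (\<lambda>n. C * real (Suc n) powr (- 5 / 4))"
      by (rule summable_mult[OF summable_powr_five_quarters])
    ultimately show "\<exists>d h. 0 < d \<and> summable h \<and> (\<forall>\<^sub>F n in sequentially. \<forall>y\<in>ball x d \<inter> ?S. norm (zeta_corr (Suc n) y) \<le> h n)"
      by (intro exI[of _ 1] exI[of _ "\<lambda>n. C * real (Suc n) powr (- 5 / 4)"] conjI always_eventually) auto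
  qed
  then obtain g g' where g: "\<forall>x\<in>?S. ((\<lambda>n. zeta_corr (Suc n) x) sums g x) \<and> (g has_field_derivative g' x) (at x)"
    by blast
  have "g holomorphic_on ?S"
    using g has_field_derivative_at_within unfolding holomorphic_on_def field_differentiable_def by blast
  then have "(\<lambda>s. 1 + g s) holomorphic_on ?S" by (intro holomorphic_intros)
  then show ?thesis
    by (rule holomorphic_transform) (use g in \<open>auto simp: zeta_reg_def sums_iff\<close>)
qed

text \<open>
  Summing the corrections up to \<open>N\<close> telescopes to
  \<open>(s - 1) \<Sum>n\<le>N. n^{-s} - 1 + (N + 1)^{1-s}\<close>.
\<close>

lemma zeta_reg_eq:
  assumes s: "Re s > 1"
  shows "zeta_reg s = (s - 1) * zeta_series s"
proof -
  have partial: "(\<Sum>n<N. zeta_corr (Suc n) s) = (s - 1) * (\<Sum>n<N. of_nat (Suc n) powr (-s)) - 1 + of_nat (Suc N) powr (1 - s)" for N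
    by (induction N) (simp_all add: zeta_corr_def algebra_simps)
  have "(\<lambda>n. of_nat n powr (-s)) sums zeta_series s"
    using dirichlet_sums[of "\<lambda>_. 1" s] s by (simp add: zeta_series_def)
  then have "(\<lambda>n. of_nat (Suc n) powr (-s)) sums zeta_series s"
    using sums_Suc_iff[of "\<lambda>n. of_nat n powr (-s)" "zeta_series s"] by simp
  then have "(\<lambda>N. \<Sum>n<N. of_nat (Suc n) powr (-s)) \<longlonglongrightarrow> zeta_series s" by (simp add: sums_def)
  moreover have "(\<lambda>N. of_nat (Suc N) powr (1 - s) :: complex) \<longlonglongrightarrow> 0"
  proof (rule tendsto_norm_zero_cancel)
    have "norm (of_nat (Suc N) powr (1 - s) :: complex) = real (Suc N) powr (1 - Re s)" for N
      using norm_nat_powr[of "Suc N" "s - 1"] by (simp only: minus_diff_eq minus_complex.sel one_complex.sel)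
    moreover have "(\<lambda>N. real (Suc N) powr (1 - Re s)) \<longlonglongrightarrow> 0"
      using s by real_asymp
    ultimately show "(\<lambda>N. norm (of_nat (Suc N) powr (1 - s) :: complex)) \<longlonglongrightarrow> 0" by simp
  qed
  ultimately have "(\<lambda>N. \<Sum>n<N. zeta_corr (Suc n) s) \<longlonglongrightarrow> (s - 1) * zeta_series s - 1 + 0"
    unfolding partial by (intro tendsto_intros)
  then have "(\<lambda>n. zeta_corr (Suc n) s) sums ((s - 1) * zeta_series s - 1)" by (simp add: sums_def)
  then show ?thesis by (simp add: zeta_reg_def sums_iff)
qed

section \<open>Explicit bounds for the logarithmic derivative near the line Re s = 1\<close>

lemma open_Re_gt: "open {s. Re s > c}"
  by (rule open_halfspace_Re_gt)

lemma zeta_reg_has_deriv: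
  assumes "Re s > 3 / 4"
  shows "(zeta_reg has_field_derivative deriv zeta_reg s) (at s)"
  by (rule holomorphic_derivI[OF zeta_reg_holomorphic open_Re_gt]) (use assms in simp)

lemma deriv_zeta_reg_has_deriv:
  assumes "Re s > 3 / 4"
  shows "(deriv zeta_reg has_field_derivative deriv (deriv zeta_reg) s) (at s)"
  by (rule holomorphic_derivI[OF holomorphic_deriv[OF zeta_reg_holomorphic open_Re_gt] open_Re_gt]) (use assms in simp)

lemma zeta_reg_nonzero: "Re s > 1 \<Longrightarrow> zeta_reg s \<noteq> 0"
  using zeta_reg_eq[of s] zeta_eq_exp_log_zeta[of s] by auto

lemma norm_strip_le:
  assumes "1 < Re s" "Re s \<le> 1 + 1 / 100"
  shows "norm (s - 1) \<le> \<bar>Im s\<bar> + 1 / 100" "norm s \<le> \<bar>Im s\<bar> + 1 + 1 / 100"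
  using cmod_le[of "s - 1"] cmod_le[of s] assms by auto

text \<open>
  Cauchy's inequalities on the circle of radius \<open>1/4\<close>, which stays inside \<open>Re s > 3/4\<close>.
\<close>

lemma zeta_reg_derivs_le:
  assumes s: "1 < Re s" "Re s \<le> 1 + 1 / 100"
  defines "B \<equiv> 1 + 7.1 * (\<bar>Im s\<bar> + 0.26) * sqrt (\<bar>Im s\<bar> + 1.26)"
  shows "norm (deriv zeta_reg s) \<le> 4 * B" and "norm (deriv (deriv zeta_reg) s) \<le> 32 * B"
proof -
  have ball: "Re z > 3 / 4" if "z \<in> cball s (1/4)" for z
  proof -
    have "Re s - Re z \<le> norm (s - z)" using abs_Re_le_cmod[of "s - z"] by simp
    also have "\<dots> \<le> 1 / 4" using that by (simp add: dist_norm)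
    finally show ?thesis using s by simp
  qed
  have sub: "cball s (1/4) \<subseteq> {s. Re s > 3 / 4}" using ball by auto
  have hol: "zeta_reg holomorphic_on ball s (1/4)"
    by (rule holomorphic_on_subset[OF zeta_reg_holomorphic order_trans[OF ball_subset_cball sub]])
  have cont: "continuous_on (cball s (1/4)) zeta_reg"
    by (rule holomorphic_on_imp_continuous_on[OF holomorphic_on_subset[OF zeta_reg_holomorphic sub]])
  have bound: "norm (zeta_reg x) \<le> B" if x: "norm (s - x) = 1 / 4" for x
  proof -
    have "x \<in> cball s (1/4)" using x by (simp add: dist_norm)
    then have "norm (zeta_reg x - 1) \<le> 7.1 * norm (x - 1) * sqrt (norm x)"
      by (intro zeta_reg_minus_1_le ball)
    also have "\<dots> \<le> 7.1 * (\<bar>Im s\<bar> + 0.26) * sqrt (\<bar>Im s\<bar> + 1.26)"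
      using norm_triangle_ineq4[of s "s - x"] norm_triangle_ineq4[of "s - 1" "s - x"] norm_strip_le[OF s] x
      by (intro mult_mono real_sqrt_le_mono) auto
    finally have le: "norm (zeta_reg x - 1) \<le> 7.1 * (\<bar>Im s\<bar> + 0.26) * sqrt (\<bar>Im s\<bar> + 1.26)" .
    have "norm (zeta_reg x) \<le> 1 + norm (zeta_reg x - 1)"
      using norm_triangle_ineq[of 1 "zeta_reg x - 1"] by simp
    also have "\<dots> \<le> B" unfolding B_def by (rule add_left_mono[OF le])
    finally show ?thesis .
  qed
  show "norm (deriv zeta_reg s) \<le> 4 * B"
    using Cauchy_inequality[OF hol cont _ bound, of 1] by simp
  show "norm (deriv (deriv zeta_reg) s) \<le> 32 * B"
    using Cauchy_inequality[OF hol cont _ bound, of 2] by (simp add: power2_eq_square numeral_2_eq_2)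
qed

text \<open>
  All estimates below are for \<open>\<bar>Im s\<bar> \<le> T\<close>.  The parameter \<open>T\<close> will eventually be \<open>L\<^sup>2 / 5\<close>
  with \<open>L \<ge> 95\<close>, so it is safe to assume that it is large, which keeps the constants small.
\<close>

locale zero_free_height =
  fixes T :: real
  assumes T: "T \<ge> 1000"
begin

definition q :: real where "q = sqrt (T + 2)"

text \<open>
  For \<open>1/10 \<le> \<bar>Im s\<bar> \<le> T\<close> and \<open>1 < Re s \<le> 1.01\<close> the derivative of \<open>zeta_reg\<close> is
  at most \<open>slope * \<bar>Im s\<bar>\<close>, see \<open>deriv_le_mid\<close>.
\<close>

definition slope :: real where "slope = 36 * q"

text \<open>
  An upper bound for \<open>\<bar>\<zeta>(s)\<bar>\<close> at the height \<open>2t\<close> that enters the 3-4-1 inequality.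
\<close>

definition zbound :: real where "zbound = 10.5 * q"

text \<open>
  The width of the strip \<open>1 < Re s \<le> 1 + eta\<close> in which \<open>\<zeta>\<close> is bounded from below.  The value is
  chosen such that the lower bound \<open>eta^3 / (1.34 * zbound)\<close> for \<open>\<bar>\<zeta>\<bar>^4\<close> at \<open>Re s = 1 + eta\<close> equals
  \<open>(2 * slope * eta)^4\<close>: moving from there towards \<open>Re s = 1\<close> then loses at most half of the lower bound.
\<close>

definition eta :: real where "eta = 1 / (16 * slope ^ 4 * (1.34 * zbound))"

lemma q: "q \<ge> 31"
proof -
  have "sqrt (31 ^ 2) \<le> sqrt (T + 2)" using T by (intro real_sqrt_le_mono) auto
  then show ?thesis by (simp add: q_def)
qed

lemma eta_pos: "eta > 0" and eta_le: "eta \<le> 1 / 1000"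
proof -
  show "eta > 0" using q by (simp add: eta_def slope_def zbound_def)
  have "1000 \<le> 16 * (slope ^ 4 * (1.34 * zbound))"
  proof -
    have "(1::real) \<le> slope ^ 4" using q by (intro one_le_power) (simp add: slope_def)
    then have "1 * (1.34 * 325) \<le> slope ^ 4 * (1.34 * zbound)"
      using q by (intro mult_mono) (auto simp: zbound_def)
    then show ?thesis by simp
  qed
  then show "eta \<le> 1 / 1000" by (simp add: eta_def field_simps)
qed

lemma circle_bound_le:
  assumes "1 / 10 \<le> t" "t \<le> T"
  shows "1 + 7.1 * (t + 0.26) * sqrt (t + 1.26) \<le> 9 * t * q"
proof (cases "t \<le> 1")
  case True
  have "sqrt (t + 1.26) \<le> 1.51" by (rule real_le_lsqrt) (use True assms in \<open>auto simp: power2_eq_square\<close>)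
  then have "7.1 * (t + 0.26) * sqrt (t + 1.26) \<le> 7.1 * 1.26 * 1.51"
    using True assms by (intro mult_mono) auto
  moreover have "9 * (1/10) * 31 \<le> 9 * t * q" using assms q by (intro mult_mono) auto
  moreover have "(1::real) + 7.1 * 1.26 * 1.51 \<le> 9 * (1/10) * 31" by simp
  ultimately show ?thesis by (meson add_left_mono order_trans)
next
  case False
  have "sqrt (t + 1.26) \<le> q" unfolding q_def using assms by (intro real_sqrt_le_mono) auto
  then have "7.1 * (t + 0.26) * sqrt (t + 1.26) \<le> 7.1 * (1.26 * t) * q"
    using False assms by (intro mult_mono) auto
  moreover have "1 * 31 \<le> t * q" using False q by (intro mult_mono) auto
  from this have "1 + 7.1 * (1.26 * t) * q \<le> 9 * t * q" by simp
  ultimately show ?thesis by (meson add_left_mono order_trans)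
qed

lemma deriv_le_mid:
  assumes s: "1 < Re s" "Re s \<le> 1 + 1 / 100" and t: "1 / 10 \<le> \<bar>Im s\<bar>" "\<bar>Im s\<bar> \<le> T"
  shows "norm (deriv zeta_reg s) \<le> slope * \<bar>Im s\<bar>" "norm (deriv (deriv zeta_reg) s) \<le> 8 * slope * \<bar>Im s\<bar>"
  using zeta_reg_derivs_le[OF s] circle_bound_le[OF t] unfolding slope_def by (simp_all add: algebra_simps)

text \<open>
  The 3-4-1 inequality at \<open>\<sigma> = 1 + eta\<close>, with \<open>\<zeta>(1 + eta) \<le> 1.1 / eta\<close> and
  \<open>\<bar>\<zeta>(1 + eta + 2it)\<bar> \<le> zbound\<close>.
\<close>

lemma zeta_lower:
  assumes t: "1 / 10 \<le> \<bar>t\<bar>" "\<bar>t\<bar> \<le> T"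
  shows "norm (zeta_series (Complex (1 + eta) t)) \<ge> 2 * slope * eta"
proof -
  have e: "1 + eta > 1" "eta \<le> 1 / 100" using eta_pos eta_le by auto
  define z where "z = norm (zeta_series (Complex (1 + eta) t))"
  have z1: "norm (zeta_series (of_real (1 + eta))) \<le> 1.1 / eta"
  proof -
    have "norm (zeta_reg (of_real (1 + eta)) - 1) \<le> 7.1 * norm (of_real (1 + eta) - 1 :: complex) * sqrt (norm (of_real (1 + eta) :: complex))"
      by (rule zeta_reg_minus_1_le) (use e in simp)
    also have "norm (of_real (1 + eta) - 1 :: complex) = eta" using eta_pos by simp
    also have "norm (of_real (1 + eta) :: complex) = 1 + eta" using e by (simp del: of_real_add)
    also have "7.1 * eta * sqrt (1 + eta) \<le> 7.1 * (1 / 100) * 1.1"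
    proof (intro mult_mono)
      show "sqrt (1 + eta) \<le> 1.1" by (rule real_le_lsqrt) (use e in \<open>auto simp: power2_eq_square\<close>)
    qed (use e in auto)
    finally have "norm (zeta_reg (of_real (1 + eta))) \<le> 1.1"
      using norm_triangle_ineq[of "zeta_reg (of_real (1 + eta)) - 1" 1] by simp
    moreover have "zeta_reg (of_real (1 + eta)) = of_real eta * zeta_series (of_real (1 + eta))"
      using e by (subst zeta_reg_eq) auto
    ultimately show ?thesis using e by (simp add: norm_mult field_simps)
  qed
  have z2: "norm (zeta_series (Complex (1 + eta) (2 * t))) \<le> zbound"
  proof -
    let ?s = "Complex (1 + eta) (2 * t)"
    have "norm (zeta_reg ?s - 1) \<le> 7.1 * norm (?s - 1) * sqrt (norm ?s)"
      by (rule zeta_reg_minus_1_le) (use e in simp)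
    moreover have "norm (zeta_reg ?s) \<le> norm (zeta_reg ?s - 1) + 1"
      using norm_triangle_ineq[of "zeta_reg ?s - 1" 1] by simp
    moreover have "zeta_reg ?s = (?s - 1) * zeta_series ?s" using e by (subst zeta_reg_eq) auto
    ultimately have *: "norm (?s - 1) * norm (zeta_series ?s) \<le> 7.1 * norm (?s - 1) * sqrt (norm ?s) + 1"
      by (simp add: norm_mult)
    have ge: "norm (?s - 1) \<ge> 1 / 5" using abs_Im_le_cmod[of "?s - 1"] t by simp
    have "sqrt (norm ?s) \<le> sqrt (2 * (T + 2))"
      using norm_strip_le(2)[of ?s] e t T by (intro real_sqrt_le_mono) auto
    also have "\<dots> = sqrt 2 * q" unfolding q_def by (rule real_sqrt_mult)
    also have "\<dots> \<le> 1.42 * q"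
    proof (rule mult_right_mono)
      show "sqrt 2 \<le> 1.42" by (rule real_le_lsqrt) (auto simp: power2_eq_square)
    qed (use q in simp)
    finally have sq: "sqrt (norm ?s) \<le> 1.42 * q" .
    have "norm (?s - 1) * norm (zeta_series ?s) \<le> norm (?s - 1) * (7.1 * sqrt (norm ?s) + 5)"
      using * ge by (simp add: algebra_simps)
    then have "norm (zeta_series ?s) \<le> 7.1 * sqrt (norm ?s) + 5"
      using ge by (subst (asm) mult_le_cancel_left_pos) auto
    also have "\<dots> \<le> zbound" using sq q by (simp add: zbound_def)
    finally show ?thesis .
  qed
  have pos: "zbound > 0" "slope > 0" using q by (auto simp: zbound_def slope_def)
  \<comment> \<open>the factor \<open>1.34\<close> exceeds \<open>1.1 ^ 3\<close>\<close>
  have "1 \<le> norm (zeta_series (of_real (1 + eta))) ^ 3 * z ^ 4 * norm (zeta_series (Complex (1 + eta) (2 * t)))"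
    unfolding z_def by (rule zeta_3_4_1[OF e(1)])
  also have "\<dots> \<le> (1.1 / eta) ^ 3 * z ^ 4 * zbound"
    using eta_pos by (intro mult_mono power_mono z1 z2) (auto simp: z_def)
  also have "\<dots> \<le> (1.34 * zbound) / eta ^ 3 * z ^ 4"
    using pos eta_pos by (simp add: field_simps power_divide)
  finally have "eta ^ 3 / (1.34 * zbound) \<le> z ^ 4" using pos eta_pos by (simp add: field_simps)
  moreover have "(2 * slope * eta) ^ 4 = eta ^ 3 / (1.34 * zbound)"
  proof -
    have "(2 * slope * eta) ^ 4 = eta ^ 3 * (16 * slope ^ 4 * eta)" by (simp add: power_mult_distrib power4_eq_xxxx power3_eq_cube)
    also have "16 * slope ^ 4 * eta = 1 / (1.34 * zbound)" using pos by (simp add: eta_def)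
    finally show ?thesis by simp
  qed
  ultimately have "(2 * slope * eta) ^ 4 \<le> z ^ 4" by simp
  then show ?thesis unfolding z_def using power_mono_iff[of "2 * slope * eta" "norm (zeta_series (Complex (1 + eta) t))" 4] pos eta_pos by simp
qed

text \<open>
  Travelling horizontally from \<open>Re s = 1 + eta\<close> changes \<open>zeta_reg\<close> by at most \<open>slope * \<bar>Im s\<bar> * eta\<close>,
  which is half of the lower bound available there.
\<close>

lemma zeta_reg_lower:
  assumes s: "1 < Re s" "Re s \<le> 1 + eta" and t: "1 / 10 \<le> \<bar>Im s\<bar>" "\<bar>Im s\<bar> \<le> T"
  shows "norm (zeta_reg s) \<ge> \<bar>Im s\<bar> * slope * eta"
proof -
  let ?s' = "Complex (1 + eta) (Im s)"
  have e: "eta \<le> 1 / 100" using eta_le by simp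
  have pos: "slope > 0" using q by (auto simp: slope_def)
  have "norm (zeta_reg s - zeta_reg ?s') \<le> (slope * \<bar>Im s\<bar>) * norm (s - ?s')"
  proof (rule field_differentiable_bound[of "closed_segment s ?s'"])
    fix z assume "z \<in> closed_segment s ?s'"
    then have z: "Im z = Im s" "1 < Re z" "Re z \<le> 1 + eta"
      using s by (auto simp: closed_segment_same_Im closed_segment_eq_real_ivl)
    show "(zeta_reg has_field_derivative deriv zeta_reg z) (at z within closed_segment s ?s')"
      by (rule has_field_derivative_at_within[OF zeta_reg_has_deriv]) (use z in simp)
    show "norm (deriv zeta_reg z) \<le> slope * \<bar>Im s\<bar>"
      using deriv_le_mid(1)[of z] z t e by simp
  qed auto
  also have "\<dots> \<le> (slope * \<bar>Im s\<bar>) * eta"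
    using s pos by (intro mult_left_mono) (auto simp: cmod_def)
  finally have d: "norm (zeta_reg s - zeta_reg ?s') \<le> slope * \<bar>Im s\<bar> * eta" .
  have "norm (zeta_reg ?s') = norm (?s' - 1) * norm (zeta_series ?s')"
    using eta_pos by (subst zeta_reg_eq) (auto simp: norm_mult)
  also have "\<dots> \<ge> \<bar>Im s\<bar> * (2 * slope * eta)"
    using abs_Im_le_cmod[of "?s' - 1"] zeta_lower[OF t] pos eta_pos by (intro mult_mono) auto
  finally have "norm (zeta_reg ?s') \<ge> \<bar>Im s\<bar> * (2 * slope * eta)" .
  with d show ?thesis using norm_triangle_ineq2[of "zeta_reg ?s'" "zeta_reg s"]
    by (simp add: norm_minus_commute algebra_simps)
qed

end

text \<open>
  The logarithmic derivative of \<open>(s - 1) \<zeta>(s)\<close>: the part of \<open>-\<zeta>'/\<zeta>\<close> that stays bounded near \<open>s = 1\<close>.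
\<close>

definition zeta_logderiv :: "complex \<Rightarrow> complex" where
  "zeta_logderiv s = deriv zeta_reg s / zeta_reg s"

lemma zeta_logderiv_holomorphic: "zeta_logderiv holomorphic_on {s. Re s > 1}"
  unfolding zeta_logderiv_def
  by (intro holomorphic_on_divide holomorphic_on_subset[OF zeta_reg_holomorphic]
      holomorphic_on_subset[OF holomorphic_deriv[OF zeta_reg_holomorphic open_Re_gt]])
     (auto simp: zeta_reg_nonzero)

lemma mangoldt_series_eq:
  assumes s: "Re s > 1"
  shows "mangoldt_series s = 1 / (s - 1) - zeta_logderiv s"
proof -
  have s1: "s \<noteq> 1" using s by auto
  have "((\<lambda>s. (s - 1) * zeta_series s) has_field_derivative (zeta_series s - (s - 1) * (mangoldt_series s * zeta_series s))) (at s)"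
    by (rule derivative_eq_intros zeta_deriv[OF s] refl)+ simp
  then have "(zeta_reg has_field_derivative (zeta_series s - (s - 1) * (mangoldt_series s * zeta_series s))) (at s)"
    by (rule has_field_derivative_transform_within_open[OF _ open_Re_gt[of 1]]) (use s zeta_reg_eq in auto)
  then have "deriv zeta_reg s = zeta_series s - (s - 1) * (mangoldt_series s * zeta_series s)"
    by (rule DERIV_imp_deriv)
  moreover have "zeta_series s \<noteq> 0" using zeta_eq_exp_log_zeta[OF s] by simp
  moreover have "(z - w * (m * z)) / (w * z) = 1 / w - m" if "z \<noteq> 0" "w \<noteq> 0" for z w m :: complex
    using that by (simp add: field_simps)
  ultimately show ?thesis using s1 by (simp add: zeta_logderiv_def zeta_reg_eq[OF s])
qed

lemma zeta_logderiv_deriv: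
  assumes s: "Re s > 1"
  shows "(zeta_logderiv has_field_derivative deriv (deriv zeta_reg) s / zeta_reg s - (zeta_logderiv s)^2) (at s)"
proof -
  have s': "Re s > 3 / 4" using s by simp
  show ?thesis unfolding zeta_logderiv_def
    by (rule derivative_eq_intros zeta_reg_has_deriv[OF s'] deriv_zeta_reg_has_deriv[OF s'] zeta_reg_nonzero[OF s] refl)+
       (simp add: zeta_reg_nonzero[OF s] field_simps power2_eq_square)
qed

context zero_free_height begin

text \<open>
  Away from the real axis the lower bound \<open>zeta_reg_lower\<close> applies; for \<open>\<bar>Im s\<bar> < 1/10\<close> the function
  \<open>zeta_reg\<close> is close to its value \<open>1\<close> at \<open>s = 1\<close>.
\<close>

lemma zeta_logderiv_le:
  assumes s: "1 < Re s" "Re s \<le> 1 + eta" and t: "\<bar>Im s\<bar> \<le> T"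
  shows "norm (zeta_logderiv s) \<le> 1 / eta" and "norm (deriv zeta_logderiv s) \<le> 2 / eta ^ 2"
proof -
  have e: "eta \<le> 1 / 100" using eta_le by simp
  have pos: "slope > 0" using q by (auto simp: slope_def)
  have *: "norm (zeta_logderiv s) \<le> 1 / eta \<and> norm (deriv (deriv zeta_reg) s / zeta_reg s) \<le> 8 / eta"
  proof (cases "1 / 10 \<le> \<bar>Im s\<bar>")
    case True
    note l = zeta_reg_lower[OF s True t]
    have l0: "\<bar>Im s\<bar> * slope * eta > 0" using True pos eta_pos by simp
    have "norm (deriv zeta_reg s) / norm (zeta_reg s) \<le> (slope * \<bar>Im s\<bar>) / (\<bar>Im s\<bar> * slope * eta)"
      using deriv_le_mid(1)[of s] s e True t l l0 pos by (intro frac_le) auto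
    moreover have "norm (deriv (deriv zeta_reg) s) / norm (zeta_reg s) \<le> (8 * slope * \<bar>Im s\<bar>) / (\<bar>Im s\<bar> * slope * eta)"
      using deriv_le_mid(2)[of s] s e True t l l0 pos by (intro frac_le) auto
    ultimately show ?thesis using True pos eta_pos by (auto simp: zeta_logderiv_def norm_divide)
  next
    case False
    have s': "Re s \<le> 1 + 1 / 100" using s e by simp
    have le: "1 + 7.1 * (\<bar>Im s\<bar> + 0.26) * sqrt (\<bar>Im s\<bar> + 1.26) \<le> 1 + 7.1 * 0.36 * 1.2"
    proof -
      have "sqrt (\<bar>Im s\<bar> + 1.26) \<le> 1.2" by (rule real_le_lsqrt) (use False in \<open>auto simp: power2_eq_square\<close>)
      then show ?thesis using False by (intro add_left_mono mult_mono) auto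
    qed
    have "norm (zeta_reg s - 1) \<le> 7.1 * norm (s - 1) * sqrt (norm s)"
      by (rule zeta_reg_minus_1_le) (use s in simp)
    also have "\<dots> \<le> 7.1 * 0.11 * 1.06"
    proof (intro mult_mono)
      show "sqrt (norm s) \<le> 1.06" by (rule real_le_lsqrt) (use False norm_strip_le(2)[OF s(1) s'] in \<open>auto simp: power2_eq_square\<close>)
    qed (use False norm_strip_le(1)[OF s(1) s'] in auto)
    finally have l: "norm (zeta_reg s) \<ge> 0.1"
      using norm_triangle_ineq2[of 1 "1 - zeta_reg s"] by (simp add: norm_minus_commute)
    have "norm (deriv zeta_reg s) / norm (zeta_reg s) \<le> 20 / 0.1"
      using zeta_reg_derivs_le(1)[OF s(1) s'] le l by (intro frac_le) auto
    moreover have "norm (deriv (deriv zeta_reg) s) / norm (zeta_reg s) \<le> 160 / 0.1"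
      using zeta_reg_derivs_le(2)[OF s(1) s'] le l by (intro frac_le) auto
    moreover have "1000 \<le> 1 / eta" using eta_pos eta_le by (simp add: field_simps)
    ultimately show ?thesis by (auto simp: zeta_logderiv_def norm_divide)
  qed
  then show "norm (zeta_logderiv s) \<le> 1 / eta" ..
  have "deriv zeta_logderiv s = deriv (deriv zeta_reg) s / zeta_reg s - (zeta_logderiv s)^2"
    by (rule DERIV_imp_deriv[OF zeta_logderiv_deriv[OF s(1)]])
  also have "norm \<dots> \<le> 8 / eta + (1 / eta) ^ 2"
    using * norm_triangle_ineq4[of "deriv (deriv zeta_reg) s / zeta_reg s" "(zeta_logderiv s)^2"]
      power_mono[of "norm (zeta_logderiv s)" "1 / eta" 2] by (simp add: norm_power)
  also have "\<dots> \<le> 2 / eta ^ 2"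
    using eta_pos eta_le by (simp add: field_simps power2_eq_square)
  finally show "norm (deriv zeta_logderiv s) \<le> 2 / eta ^ 2" .
qed

end

section \<open>The Fejer kernel\<close>

lemma cos_ge_quadratic: "cos x \<ge> 1 - x ^ 2 / 2" for x :: real
proof -
  have "sin (x / 2) ^ 2 \<le> (x / 2) ^ 2"
    using abs_sin_x_le_abs_x[of "x / 2"] by (metis abs_le_square_iff)
  then show ?thesis using cos_double_sin[of "x / 2"] by (simp add: power2_eq_square)
qed

lemma sin_ge_cubic: "sin x \<ge> x - x ^ 3 / 6" if "x \<ge> 0" for x :: real
proof -
  have "(\<lambda>x. sin x - x + x ^ 3 / 6) 0 \<le> (\<lambda>x::real. sin x - x + x ^ 3 / 6) x"
  proof (rule DERIV_nonneg_imp_nondecreasing[OF that])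
    fix u :: real
    have "((\<lambda>x. sin x - x + x ^ 3 / 6) has_real_derivative (cos u - 1 + u ^ 2 / 2)) (at u)"
      by (auto intro!: derivative_eq_intros)
    then show "\<exists>y. ((\<lambda>x. sin x - x + x ^ 3 / 6) has_real_derivative y) (at u) \<and> 0 \<le> y"
      using cos_ge_quadratic[of u] by (intro exI[of _ "cos u - 1 + u ^ 2 / 2"]) auto
  qed
  then show ?thesis by simp
qed

lemma cos_le_quartic: "cos x \<le> 1 - x ^ 2 / 2 + x ^ 4 / 24" for x :: real
proof -
  have "cos y \<le> 1 - y ^ 2 / 2 + y ^ 4 / 24" if y: "y \<ge> 0" for y :: real
  proof -
    have "(\<lambda>x. 1 - x ^ 2 / 2 + x ^ 4 / 24 - cos x) 0 \<le> (\<lambda>x::real. 1 - x ^ 2 / 2 + x ^ 4 / 24 - cos x) y"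
    proof (rule DERIV_nonneg_imp_nondecreasing[OF y])
      fix u :: real assume u: "0 \<le> u"
      have "((\<lambda>x. 1 - x ^ 2 / 2 + x ^ 4 / 24 - cos x) has_real_derivative (sin u - (u - u ^ 3 / 6))) (at u)"
        by (auto intro!: derivative_eq_intros)
      then show "\<exists>z. ((\<lambda>x. 1 - x ^ 2 / 2 + x ^ 4 / 24 - cos x) has_real_derivative z) (at u) \<and> 0 \<le> z"
        using sin_ge_cubic[OF u] by (intro exI[of _ "sin u - (u - u ^ 3 / 6)"]) auto
    qed
    then show ?thesis by simp
  qed
  from this[of "\<bar>x\<bar>"] show ?thesis by simp
qed

text \<open>
  The Fourier transform of the triangle function on \<open>{-T..T}\<close>.
\<close>

definition fejer :: "real \<Rightarrow> real \<Rightarrow> real" where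
  "fejer T u = integral {-T..T} (\<lambda>t. (1 - \<bar>t\<bar> / T) * cos (t * u))"

lemma fejer_has_integral:
  fixes T u :: real
  assumes T: "T > 0" and u: "u \<noteq> 0"
  shows "((\<lambda>t. (1 - \<bar>t\<bar> / T) * cos (t * u)) has_integral (2 * (1 - cos (T * u)) / (T * u ^ 2))) {-T..T}"
proof -
  let ?f = "\<lambda>t. (1 - \<bar>t\<bar> / T) * cos (t * u)"
  let ?F = "\<lambda>t. (1 - t / T) * (sin (t * u) / u) - cos (t * u) / (T * u ^ 2)"
  have "((\<lambda>t. (1 - t / T) * cos (t * u)) has_integral (?F T - ?F 0)) {0..T}"
  proof (rule fundamental_theorem_of_calculus[where f = ?F])
    fix t
    have "(?F has_real_derivative ((1 - t / T) * cos (t * u))) (at t)"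
      using T u by (auto intro!: derivative_eq_intros simp: field_simps power2_eq_square)
    then show "(?F has_vector_derivative ((1 - t / T) * cos (t * u))) (at t within {0..T})"
      by (simp add: has_real_derivative_iff_has_vector_derivative has_vector_derivative_at_within)
  qed (use T in simp)
  moreover have "?F T - ?F 0 = (1 - cos (T * u)) / (T * u ^ 2)"
    using T u by (simp add: field_simps)
  ultimately have "((\<lambda>t. (1 - t / T) * cos (t * u)) has_integral ((1 - cos (T * u)) / (T * u ^ 2))) {0..T}" by simp
  then have right: "(?f has_integral ((1 - cos (T * u)) / (T * u ^ 2))) {0..T}"
    by (rule has_integral_eq[rotated]) auto
  then have left: "(?f has_integral ((1 - cos (T * u)) / (T * u ^ 2))) {-T..0}"
    using has_integral_reflect_real[where f = ?f and a = 0 and b = T] by simp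
  have "(?f has_integral ((1 - cos (T * u)) / (T * u ^ 2) + (1 - cos (T * u)) / (T * u ^ 2))) {-T..T}"
    by (rule has_integral_combine[OF _ _ left right]) (use T in auto)
  then show ?thesis by (simp only: mult_2 add_divide_distrib)
qed

lemma fejer_eq: "T > 0 \<Longrightarrow> u \<noteq> 0 \<Longrightarrow> fejer T u = 2 * (1 - cos (T * u)) / (T * u ^ 2)"
  unfolding fejer_def by (rule Henstock_Kurzweil_Integration.integral_unique[OF fejer_has_integral])

lemma fejer_0:
  assumes T: "T > 0"
  shows "fejer T 0 = T"
proof -
  let ?f = "\<lambda>t. (1 - \<bar>t\<bar> / T)"
  have "((\<lambda>t. (1 - t / T)) has_integral ((T - T ^ 2 / (2 * T)) - (0 - 0 ^ 2 / (2 * T)))) {0..T}"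
  proof (rule fundamental_theorem_of_calculus[where f = "\<lambda>t. t - t ^ 2 / (2 * T)"])
    fix t
    have "((\<lambda>t. t - t ^ 2 / (2 * T)) has_real_derivative (1 - t / T)) (at t)"
      using T by (auto intro!: derivative_eq_intros simp: field_simps power2_eq_square)
    then show "((\<lambda>t. t - t ^ 2 / (2 * T)) has_vector_derivative (1 - t / T)) (at t within {0..T})"
      by (simp add: has_real_derivative_iff_has_vector_derivative has_vector_derivative_at_within)
  qed (use T in simp)
  then have "((\<lambda>t. (1 - t / T)) has_integral (T / 2)) {0..T}"
    using T by (simp add: power2_eq_square)
  then have right: "(?f has_integral T / 2) {0..T}"
    by (rule has_integral_eq[rotated]) auto
  then have left: "(?f has_integral T / 2) {-T..0}"
    using has_integral_reflect_real[where f = ?f and a = 0 and b = T] by simp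
  have "(?f has_integral (T / 2 + T / 2)) {-T..T}"
    by (rule has_integral_combine[OF _ _ left right]) (use T in auto)
  then show ?thesis unfolding fejer_def by (simp add: Henstock_Kurzweil_Integration.integral_unique)
qed

lemma fejer_nonneg: "T > 0 \<Longrightarrow> fejer T u \<ge> 0"
  by (cases "u = 0") (simp_all add: fejer_0 fejer_eq)

lemma fejer_even: "fejer T (-u) = fejer T u"
  unfolding fejer_def by simp

lemma fejer_le:
  assumes "T > 0" "u \<noteq> 0"
  shows "fejer T u \<le> 4 / (T * u ^ 2)"
proof -
  have "2 - 2 * cos (T * u) \<le> 4" using cos_ge_minus_one[of "T * u"] by linarith
  then have "2 * (1 - cos (T * u)) \<le> 4" by (simp only: right_diff_distrib mult_1_right)
  then show ?thesis unfolding fejer_eq[OF assms] by (rule divide_right_mono) (use assms in auto)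
qed

lemma fejer_ge:
  assumes T: "T > 0"
  shows "fejer T u \<ge> T - T ^ 3 * u ^ 2 / 12"
proof (cases "u = 0")
  case False
  have pos: "0 < T * u ^ 2" using T False by simp
  have "(T - T ^ 3 * u ^ 2 / 12) * (T * u ^ 2) = (T * u) ^ 2 - (T * u) ^ 4 / 12"
    by (simp add: power_mult_distrib left_diff_distrib power2_eq_square power3_eq_cube power4_eq_xxxx)
  also have "\<dots> \<le> 2 * (1 - cos (T * u))"
  proof -
    have "a - b / 12 \<le> 2 * (1 - c)" if "c \<le> 1 - a / 2 + b / 24" for a b c :: real using that by simp
    from this[OF cos_le_quartic] show ?thesis .
  qed
  finally show ?thesis
    unfolding fejer_eq[OF T False] pos_le_divide_eq[OF pos] .
qed (simp add: fejer_0[OF T])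

lemma fejer_continuous: "continuous_on A (fejer T)"
proof -
  have "continuous_on UNIV (\<lambda>u. integral (cbox (-T) T) (\<lambda>t. (1 - \<bar>t\<bar> / T) * cos (t * u)))"
    unfolding divide_inverse
    by (rule integral_continuous_on_param) (unfold split_def, intro continuous_intros)
  moreover have "(\<lambda>u. integral (cbox (-T) T) (\<lambda>t. (1 - \<bar>t\<bar> / T) * cos (t * u))) = fejer T"
    by (rule ext) (simp add: fejer_def)
  ultimately have "continuous_on UNIV (fejer T)" by (simp only:)
  then show ?thesis by (rule continuous_on_subset) simp
qed

lemma fejer_integrable: "fejer T integrable_on {a..b}"
  by (rule integrable_continuous_interval[OF fejer_continuous])

text \<open>
  Only the ratio of the tail of the kernel to its mass near \<open>0\<close> will matter, so the exact total
  mass \<open>2 * pi\<close> is replaced by the crude lower bound \<open>9/2\<close>, which comes from integrating the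
  parabola in \<open>fejer_ge\<close> over \<open>\<bar>u\<bar> \<le> 3 / T\<close>.
\<close>

lemma fejer_window_ge:
  assumes T: "T > 0" and w: "T * w \<ge> 3"
  shows "integral {-w..w} (fejer T) \<ge> 9 / 2"
proof -
  have wle: "3 / T \<le> w" using T w by (simp add: field_simps)
  let ?G = "\<lambda>u. T * u - T ^ 3 * u ^ 3 / 36"
  have "((\<lambda>u. T - T ^ 3 * u ^ 2 / 12) has_integral (?G (3 / T) - ?G (- (3 / T)))) {-(3/T)..3/T}"
  proof (rule fundamental_theorem_of_calculus[where f = ?G])
    fix u
    have "(?G has_real_derivative (T - T ^ 3 * u ^ 2 / 12)) (at u)"
      by (auto intro!: derivative_eq_intros simp: power2_eq_square)
    then show "(?G has_vector_derivative (T - T ^ 3 * u ^ 2 / 12)) (at u within {-(3/T)..3/T})"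
      by (simp add: has_real_derivative_iff_has_vector_derivative has_vector_derivative_at_within)
  qed (use T in simp)
  moreover have "?G (3 / T) - ?G (- (3 / T)) = 9 / 2"
    using T by (simp add: field_simps power3_eq_cube)
  ultimately have "((\<lambda>u. T - T ^ 3 * u ^ 2 / 12) has_integral (9 / 2)) {-(3/T)..3/T}" by (simp only:)
  then have "9 / 2 \<le> integral {-(3/T)..3/T} (fejer T)"
    by (rule has_integral_le[OF _ integrable_integral[OF fejer_integrable]]) (rule fejer_ge[OF T])
  also have "\<dots> \<le> integral {-w..w} (fejer T)"
    by (rule Henstock_Kurzweil_Integration.integral_subset_le) (use wle in \<open>auto simp: fejer_integrable fejer_nonneg[OF T]\<close>)
  finally show ?thesis .
qed

lemma fejer_tail_le:
  assumes T: "T > 0" and w: "0 < w" "w \<le> b"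
  shows "integral {w..b} (fejer T) \<le> 4 / (T * w)"
proof -
  let ?G = "\<lambda>u. - 4 / (T * u)"
  have "((\<lambda>u. 4 / (T * u ^ 2)) has_integral (?G b - ?G w)) {w..b}"
  proof (rule fundamental_theorem_of_calculus[where f = ?G])
    fix u assume u: "u \<in> {w..b}"
    have "(?G has_real_derivative (4 / (T * u ^ 2))) (at u)"
      using T w u by (auto intro!: derivative_eq_intros simp: field_simps power2_eq_square)
    then show "(?G has_vector_derivative (4 / (T * u ^ 2))) (at u within {w..b})"
      by (simp add: has_real_derivative_iff_has_vector_derivative has_vector_derivative_at_within)
  qed (use w in simp)
  then have "integral {w..b} (fejer T) \<le> ?G b - ?G w"
    by (rule has_integral_le[OF integrable_integral[OF fejer_integrable]]) (use w in \<open>auto intro!: fejer_le[OF T]\<close>)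
  also have "\<dots> \<le> 4 / (T * w)" using T w by simp
  finally show ?thesis .
qed

lemma fejer_integral_le:
  assumes T: "T > 0" and w: "0 < w"
  shows "integral {a..b} (fejer T) \<le> integral {-w..w} (fejer T) + 8 / (T * w)"
proof -
  define B where "B = max w (max \<bar>a\<bar> \<bar>b\<bar>)"
  have B: "w \<le> B" "-B \<le> a" "b \<le> B" by (auto simp: B_def)
  have "integral {a..b} (fejer T) \<le> integral {-B..B} (fejer T)"
    by (rule Henstock_Kurzweil_Integration.integral_subset_le) (use B in \<open>auto simp: fejer_integrable fejer_nonneg[OF T]\<close>)
  also have "\<dots> = integral {-B..-w} (fejer T) + (integral {-w..w} (fejer T) + integral {w..B} (fejer T))"
    using B w by (simp add: Henstock_Kurzweil_Integration.integral_combine fejer_integrable)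
  also have "integral {-B..-w} (fejer T) = integral {w..B} (fejer T)"
    using Henstock_Kurzweil_Integration.integral_reflect_real[of B w "fejer T"] unfolding fejer_even .
  finally show ?thesis using fejer_tail_le[OF T w B(1)] by simp
qed

text \<open>
  The contribution of the pole.  Writing \<open>1 / (\<epsilon> + it) = integral {0..} (\<lambda>v. e^{-(\<epsilon> + it) v})\<close>, truncated at a
  large \<open>V\<close>, and exchanging the integrals gives \<open>integral {0..V} (\<lambda>v. e^{-\<epsilon>v} * fejer T (y - v))\<close>, which is at most
  the mass of the nonnegative kernel on an interval; the truncation error vanishes as \<open>V \<longlongrightarrow> \<infinity>\<close>.
\<close>

lemma fejer_pole_le:
  assumes T: "T > 0" and w: "w > 0" and e: "\<epsilon> > 0"
  shows "integral {-T..T} (\<lambda>t. (1 - \<bar>t\<bar> / T) * Re (cis (t * y) / Complex \<epsilon> t))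
         \<le> integral {-w..w} (fejer T) + 8 / (T * w)" (is "?I \<le> ?R")
proof -
  have inner: "integral {0..V} (\<lambda>v. exp (- \<epsilon> * v) * cos (t * (y - v))) =
      Re (cis (t * y) / Complex \<epsilon> t) - Re (cis (t * (y - V)) / Complex \<epsilon> t) * exp (- \<epsilon> * V)" if "V \<ge> 0" for t V
  proof (rule Henstock_Kurzweil_Integration.integral_unique)
    let ?g = "\<lambda>v. exp (- \<epsilon> * v) * (\<epsilon> * cos (t * (y - v)) + t * sin (t * (y - v)))"
    let ?F = "\<lambda>v. (- 1 / (\<epsilon>^2 + t^2)) * ?g v"
    have nz: "\<epsilon>^2 + t^2 > 0" using e by (simp add: add_pos_nonneg)
    have "((\<lambda>v. exp (- \<epsilon> * v) * cos (t * (y - v))) has_integral (?F V - ?F 0)) {0..V}"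
    proof (rule fundamental_theorem_of_calculus[where f = ?F])
      fix v
      have "(?g has_real_derivative (- (\<epsilon>^2 + t^2) * (exp (- \<epsilon> * v) * cos (t * (y - v))))) (at v)"
        by (auto intro!: derivative_eq_intros simp: power2_eq_square algebra_simps)
      moreover have c: "(- 1 / (\<epsilon>^2 + t^2)) * (- (\<epsilon>^2 + t^2) * X) = X" for X
      proof -
        have "(- 1 / q) * (- q * X) = X" if "q > 0" for q :: real using that by simp
        from this[OF nz] show ?thesis .
      qed
      ultimately have "(?F has_real_derivative (exp (- \<epsilon> * v) * cos (t * (y - v)))) (at v)"
        using DERIV_cmult[of ?g "- (\<epsilon>^2 + t^2) * (exp (- \<epsilon> * v) * cos (t * (y - v)))" v UNIV "- 1 / (\<epsilon>^2 + t^2)"]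
        unfolding c by simp
      then show "(?F has_vector_derivative (exp (- \<epsilon> * v) * cos (t * (y - v)))) (at v within {0..V})"
        by (simp add: has_real_derivative_iff_has_vector_derivative has_vector_derivative_at_within)
    qed (use that in simp)
    moreover have "?F V - ?F 0 = Re (cis (t * y) / Complex \<epsilon> t) - Re (cis (t * (y - V)) / Complex \<epsilon> t) * exp (- \<epsilon> * V)"
      by (simp add: Re_divide power2_eq_square algebra_simps add_divide_distrib)
    ultimately show "((\<lambda>v. exp (- \<epsilon> * v) * cos (t * (y - v))) has_integral
       (Re (cis (t * y) / Complex \<epsilon> t) - Re (cis (t * (y - V)) / Complex \<epsilon> t) * exp (- \<epsilon> * V))) {0..V}" by simp
  qed
  have nz: "Complex \<epsilon> t \<noteq> 0" for t using e by (simp add: complex_eq_iff)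
  have cont: "continuous_on A (\<lambda>t. (1 - \<bar>t\<bar> / T) * Re (cis (t * z) / Complex \<epsilon> t))" for A z
    using nz T by (auto intro!: continuous_intros simp: Complex_eq cis_conv_exp)
  have le: "?I \<le> ?R + 2 * T / \<epsilon> * exp (- \<epsilon> * V)" if V: "V \<ge> 0" for V
  proof -
    let ?f = "\<lambda>t v. (1 - \<bar>t\<bar> / T) * (exp (- \<epsilon> * v) * cos (t * (y - v)))"
    have "integral {-T..T} (\<lambda>t. integral {0..V} (?f t)) = integral {0..V} (\<lambda>v. integral {-T..T} (\<lambda>t. ?f t v))"
    proof -
      have "continuous_on (cbox (-T, 0) (T, V)) (\<lambda>(t, v). ?f t v)"
        unfolding split_def using T by (intro continuous_intros) auto
      from integral_swap_continuous[OF this] show ?thesis by (simp only: box_real)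
    qed
    also have "\<dots> = integral {0..V} (\<lambda>v. exp (- \<epsilon> * v) * fejer T (y - v))"
    proof -
      have "integral {-T..T} (\<lambda>t. ?f t v) = exp (- \<epsilon> * v) * fejer T (y - v)" for v
        unfolding fejer_def by (subst Henstock_Kurzweil_Integration.integral_mult_right[symmetric]) (simp add: mult_ac)
      then show ?thesis by simp
    qed
    also have "\<dots> \<le> integral {0..V} (\<lambda>v. fejer T (y - v))"
    proof (rule Henstock_Kurzweil_Integration.integral_le)
      show "(\<lambda>v. exp (- \<epsilon> * v) * fejer T (y - v)) integrable_on {0..V}"
        by (intro integrable_continuous_interval continuous_intros continuous_on_compose2[OF fejer_continuous[of UNIV]]) auto
      show "(\<lambda>v. fejer T (y - v)) integrable_on {0..V}"
        by (intro integrable_continuous_interval continuous_intros continuous_on_compose2[OF fejer_continuous[of UNIV]]) auto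
      fix v assume "v \<in> {0..V}"
      then have "exp (- \<epsilon> * v) \<le> 1" using e by simp
      then show "exp (- \<epsilon> * v) * fejer T (y - v) \<le> fejer T (y - v)"
        using fejer_nonneg[OF T, of "y - v"] by (intro mult_left_le_one_le) auto
    qed
    also have "\<dots> = integral {0..V} (\<lambda>v. fejer T (v + (-y)))"
    proof (rule arg_cong[where f = "integral {0..V}"], rule ext)
      show "fejer T (y - v) = fejer T (v + (-y))" for v using fejer_even[of T "y - v"] by simp
    qed
    also have "\<dots> = integral {-y..V-y} (fejer T)"
      using integral_shift_real_ivl[of "-y" "-y" "V - y" "fejer T"] by simp
    also have "\<dots> \<le> ?R" by (rule fejer_integral_le[OF T w])
    finally have 1: "integral {-T..T} (\<lambda>t. integral {0..V} (?f t)) \<le> ?R" .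
    have eq: "(\<lambda>t. integral {0..V} (?f t)) = (\<lambda>t. (1 - \<bar>t\<bar> / T) * Re (cis (t * y) / Complex \<epsilon> t)
           - (1 - \<bar>t\<bar> / T) * Re (cis (t * (y - V)) / Complex \<epsilon> t) * exp (- \<epsilon> * V))"
      by (rule ext, subst Henstock_Kurzweil_Integration.integral_mult_right, subst inner[OF V])
         (simp only: right_diff_distrib mult.assoc)
    have int: "(\<lambda>t. integral {0..V} (?f t)) integrable_on {-T..T}"
      unfolding eq by (intro integrable_continuous_interval continuous_intros cont)
    have "?I \<le> integral {-T..T} (\<lambda>t. integral {0..V} (?f t) + exp (- \<epsilon> * V) / \<epsilon>)"
    proof (rule Henstock_Kurzweil_Integration.integral_le)
      show "(\<lambda>t. (1 - \<bar>t\<bar> / T) * Re (cis (t * y) / Complex \<epsilon> t)) integrable_on {-T..T}"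
        by (rule integrable_continuous_interval[OF cont])
      show "(\<lambda>t. integral {0..V} (?f t) + exp (- \<epsilon> * V) / \<epsilon>) integrable_on {-T..T}"
        by (intro integrable_add int) (rule integrable_const_ivl)
      fix t assume t: "t \<in> {-T..T}"
      have "Re (cis (t * (y - V)) / Complex \<epsilon> t) \<le> norm (cis (t * (y - V)) / Complex \<epsilon> t)"
        by (rule complex_Re_le_cmod)
      also have "\<dots> = 1 / norm (Complex \<epsilon> t)" by (simp add: norm_divide)
      also have "\<dots> \<le> 1 / \<epsilon>"
        using complex_Re_le_cmod[of "Complex \<epsilon> t"] e by (intro divide_left_mono mult_pos_pos) (auto simp: nz)
      finally have a: "Re (cis (t * (y - V)) / Complex \<epsilon> t) \<le> 1 / \<epsilon>" .
      have b: "0 \<le> 1 - \<bar>t\<bar> / T" "1 - \<bar>t\<bar> / T \<le> 1" using t T by (auto simp: field_simps)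
      have "(1 - \<bar>t\<bar> / T) * Re (cis (t * (y - V)) / Complex \<epsilon> t) \<le> (1 - \<bar>t\<bar> / T) * (1 / \<epsilon>)"
        by (rule mult_left_mono[OF a b(1)])
      also have "\<dots> \<le> 1 * (1 / \<epsilon>)" using b e by (intro mult_right_mono) auto
      finally have "(1 - \<bar>t\<bar> / T) * Re (cis (t * (y - V)) / Complex \<epsilon> t) * exp (- \<epsilon> * V) \<le> 1 * (1 / \<epsilon>) * exp (- \<epsilon> * V)"
        by (rule mult_right_mono) simp
      then show "(1 - \<bar>t\<bar> / T) * Re (cis (t * y) / Complex \<epsilon> t) \<le> integral {0..V} (?f t) + exp (- \<epsilon> * V) / \<epsilon>"
        using fun_cong[OF eq, of t] by simp
    qed
    also have "\<dots> = integral {-T..T} (\<lambda>t. integral {0..V} (?f t)) + 2 * T / \<epsilon> * exp (- \<epsilon> * V)"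
    proof (subst Henstock_Kurzweil_Integration.integral_add)
      show "(\<lambda>t. integral {0..V} (?f t)) integrable_on {-T..T}" by (rule int)
    qed (use T in auto)
    finally show ?thesis using 1 by simp
  qed
  have "((\<lambda>V. ?R + 2 * T / \<epsilon> * exp (- \<epsilon> * V)) \<longlongrightarrow> ?R + 2 * T / \<epsilon> * 0) at_top"
    using e by (intro tendsto_intros) real_asymp
  then have "?I \<le> ?R + 2 * T / \<epsilon> * 0"
    by (rule tendsto_lowerbound[OF _ eventually_at_top_linorderI[of 0, OF le] trivial_limit_at_top_linorder])
  then show ?thesis by simp
qed

text \<open>
  One integration by parts against \<open>e^{ity}\<close>.
\<close>

lemma oscillatory_integral_le:
  fixes f f' :: "real \<Rightarrow> complex"
  assumes ab: "a \<le> b" and y: "y > 0"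
    and f: "\<And>t. t \<in> {a..b} \<Longrightarrow> (f has_vector_derivative f' t) (at t within {a..b})"
    and f': "continuous_on {a..b} f'"
    and D: "\<And>t. t \<in> {a..b} \<Longrightarrow> norm (f' t) \<le> D"
  shows "norm (integral {a..b} (\<lambda>t. f t * cis (t * y))) \<le> (norm (f a) + norm (f b) + D * (b - a)) / y"
proof -
  have cf: "continuous_on {a..b} f"
    using f has_vector_derivative_continuous continuous_on_eq_continuous_within by blast
  have dcis: "((\<lambda>t. cis (t * y)) has_vector_derivative (\<i> * y * cis (t * y))) (at t within A)" for t A
  proof -
    have "((\<lambda>z. exp (\<i> * (z * of_real y))) has_field_derivative (\<i> * y * exp (\<i> * (of_real t * of_real y)))) (at (of_real t))"
      by (auto intro!: derivative_eq_intros)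
    from has_vector_derivative_real_field[OF this] show ?thesis by (simp add: cis_conv_exp)
  qed
  have ccis: "continuous_on A (\<lambda>t. cis (t * y))" for A by (intro continuous_intros)
  have "((\<lambda>t. f t * (\<i> * y * cis (t * y)) + f' t * cis (t * y)) has_integral (f b * cis (b * y) - f a * cis (a * y))) {a..b}"
    by (rule fundamental_theorem_of_calculus[OF ab]) (intro has_vector_derivative_mult f dcis)
  then have i1: "integral {a..b} (\<lambda>t. f t * (\<i> * y * cis (t * y)) + f' t * cis (t * y)) = f b * cis (b * y) - f a * cis (a * y)"
    by (rule Henstock_Kurzweil_Integration.integral_unique)
  have i2: "integral {a..b} (\<lambda>t. f t * (\<i> * y * cis (t * y)) + f' t * cis (t * y)) =
      integral {a..b} (\<lambda>t. f t * (\<i> * y * cis (t * y))) + integral {a..b} (\<lambda>t. f' t * cis (t * y))"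
    by (rule Henstock_Kurzweil_Integration.integral_add) (intro integrable_continuous_interval continuous_intros cf f' ccis)+
  have "integral {a..b} (\<lambda>t. f t * (\<i> * y * cis (t * y))) = integral {a..b} (\<lambda>t. (\<i> * y) * (f t * cis (t * y)))"
    by (rule arg_cong[where f = "integral {a..b}"], rule ext, rule mult.left_commute)
  also have "\<dots> = (\<i> * y) * integral {a..b} (\<lambda>t. f t * cis (t * y))"
    by (rule Henstock_Kurzweil_Integration.integral_mult_right)
  finally have i3: "integral {a..b} (\<lambda>t. f t * (\<i> * y * cis (t * y))) = (\<i> * y) * integral {a..b} (\<lambda>t. f t * cis (t * y))" .
  have sum: "f b * cis (b * y) - f a * cis (a * y) =
     (\<i> * y) * integral {a..b} (\<lambda>t. f t * cis (t * y)) + integral {a..b} (\<lambda>t. f' t * cis (t * y))"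
    using i1 unfolding i2 i3 by (rule sym)
  have "y * norm (integral {a..b} (\<lambda>t. f t * cis (t * y))) = norm ((\<i> * y) * integral {a..b} (\<lambda>t. f t * cis (t * y)))"
    using y by (simp only: norm_mult norm_ii mult_1 norm_of_real abs_of_pos)
  also have "(\<i> * y) * integral {a..b} (\<lambda>t. f t * cis (t * y)) =
     f b * cis (b * y) - f a * cis (a * y) - integral {a..b} (\<lambda>t. f' t * cis (t * y))"
    unfolding sum by (rule add_diff_cancel_right'[symmetric])
  also have "norm (f b * cis (b * y) - f a * cis (a * y) - integral {a..b} (\<lambda>t. f' t * cis (t * y)))
      \<le> norm (f b * cis (b * y)) + norm (f a * cis (a * y)) + norm (integral {a..b} (\<lambda>t. f' t * cis (t * y)))"
    by (rule order_trans[OF norm_triangle_ineq4 add_right_mono[OF norm_triangle_ineq4]])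
  also have "norm (integral {a..b} (\<lambda>t. f' t * cis (t * y))) \<le> D * (b - a)"
    by (rule Henstock_Kurzweil_Integration.integral_bound[OF ab]) (auto intro!: continuous_intros f' ccis simp: norm_mult D)
  also have "norm (f b * cis (b * y)) = norm (f b)" by (simp add: norm_mult)
  also have "norm (f a * cis (a * y)) = norm (f a)" by (simp add: norm_mult)
  finally show ?thesis using y by (simp only: pos_le_divide_eq mult.commute add.commute)
qed

section \<open>Primes weighted by the Fejer kernel\<close>

context zero_free_height begin

lemma T_pos: "T > 0" using T by simp

lemma vertical_deriv:
  assumes "\<epsilon> > 0"
  shows "((\<lambda>t. zeta_logderiv (Complex (1 + \<epsilon>) t)) has_vector_derivative (deriv zeta_logderiv (Complex (1 + \<epsilon>) t) * \<i>)) (at t within A)"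
proof -
  have "(zeta_logderiv has_field_derivative deriv zeta_logderiv (Complex (1 + \<epsilon>) t)) (at (of_real (1 + \<epsilon>) + \<i> * of_real t))"
    using holomorphic_derivI[OF zeta_logderiv_holomorphic open_Re_gt, of "Complex (1 + \<epsilon>) t"] assms
    by (simp add: Complex_eq)
  moreover have "((\<lambda>z. of_real (1 + \<epsilon>) + \<i> * z) has_field_derivative \<i>) (at (of_real t))"
    by (auto intro!: derivative_eq_intros)
  ultimately have "((\<lambda>z. zeta_logderiv (of_real (1 + \<epsilon>) + \<i> * z)) has_field_derivative (deriv zeta_logderiv (Complex (1 + \<epsilon>) t) * \<i>)) (at (of_real t))"
    by (rule DERIV_chain2)
  from has_vector_derivative_real_field[OF this] show ?thesis by (simp add: Complex_eq)
qed

lemma continuous_on_vertical: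
  assumes "f holomorphic_on {s. Re s > 1}" "\<epsilon> > 0"
  shows "continuous_on A (\<lambda>t. f (Complex (1 + \<epsilon>) t))"
proof (rule continuous_on_compose2[OF holomorphic_on_imp_continuous_on[OF assms(1)]])
  show "continuous_on A (Complex (1 + \<epsilon>))"
    unfolding Complex_eq[abs_def] by (intro continuous_intros)
qed (use assms in auto)

text \<open>
  The triangle function is differentiable on each half of \<open>{-T..T}\<close>, so the two halves are
  integrated by parts separately; the pair \<open>(a, b)\<close> and the slope \<open>c\<close> describe either half.
\<close>

lemma oscillatory_half_le:
  assumes e: "0 < \<epsilon>" "\<epsilon> \<le> eta" and y: "y > 0" and ab: "(a, b) = (0, T) \<and> c = - 1 / T \<or> (a, b) = (-T, 0) \<and> c = 1 / T"
  shows "norm (integral {a..b} (\<lambda>t. (of_real (1 + c * t) * zeta_logderiv (Complex (1 + \<epsilon>) t)) * cis (t * y)))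
         \<le> (2 / eta + 2 * T / eta ^ 2) / y"
proof -
  let ?H = "\<lambda>t. zeta_logderiv (Complex (1 + \<epsilon>) t)"
  let ?H' = "\<lambda>t. deriv zeta_logderiv (Complex (1 + \<epsilon>) t) * \<i>"
  define f where "f = (\<lambda>t. of_real (1 + c * t) * ?H t)"
  define f' where "f' = (\<lambda>t. of_real (1 + c * t) * ?H' t + of_real c * ?H t)"
  have ab': "a \<le> b" "b - a = T" "\<bar>c\<bar> = 1 / T" "{a..b} \<subseteq> {-T..T}" using ab T_pos by auto
  have le1: "\<bar>1 + c * t\<bar> \<le> 1" if "t \<in> {a..b}" for t
  proof -
    have "1 + c * t = 1 - \<bar>t\<bar> / T" using ab that by (elim disjE) auto
    moreover have "\<bar>t\<bar> \<le> T" using ab that T_pos by auto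
    then have "0 \<le> \<bar>t\<bar> / T" "\<bar>t\<bar> / T \<le> 1" using T_pos by (auto simp: divide_le_eq_1)
    ultimately show ?thesis by linarith
  qed
  have Hle: "norm (?H t) \<le> 1 / eta" "norm (?H' t) \<le> 2 / eta ^ 2" if "t \<in> {a..b}" for t
    using zeta_logderiv_le[of "Complex (1 + \<epsilon>) t"] that ab'(4) e by (auto simp: norm_mult)
  have "norm (integral {a..b} (\<lambda>t. f t * cis (t * y))) \<le> (norm (f a) + norm (f b) + (2 / eta ^ 2 + 1 / T * (1 / eta)) * (b - a)) / y"
  proof (rule oscillatory_integral_le[OF ab'(1) y])
    fix t assume t: "t \<in> {a..b}"
    have "((\<lambda>t. of_real (1 + c * t) :: complex) has_vector_derivative of_real c) (at t within {a..b})"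
      by (auto intro!: derivative_eq_intros simp: has_vector_derivative_def scaleR_conv_of_real)
    then show "(f has_vector_derivative f' t) (at t within {a..b})"
      unfolding f_def f'_def by (intro has_vector_derivative_mult vertical_deriv e)
    have "norm (f' t) \<le> norm (of_real (1 + c * t) * ?H' t) + norm (of_real c * ?H t)"
      unfolding f'_def by (rule norm_triangle_ineq)
    also have "\<dots> = \<bar>1 + c * t\<bar> * norm (?H' t) + \<bar>c\<bar> * norm (?H t)"
      by (simp only: norm_mult norm_of_real)
    also have "\<dots> \<le> 1 * (2 / eta ^ 2) + 1 / T * (1 / eta)"
      unfolding ab'(3) using T_pos by (intro add_mono mult_mono le1 Hle t order_refl) auto
    finally show "norm (f' t) \<le> 2 / eta ^ 2 + 1 / T * (1 / eta)" by simp
  next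
    show "continuous_on {a..b} f'"
      unfolding f'_def
      by (intro continuous_intros continuous_on_vertical holomorphic_deriv[OF zeta_logderiv_holomorphic open_Re_gt]
          zeta_logderiv_holomorphic e)
  qed
  also have "\<dots> \<le> (2 / eta + 2 * T / eta ^ 2) / y"
  proof (rule divide_right_mono)
    have z: "f a = 0 \<or> f b = 0" using ab T_pos by (auto simp: f_def)
    have "norm (f t) \<le> 1 * (1 / eta)" if "t \<in> {a..b}" for t
      unfolding f_def norm_mult norm_of_real by (intro mult_mono le1 Hle that) auto
    then have "norm (f a) \<le> 1 / eta" "norm (f b) \<le> 1 / eta" using ab'(1) by auto
    with z have n: "norm (f a) + norm (f b) \<le> 1 / eta" by auto
    have "(2 / eta ^ 2 + 1 / T * (1 / eta)) * (b - a) = 2 * T / eta ^ 2 + 1 / eta"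
      unfolding ab'(2) using T_pos eta_pos by (simp add: field_simps)
    with n show "norm (f a) + norm (f b) + (2 / eta ^ 2 + 1 / T * (1 / eta)) * (b - a) \<le> 2 / eta + 2 * T / eta ^ 2"
      by simp
  qed (use y in simp)
  finally show ?thesis by (simp only: f_def)
qed

lemma oscillatory_le:
  assumes e: "0 < \<epsilon>" "\<epsilon> \<le> eta" and y: "y > 0"
  shows "- integral {-T..T} (\<lambda>t. (1 - \<bar>t\<bar> / T) * Re (cis (t * y) * zeta_logderiv (Complex (1 + \<epsilon>) t)))
         \<le> 5 * T / eta ^ 2 / y"
proof -
  let ?h = "\<lambda>t. of_real (1 - \<bar>t\<bar> / T) * zeta_logderiv (Complex (1 + \<epsilon>) t) * cis (t * y)"
  have cont: "continuous_on A ?h" for A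
    unfolding divide_inverse by (intro continuous_intros continuous_on_vertical zeta_logderiv_holomorphic e)
  have int: "?h integrable_on {a..b}" for a b by (rule integrable_continuous_interval[OF cont])
  have right: "integral {0..T} ?h = integral {0..T} (\<lambda>t. (of_real (1 + (- 1 / T) * t) * zeta_logderiv (Complex (1 + \<epsilon>) t)) * cis (t * y))"
    by (rule Henstock_Kurzweil_Integration.integral_cong) simp
  have left: "integral {-T..0} ?h = integral {-T..0} (\<lambda>t. (of_real (1 + (1 / T) * t) * zeta_logderiv (Complex (1 + \<epsilon>) t)) * cis (t * y))"
    by (rule Henstock_Kurzweil_Integration.integral_cong) simp
  have "- integral {-T..T} (\<lambda>t. (1 - \<bar>t\<bar> / T) * Re (cis (t * y) * zeta_logderiv (Complex (1 + \<epsilon>) t)))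
     = - integral {-T..T} (Re \<circ> ?h)"
  proof -
    have "Re (of_real x * z * v) = x * Re (v * z)" for x v z by (simp add: algebra_simps)
    then show ?thesis by (simp only: o_def)
  qed
  also have "\<dots> = - Re (integral {-T..T} ?h)"
    by (subst integral_linear[OF int bounded_linear_Re]) simp
  also have "\<dots> \<le> norm (integral {-T..T} ?h)"
    using abs_Re_le_cmod[of "integral {-T..T} ?h"] by simp
  also have "integral {-T..T} ?h = integral {-T..0} ?h + integral {0..T} ?h"
    using T_pos by (intro Henstock_Kurzweil_Integration.integral_combine[symmetric] int) auto
  also have "norm (integral {-T..0} ?h + integral {0..T} ?h) \<le> (2 / eta + 2 * T / eta ^ 2) / y + (2 / eta + 2 * T / eta ^ 2) / y"
    unfolding left right
    by (rule order_trans[OF norm_triangle_ineq add_mono[OF oscillatory_half_le oscillatory_half_le]]) (use e y in auto)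
  also have "\<dots> = (4 / eta + 4 * T / eta ^ 2) / y" using y by (simp add: field_simps)
  also have "\<dots> \<le> 5 * T / eta ^ 2 / y"
  proof (rule divide_right_mono)
    have "4 * eta \<le> T" using T eta_le by simp
    then have "4 / eta \<le> T / eta ^ 2" using eta_pos by (simp add: field_simps power2_eq_square)
    then show "4 / eta + 4 * T / eta ^ 2 \<le> 5 * T / eta ^ 2" by (simp add: add_divide_distrib[symmetric])
  qed (use y in simp)
  finally show ?thesis .
qed

text \<open>
  Integrating the Dirichlet series term by term, which is legitimate as it converges uniformly in \<open>t\<close>.
  The full sum is an equality; restricting it to \<open>A\<close> uses that all terms are nonnegative.
\<close>

lemma fejer_sum_le_integral:
  assumes e: "0 < \<epsilon>" and A: "finite A"
  shows "(\<Sum>n\<in>A. mangoldt n * real n powr (- (1 + \<epsilon>)) * fejer T (y - ln (real n)))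
     \<le> integral {-T..T} (\<lambda>t. (1 - \<bar>t\<bar> / T) * Re (cis (t * y) * mangoldt_series (Complex (1 + \<epsilon>) t)))"
proof -
  define a where "a = (\<lambda>n. mangoldt n * real n powr (- (1 + \<epsilon>)))"
  let ?r = "\<lambda>n t. (1 - \<bar>t\<bar> / T) * (a n * cos (t * (y - ln (real n))))"
  have a0: "a n \<ge> 0" for n by (simp add: a_def mangoldt_nonneg)
  have Lsums: "(\<lambda>n. ?r n t) sums ((1 - \<bar>t\<bar> / T) * Re (cis (t * y) * mangoldt_series (Complex (1 + \<epsilon>) t)))" for t
  proof (rule sums_mult)
    have "(\<lambda>n. Re (cis (t * y) * (mangoldt n * of_nat n powr (- Complex (1 + \<epsilon>) t)))) sums Re (cis (t * y) * mangoldt_series (Complex (1 + \<epsilon>) t))"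
      by (intro sums_Re sums_mult log_zeta_deriv(2)) (use e in simp)
    moreover have "Re (cis (t * y) * (mangoldt n * of_nat n powr (- Complex (1 + \<epsilon>) t))) = a n * cos (t * (y - ln (real n)))" for n
    proof (cases "n = 0")
      case False
      have "(of_nat n powr (- Complex (1 + \<epsilon>) t) :: complex) = of_real (real n powr (- (1 + \<epsilon>))) * cis (- t * ln (real n))"
      proof -
        have "(of_nat n powr (- Complex (1 + \<epsilon>) t) :: complex) = exp (- Complex (1 + \<epsilon>) t * of_real (ln (real n)))"
          using False by (simp add: powr_def)
        also have "- Complex (1 + \<epsilon>) t * of_real (ln (real n)) = Complex (- (1 + \<epsilon>) * ln (real n)) (- t * ln (real n))"
          by (simp add: complex_eq_iff algebra_simps)
        also have "exp \<dots> = of_real (exp (- (1 + \<epsilon>) * ln (real n))) * cis (- t * ln (real n))"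
          by (simp only: exp_eq_polar complex.sel)
        also have "exp (- (1 + \<epsilon>) * ln (real n)) = real n powr (- (1 + \<epsilon>))"
          using False by (simp add: powr_def)
        finally show ?thesis .
      qed
      then have "cis (t * y) * (mangoldt n * of_nat n powr (- Complex (1 + \<epsilon>) t)) = of_real (a n) * (cis (t * y) * cis (- t * ln (real n)))"
        by (simp add: a_def)
      also have "cis (t * y) * cis (- t * ln (real n)) = cis (t * (y - ln (real n)))"
        by (simp add: cis_mult algebra_simps)
      finally show ?thesis by simp
    qed (simp add: a_def)
    ultimately show "(\<lambda>n. a n * cos (t * (y - ln (real n)))) sums Re (cis (t * y) * mangoldt_series (Complex (1 + \<epsilon>) t))"
      by (simp only:)
  qed
  have asum: "summable a"
  proof -
    have "summable (\<lambda>n. norm (mangoldt n * of_nat n powr (- of_real (1 + \<epsilon>)) :: complex))"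
      by (rule mangoldt_series_abs_summable) (use e in simp)
    then show ?thesis
      unfolding a_def by (simp only: norm_mult norm_nat_powr norm_mangoldt Re_complex_of_real)
  qed
  have u: "uniform_limit (cbox (-T) T) (\<lambda>N t. \<Sum>n<N. ?r n t) (\<lambda>t. \<Sum>n. ?r n t) sequentially"
  proof (rule Weierstrass_m_test[OF _ asum])
    fix n t assume "t \<in> cbox (-T) T"
    then have t: "\<bar>1 - \<bar>t\<bar> / T\<bar> \<le> 1" using T_pos by (auto simp: field_simps abs_le_iff)
    have "norm (?r n t) = \<bar>1 - \<bar>t\<bar> / T\<bar> * (a n * \<bar>cos (t * (y - ln (real n)))\<bar>)"
      using a0[of n] by (simp add: abs_mult)
    also have "\<dots> \<le> 1 * (a n * 1)"
      using a0[of n] by (intro mult_mono t abs_cos_le_one) auto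
    finally show "norm (?r n t) \<le> a n" by simp
  qed
  have rc: "continuous_on B (?r n)" for B n unfolding divide_inverse by (intro continuous_intros)
  have rint: "(?r n has_integral (a n * fejer T (y - ln (real n)))) {-T..T}" for n
  proof -
    have "integral {-T..T} (?r n) = integral {-T..T} (\<lambda>t. a n * ((1 - \<bar>t\<bar> / T) * cos (t * (y - ln (real n)))))"
      by (rule Henstock_Kurzweil_Integration.integral_cong) (simp only: mult.left_commute)
    also have "\<dots> = a n * fejer T (y - ln (real n))"
      unfolding fejer_def by (rule Henstock_Kurzweil_Integration.integral_mult_right)
    finally show ?thesis using integrable_continuous_interval[OF rc[of "{-T..T}" n]] by (metis integrable_integral)
  qed
  obtain I J where IJ: "\<And>N. ((\<lambda>t. \<Sum>n<N. ?r n t) has_integral I N) (cbox (-T) T)"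
    "((\<lambda>t. \<Sum>n. ?r n t) has_integral J) (cbox (-T) T)" "(I \<longlongrightarrow> J) sequentially"
    using uniform_limit_integral_cbox[OF u continuous_on_sum[OF rc] trivial_limit_sequentially] by blast
  have "I = (\<lambda>N. \<Sum>n<N. a n * fejer T (y - ln (real n)))"
  proof (rule ext)
    fix N show "I N = (\<Sum>n<N. a n * fejer T (y - ln (real n)))"
    using IJ(1)[of N] has_integral_sum[of "{..<N}" ?r "\<lambda>n. a n * fejer T (y - ln (real n))", OF _ rint]
    by (simp add: has_integral_unique)
  qed
  then have "(\<lambda>n. a n * fejer T (y - ln (real n))) sums J"
    using IJ(3) unfolding sums_def by (simp only:)
  moreover have "J = integral {-T..T} (\<lambda>t. (1 - \<bar>t\<bar> / T) * Re (cis (t * y) * mangoldt_series (Complex (1 + \<epsilon>) t)))"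
    using IJ(2) unfolding sums_unique[OF Lsums, symmetric] box_real by (rule Henstock_Kurzweil_Integration.integral_unique[symmetric])
  moreover have "(\<Sum>n\<in>A. a n * fejer T (y - ln (real n))) \<le> (\<Sum>n. a n * fejer T (y - ln (real n)))"
    by (rule sum_le_suminf[OF sums_summable[OF calculation(1)] A]) (simp add: a0 fejer_nonneg[OF T_pos])
  ultimately show ?thesis by (simp add: sums_iff a_def)
qed

text \<open>
  Split \<open>-\<zeta>'/\<zeta>\<close> into its pole, which contributes at most the mass of the kernel, and the regular part, whose
  integral oscillates.
\<close>

lemma fejer_sum_eps_le:
  assumes e: "0 < \<epsilon>" "\<epsilon> \<le> eta" and A: "finite A" and w: "w > 0" and y: "y > 0"
  shows "(\<Sum>n\<in>A. mangoldt n * real n powr (- (1 + \<epsilon>)) * fejer T (y - ln (real n)))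
     \<le> integral {-w..w} (fejer T) + 8 / (T * w) + 5 * T / eta ^ 2 / y"
proof -
  let ?p = "\<lambda>t. (1 - \<bar>t\<bar> / T) * Re (cis (t * y) / Complex \<epsilon> t)"
  let ?h = "\<lambda>t. (1 - \<bar>t\<bar> / T) * Re (cis (t * y) * zeta_logderiv (Complex (1 + \<epsilon>) t))"
  have nz: "Complex \<epsilon> t \<noteq> 0" for t using e by (simp add: complex_eq_iff)
  have "continuous_on {-T..T} ?p"
    using nz T_pos by (auto intro!: continuous_intros simp: Complex_eq cis_conv_exp)
  then have pint: "?p integrable_on {-T..T}" by (rule integrable_continuous_interval)
  have "continuous_on {-T..T} ?h"
    unfolding divide_inverse by (intro continuous_intros continuous_on_vertical zeta_logderiv_holomorphic e)
  then have hint: "?h integrable_on {-T..T}" by (rule integrable_continuous_interval)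
  note fejer_sum_le_integral[OF e(1) A, of y]
  also have "integral {-T..T} (\<lambda>t. (1 - \<bar>t\<bar> / T) * Re (cis (t * y) * mangoldt_series (Complex (1 + \<epsilon>) t)))
     = integral {-T..T} (\<lambda>t. ?p t - ?h t)"
  proof (rule Henstock_Kurzweil_Integration.integral_cong)
    fix t
    have "mangoldt_series (Complex (1 + \<epsilon>) t) = 1 / Complex \<epsilon> t - zeta_logderiv (Complex (1 + \<epsilon>) t)"
    proof -
      have "Complex (1 + \<epsilon>) t - 1 = Complex \<epsilon> t" by (simp add: complex_eq_iff)
      then show ?thesis using mangoldt_series_eq[of "Complex (1 + \<epsilon>) t"] e by simp
    qed
    then show "(1 - \<bar>t\<bar> / T) * Re (cis (t * y) * mangoldt_series (Complex (1 + \<epsilon>) t)) = ?p t - ?h t"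
      by (simp only: right_diff_distrib minus_complex.sel times_divide_eq_right mult_1_right)
  qed
  also have "\<dots> = integral {-T..T} ?p - integral {-T..T} ?h"
    by (rule Henstock_Kurzweil_Integration.integral_diff[OF pint hint])
  also have "\<dots> \<le> (integral {-w..w} (fejer T) + 8 / (T * w)) + 5 * T / eta ^ 2 / y"
    using fejer_pole_le[OF T_pos w e(1), of y] oscillatory_le[OF e y] by linarith
  finally show ?thesis .
qed

text \<open>
  Letting \<open>\<epsilon>\<close> tend to \<open>0\<close> is harmless because the set \<open>A\<close> is finite and the bound does not depend on \<open>\<epsilon>\<close>.
\<close>

lemma fejer_sum_le:
  assumes A: "finite A" and w: "w > 0" and y: "y > 0"
  shows "(\<Sum>n\<in>A. mangoldt n / real n * fejer T (y - ln (real n)))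
     \<le> integral {-w..w} (fejer T) + 8 / (T * w) + 5 * T / eta ^ 2 / y"
proof -
  have "((\<lambda>\<epsilon>. \<Sum>n\<in>A. mangoldt n * real n powr (- (1 + \<epsilon>)) * fejer T (y - ln (real n))) \<longlongrightarrow>
     (\<Sum>n\<in>A. mangoldt n * real n powr (- (1 + 0)) * fejer T (y - ln (real n)))) (at_right 0)"
  proof (rule tendsto_sum)
    fix n
    show "((\<lambda>\<epsilon>. mangoldt n * real n powr (- (1 + \<epsilon>)) * fejer T (y - ln (real n))) \<longlongrightarrow>
       mangoldt n * real n powr (- (1 + 0)) * fejer T (y - ln (real n))) (at_right 0)"
    proof (cases "n = 0")
      case False
      then show ?thesis by (intro tendsto_intros) auto
    qed simp
  qed
  moreover have "\<forall>\<^sub>F \<epsilon> in at_right 0. (\<Sum>n\<in>A. mangoldt n * real n powr (- (1 + \<epsilon>)) * fejer T (y - ln (real n)))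
     \<le> integral {-w..w} (fejer T) + 8 / (T * w) + 5 * T / eta ^ 2 / y"
    by (rule eventually_at_rightI[OF fejer_sum_eps_le[OF _ _ A w y] eta_pos]) auto
  ultimately have "(\<Sum>n\<in>A. mangoldt n * real n powr (- (1 + 0)) * fejer T (y - ln (real n)))
     \<le> integral {-w..w} (fejer T) + 8 / (T * w) + 5 * T / eta ^ 2 / y"
    by (rule tendsto_upperbound) simp
  moreover have "mangoldt n * real n powr (- (1 + 0)) = mangoldt n / real n" for n
    by (cases "n = 0") (simp_all add: powr_minus_divide)
  ultimately show ?thesis by simp
qed

end

section \<open>A prime number theorem with explicit error\<close>

lemma exp_1_ge: "exp (1::real) \<ge> 2.716"
proof -
  have "(\<Sum>n<6. 1 / fact n :: real) \<le> (\<Sum>n. 1 / fact n)"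
    using summable_exp[of "1::real"] by (intro sum_le_suminf) (auto simp: divide_inverse)
  also have "\<dots> = exp 1" by (simp add: exp_def divide_inverse)
  finally show ?thesis by (simp add: eval_nat_numeral lessThan_Suc)
qed

text \<open>
  As \<open>2.716 < e\<close>, comparing powers of rational numbers bounds logarithms from above.
\<close>

lemma ln_le_of_power_le:
  fixes a :: real
  assumes "a > 0" "a ^ m \<le> 2.716 ^ k"
  shows "real m * ln a \<le> real k"
proof -
  have "(2.716 :: real) ^ k \<le> exp 1 ^ k" by (rule power_mono[OF exp_1_ge]) simp
  then have "a ^ m \<le> exp 1 ^ k" using assms(2) by linarith
  then have "ln (a ^ m) \<le> ln (exp 1 ^ k)" using assms(1) by (subst ln_le_cancel_iff) simp_all
  then show ?thesis using assms(1) by (simp add: ln_realpow)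
qed

definition theta :: "real \<Rightarrow> real" where
  "theta x = (\<Sum>p | prime p \<and> real p \<le> x. ln (real p))"

lemma finite_primes_le: "finite {p. prime p \<and> real p \<le> x}"
proof (rule finite_subset)
  show "{p. prime p \<and> real p \<le> x} \<subseteq> {..nat \<lfloor>x\<rfloor>}"
    by (auto simp: le_nat_floor)
qed simp

lemma theta_mono: "x \<le> y \<Longrightarrow> theta x \<le> theta y"
  unfolding theta_def by (intro sum_mono2 finite_primes_le) (auto dest: prime_gt_0_nat)

lemma theta_le_trivial:
  assumes "x \<ge> 1"
  shows "theta x \<le> x * ln x"
proof -
  have "theta x \<le> (\<Sum>p | prime p \<and> real p \<le> x. ln x)"
    unfolding theta_def using assms by (intro sum_mono) (auto dest: prime_gt_0_nat)
  also have "\<dots> = real (card {p. prime p \<and> real p \<le> x}) * ln x" by simp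
  also have "card {p. prime p \<and> real p \<le> x} \<le> card {1..nat \<lfloor>x\<rfloor>}"
    by (intro card_mono) (auto simp: le_nat_floor Suc_le_eq dest: prime_gt_0_nat)
  then have "real (card {p. prime p \<and> real p \<le> x}) \<le> x"
    using assms by (simp add: le_nat_iff) linarith
  then have "real (card {p. prime p \<and> real p \<le> x}) * ln x \<le> x * ln x"
    using assms by (intro mult_right_mono) auto
  finally show ?thesis .
qed

context zero_free_height begin

text \<open>
  Multiply the smoothed estimate \<open>fejer_sum_le\<close> by \<open>e^y\<close> and integrate over \<open>y\<close>.  A prime \<open>p\<close> contributes at least
  \<open>ln p / p\<close> times the integral over \<open>\<bar>y - ln p\<bar> \<le> w\<close>, where \<open>e^y \<ge> p e^{-w}\<close>, hence at least
  \<open>ln p * e^{-w}\<close> times the mass of the window.  The primes up to \<open>e^{Y+w}\<close>, whose windows are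
  not covered, are kept as a separate term.
\<close>

lemma theta_le_smoothed:
  assumes w: "w > 0" "T * w \<ge> 3" and y: "0 < Y" "Y \<le> ln x + w" and x: "x > 0"
  shows "theta x \<le> theta (exp (Y + w)) + exp (2 * w) * x * (1 + (8 / (T * w) + 5 * T / eta ^ 2 / Y) / (9 / 2))"
proof -
  define W where "W = integral {-w..w} (fejer T)"
  define E where "E = 8 / (T * w) + 5 * T / eta ^ 2 / Y"
  define y1 where "y1 = ln x + w"
  have W: "W \<ge> 9 / 2" unfolding W_def by (rule fejer_window_ge[OF T_pos w(2)])
  have E: "E \<ge> 0" unfolding E_def using T_pos w y eta_pos by simp
  define A where "A = {p. prime p \<and> real p \<le> x} - {p. prime p \<and> real p \<le> exp (Y + w)}"
  have A: "finite A" unfolding A_def using finite_primes_le by blast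
  have p0: "real p > 0" if "p \<in> A" for p using that by (auto simp: A_def dest: prime_gt_0_nat)
  have pA: "Y + w \<le> ln (real p)" "ln (real p) + w \<le> y1" if "p \<in> A" for p
  proof -
    have "exp (Y + w) < real p" "real p \<le> x" using that by (auto simp: A_def)
    then show "Y + w \<le> ln (real p)" "ln (real p) + w \<le> y1"
      using p0[OF that] x by (auto simp: y1_def ln_ge_iff)
  qed
  let ?g = "\<lambda>p y. exp y * (ln (real p) / real p * fejer T (y - ln (real p)))"
  have fc: "continuous_on B (\<lambda>y. fejer T (y - c))" for B c
    by (intro continuous_on_compose2[OF fejer_continuous[of UNIV]] continuous_intros) auto
  have gint: "?g p integrable_on {a..b}" for p a b
    by (intro integrable_continuous_interval continuous_intros fc)
  have upper: "(\<Sum>p\<in>A. ?g p y) \<le> (W + E) * exp y" if yy: "y \<in> {Y..y1}" for y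
  proof -
    have "(\<Sum>p\<in>A. ln (real p) / real p * fejer T (y - ln (real p))) = (\<Sum>p\<in>A. mangoldt p / real p * fejer T (y - ln (real p)))"
      by (rule sum.cong) (auto simp: A_def)
    also have "\<dots> \<le> integral {-w..w} (fejer T) + 8 / (T * w) + 5 * T / eta ^ 2 / y"
      by (rule fejer_sum_le[OF A w(1)]) (use yy y in auto)
    also have "5 * T / eta ^ 2 / y \<le> 5 * T / eta ^ 2 / Y"
      using yy y T_pos eta_pos by (intro divide_left_mono) auto
    finally have "(\<Sum>p\<in>A. ln (real p) / real p * fejer T (y - ln (real p))) \<le> W + E"
      by (simp add: W_def E_def)
    from mult_left_mono[OF this, of "exp y"] show ?thesis by (simp add: sum_distrib_left mult.commute)
  qed
  have "(\<Sum>p\<in>A. ln (real p) * (exp (-w) * W)) \<le> (\<Sum>p\<in>A. integral {Y..y1} (?g p))"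
  proof (rule sum_mono)
    fix p assume p: "p \<in> A"
    have lnp: "ln (real p) \<ge> 0" using p by (auto simp: A_def dest: prime_gt_0_nat)
    let ?c = "ln (real p) * exp (-w)"
    have "ln (real p) * (exp (-w) * W) = ?c * integral {-w..w} (fejer T)" by (simp add: W_def)
    also have "integral {-w..w} (fejer T) = integral {ln (real p) - w..ln (real p) + w} (\<lambda>y. fejer T (y - ln (real p)))"
      using integral_shift_real_ivl[of "-w" "- ln (real p)" w "fejer T"] by (simp add: algebra_simps)
    also have "?c * \<dots> = integral {ln (real p) - w..ln (real p) + w} (\<lambda>y. ?c * fejer T (y - ln (real p)))"
      by (rule Henstock_Kurzweil_Integration.integral_mult_right[symmetric])
    also have "\<dots> \<le> integral {ln (real p) - w..ln (real p) + w} (?g p)"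
    proof (rule Henstock_Kurzweil_Integration.integral_le[OF _ gint])
      show "(\<lambda>y. ?c * fejer T (y - ln (real p))) integrable_on {ln (real p) - w..ln (real p) + w}"
        by (intro integrable_continuous_interval continuous_intros fc)
      fix y assume y: "y \<in> {ln (real p) - w..ln (real p) + w}"
      have "real p * exp (- w) = exp (ln (real p) - w)" using p0[OF p] by (simp add: exp_diff exp_minus field_simps)
      also have "\<dots> \<le> exp y" using y by simp
      finally have "exp (- w) \<le> exp y / real p" using p0[OF p] by (simp add: field_simps)
      then have "ln (real p) * exp (- w) * fejer T (y - ln (real p)) \<le> ln (real p) * (exp y / real p) * fejer T (y - ln (real p))"
        by (intro mult_right_mono mult_left_mono fejer_nonneg[OF T_pos] lnp)
      then show "?c * fejer T (y - ln (real p)) \<le> ?g p y" by (simp add: mult_ac)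
    qed
    also have "\<dots> \<le> integral {Y..y1} (?g p)"
    proof (rule Henstock_Kurzweil_Integration.integral_subset_le[OF _ gint gint])
      show "{ln (real p) - w..ln (real p) + w} \<subseteq> {Y..y1}" using pA[OF p] by auto
      show "\<forall>y\<in>{Y..y1}. 0 \<le> ?g p y"
      proof
        fix y show "0 \<le> ?g p y" using lnp fejer_nonneg[OF T_pos, of "y - ln (real p)"] by simp
      qed
    qed
    finally show "ln (real p) * (exp (-w) * W) \<le> integral {Y..y1} (?g p)" .
  qed
  also have "\<dots> = integral {Y..y1} (\<lambda>y. \<Sum>p\<in>A. ?g p y)"
    by (rule Henstock_Kurzweil_Integration.integral_sum[symmetric, OF A gint])
  also have "\<dots> \<le> (W + E) * exp y1 - (W + E) * exp Y"
  proof (rule has_integral_le)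
    show "((\<lambda>y. \<Sum>p\<in>A. ?g p y) has_integral integral {Y..y1} (\<lambda>y. \<Sum>p\<in>A. ?g p y)) {Y..y1}"
      by (rule integrable_integral[OF integrable_sum[OF A gint]])
    show "((\<lambda>y. (W + E) * exp y) has_integral ((W + E) * exp y1 - (W + E) * exp Y)) {Y..y1}"
    proof (rule fundamental_theorem_of_calculus)
      fix t show "((\<lambda>y. (W + E) * exp y) has_vector_derivative (W + E) * exp t) (at t within {Y..y1})"
        by (auto intro!: derivative_eq_intros simp: has_real_derivative_iff_has_vector_derivative[symmetric])
    qed (use y y1_def in simp)
  qed (rule upper)
  also have "\<dots> \<le> (W + E) * exp y1" using W E by simp
  finally have "(\<Sum>p\<in>A. ln (real p)) * (exp (-w) * W) \<le> (W + E) * exp y1" by (simp add: sum_distrib_right)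
  also have "exp y1 = x * exp w" using x by (simp add: y1_def exp_add)
  finally have *: "(\<Sum>p\<in>A. ln (real p)) * (exp (-w) * W) \<le> (W + E) * (x * exp w)" .
  have "(\<Sum>p\<in>A. ln (real p)) * W = ((\<Sum>p\<in>A. ln (real p)) * (exp (-w) * W)) * exp w"
    by (simp add: exp_minus)
  also have "\<dots> \<le> ((W + E) * (x * exp w)) * exp w" by (rule mult_right_mono[OF *]) simp
  also have "\<dots> = exp (2 * w) * x * (W + E)"
  proof -
    have ee: "exp (2 * w) = exp w * exp w" by (simp add: mult_exp_exp)
    show ?thesis unfolding ee by (simp only: mult_ac)
  qed
  finally have "(\<Sum>p\<in>A. ln (real p)) \<le> exp (2 * w) * x * (W + E) / W" using W by (simp add: pos_le_divide_eq)
  also have "\<dots> = exp (2 * w) * x * (1 + E / W)" using W by (simp add: field_simps)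
  also have "\<dots> \<le> exp (2 * w) * x * (1 + E / (9 / 2))"
    using W E x by (intro mult_left_mono add_left_mono divide_left_mono) auto
  finally have sumA: "(\<Sum>p\<in>A. ln (real p)) \<le> exp (2 * w) * x * (1 + E / (9 / 2))" .
  have "theta x \<le> (\<Sum>p\<in>A \<union> {p. prime p \<and> real p \<le> exp (Y + w)}. ln (real p))"
    unfolding theta_def by (intro sum_mono2) (auto simp: A_def finite_primes_le dest: prime_gt_0_nat)
  also have "\<dots> = (\<Sum>p\<in>A. ln (real p)) + theta (exp (Y + w))"
    unfolding theta_def by (rule sum.union_disjoint) (auto simp: A finite_primes_le A_def)
  finally show ?thesis using sumA unfolding E_def by linarith
qed

lemma inverse_eta_sq_le: "1 / eta ^ 2 \<le> (143 * 10 ^ 15) * (T + 2) ^ 5"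
proof -
  have q2: "q ^ 2 = T + 2" using T by (simp add: q_def)
  have "16 * slope ^ 4 * (1.34 * zbound) = (16 * 36 ^ 4 * 1.34 * 10.5) * (q ^ 4 * q)"
    unfolding slope_def zbound_def by (simp add: power_mult_distrib)
  then have "1 / eta ^ 2 = ((16 * 36 ^ 4 * 1.34 * 10.5) * (q ^ 4 * q)) ^ 2"
    by (simp only: eta_def power_divide power_one divide_divide_eq_right mult_1_left div_by_1)
  also have "\<dots> = (16 * 36 ^ 4 * 1.34 * 10.5) ^ 2 * (q ^ 4 * q) ^ 2"
    by (rule power_mult_distrib)
  also have "(q ^ 4 * q) ^ 2 = (q ^ 2) ^ 5" by (simp add: eval_nat_numeral mult_ac)
  also have "(16 * 36 ^ 4 * 1.34 * 10.5) ^ 2 * (q ^ 2) ^ 5 \<le> (143 * 10 ^ 15) * (q ^ 2) ^ 5"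
    by (intro mult_right_mono) (simp_all add: power2_eq_square)
  finally show ?thesis unfolding q2 .
qed

end

text \<open>
  The exponent \<open>13\<close> is what the error term needs: \<open>T / eta\<^sup>2\<close> is of size \<open>L^12\<close>, and it must be beaten
  by a further factor \<open>L\<close>.  Convexity of \<open>exp\<close> reduces the claim to \<open>L = 95\<close>.
\<close>

lemma exp_ge_power_13:
  fixes L :: real
  assumes L: "L \<ge> 95"
  shows "exp L \<ge> 10 ^ 15 * L ^ 13"
proof -
  have "exp (95::real) = exp 1 ^ 95" by (simp add: exp_of_nat_mult[symmetric])
  also have "\<dots> \<ge> 2.716 ^ 95" by (rule power_mono[OF exp_1_ge]) simp
  finally have e: "exp (95::real) \<ge> 10 ^ 15 * 95 ^ 13" by (rule order_trans[rotated]) (simp add: power_divide)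
  have "exp ((L - 95) / 13) \<ge> 1 + (L - 95) / 13" by (rule exp_ge_add_one_self)
  moreover have "1 + (L - 95) / 13 \<ge> L / 95" using L by (simp add: field_simps)
  ultimately have "exp ((L - 95) / 13) \<ge> L / 95" by linarith
  then have "(L / 95) ^ 13 \<le> exp ((L - 95) / 13) ^ 13" using L by (intro power_mono) auto
  also have "\<dots> = exp (L - 95)" by (simp add: exp_of_nat_mult[symmetric])
  finally have "(10 ^ 15 * 95 ^ 13) * (L / 95) ^ 13 \<le> exp 95 * exp (L - 95)"
    using e L by (intro mult_mono) auto
  then show ?thesis by (simp add: exp_add[symmetric] power_divide)
qed

text \<open>
  The previous estimate with \<open>T = L\<^sup>2 / 5\<close>, \<open>w = 5 / (2 L)\<close> and \<open>Y = ln x / 2\<close>.  The window costs a factor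
  \<open>e^{2w}\<close>, about \<open>1 + 5 / L\<close>; the tail of the kernel costs \<open>8 / (T w) / (9/2) = 32 / (9 L)\<close>.  The total stays
  below \<open>1 + 9.2 / L\<close>.
\<close>

lemma theta_le_sharp:
  assumes L: "L \<ge> 95" and x: "x = exp (exp L)"
  shows "theta x \<le> x * (1 + 9.2 / L)"
proof -
  define T where "T = L ^ 2 / 5"
  define w where "w = 5 / (2 * L)"
  have L2: "L ^ 2 \<ge> 95 ^ 2" using L by (intro power_mono) auto
  interpret zero_free_height T by standard (use L2 in \<open>simp add: T_def\<close>)
  define Y where "Y = exp L / 2"
  have big: "exp L \<ge> 10 ^ 15 * L ^ 13" by (rule exp_ge_power_13[OF L])
  have Tw: "T * w = L / 2" using L by (simp add: T_def w_def power2_eq_square)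
  have L13: "L ^ 13 \<ge> L" using L by (intro self_le_power) auto
  have w: "w > 0" "w \<le> 1" using L by (auto simp: w_def)
  have Y: "Y \<ge> 10 ^ 14 * L ^ 13" "Y \<ge> 10 ^ 14 * L" using big L13 L by (auto simp: Y_def)
  have Y4: "Y \<ge> (4 * 10 ^ 14) * L ^ 13"
  proof -
    have "c / 2 \<ge> (4 * 10 ^ 14) * z" if "c \<ge> 10 ^ 15 * z" "z \<ge> 0" for c z :: real using that by simp
    from this[OF big] show ?thesis unfolding Y_def using L by simp
  qed
  have main: "theta x \<le> theta (exp (Y + w)) + exp (2 * w) * x * (1 + (8 / (T * w) + 5 * T / eta ^ 2 / Y) / (9 / 2))"
    by (rule theta_le_smoothed) (use w Tw L Y x in \<open>auto simp: Y_def\<close>)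
  have err: "5 * T / eta ^ 2 / Y \<le> 0.4 / L"
  proof -
    have T2: "T + 2 \<le> L ^ 2 / 4.9" using L2 by (simp add: T_def)
    have "5 * T / eta ^ 2 \<le> 5 * (T + 2) * ((143 * 10 ^ 15) * (T + 2) ^ 5)"
      using mult_mono[OF _ inverse_eta_sq_le, of "5 * T" "5 * (T + 2)"] T_pos eta_pos by simp
    also have "\<dots> = (715 * 10 ^ 15) * (T + 2) ^ 6"
    proof -
      have "5 * z * (143 * 10 ^ 15 * z ^ 5) = 715 * 10 ^ 15 * z ^ 6" for z :: real by (simp add: eval_nat_numeral)
      then show ?thesis .
    qed
    also have "\<dots> \<le> (715 * 10 ^ 15) * (L ^ 2 / 4.9) ^ 6"
      using T2 T_pos by (intro mult_left_mono power_mono) auto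
    also have "\<dots> = (715 * 10 ^ 15) / 4.9 ^ 6 * L ^ 12" by (simp add: power_divide power_mult[symmetric])
    also have "\<dots> \<le> (6 * 10 ^ 13) * L ^ 12" using L by (intro mult_right_mono) (auto simp: power_divide)
    finally have "5 * T / eta ^ 2 / Y \<le> (6 * 10 ^ 13) * L ^ 12 / Y" using Y L by (intro divide_right_mono) auto
    also have "\<dots> \<le> (6 * 10 ^ 13) * L ^ 12 / ((4 * 10 ^ 14) * L ^ 13)"
      using Y4 L Y by (intro divide_left_mono mult_pos_pos) auto
    also have "\<dots> \<le> 0.4 / L" using L by (simp add: field_simps eval_nat_numeral)
    finally show ?thesis .
  qed
  have e2w: "exp (2 * w) \<le> 1 + 5.27 / L"
  proof -
    have w2: "2 * w = 5 / L" by (simp add: w_def)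
    have "exp (5 / L) \<le> 1 + 5 / L + (5 / L) ^ 2" by (rule exp_bound) (use L in auto)
    also have "1 + 5 / L + (5 / L) ^ 2 \<le> 1 + 5.27 / L"
      using L by (simp add: field_simps power2_eq_square)
    finally show ?thesis unfolding w2 .
  qed
  have E: "(8 / (T * w) + 5 * T / eta ^ 2 / Y) / (9 / 2) \<le> 3.65 / L"
  proof -
    have "8 / (T * w) = 16 / L" using L by (simp add: Tw)
    then have "(8 / (T * w) + 5 * T / eta ^ 2 / Y) / (9 / 2) \<le> (16 / L + 0.4 / L) / (9 / 2)"
      using err by (intro divide_right_mono) auto
    also have "\<dots> \<le> 3.65 / L" using L by (simp add: field_simps)
    finally show ?thesis .
  qed
  have x0: "x > 0" by (simp add: x)
  have "exp (2 * w) * x * (1 + (8 / (T * w) + 5 * T / eta ^ 2 / Y) / (9 / 2)) \<le> (1 + 5.27 / L) * x * (1 + 3.65 / L)"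
    using e2w E x0 L T_pos w Y eta_pos by (intro mult_mono add_left_mono) auto
  also have "\<dots> = x * (1 + 8.92 / L + 19.2355 / L ^ 2)" using L by (simp add: field_simps power2_eq_square)
  also have "\<dots> \<le> x * (1 + 9.15 / L)"
    using L x0 by (intro mult_left_mono) (simp_all add: field_simps power2_eq_square)
  finally have a: "exp (2 * w) * x * (1 + (8 / (T * w) + 5 * T / eta ^ 2 / Y) / (9 / 2)) \<le> x * (1 + 9.15 / L)" .
  have "theta (exp (Y + w)) \<le> exp (Y + w) * ln (exp (Y + w))"
    by (rule theta_le_trivial) (use w Y L in simp)
  also have "\<dots> \<le> exp (Y + 1) * (Y + 1)" using w Y L by (intro mult_mono) auto
  also have "\<dots> \<le> x * (0.05 / L)"
  proof -
    have Y1: "Y \<ge> 10 ^ 15" using Y(2) L by simp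
    have ex: "x = exp Y * exp Y" by (simp add: x Y_def exp_add[symmetric])
    have "exp 1 * (Y + 1) * L \<le> 3 * (2 * Y) * Y / 10 ^ 14"
    proof -
      have "L \<le> Y / 10 ^ 14" using Y(2) by simp
      moreover have "exp 1 * (Y + 1) \<le> 3 * (2 * Y)" using exp_le Y1 by (intro mult_mono) auto
      ultimately have "exp 1 * (Y + 1) * L \<le> 3 * (2 * Y) * (Y / 10 ^ 14)"
        using L Y1 by (intro mult_mono[of "exp 1 * (Y + 1)" "3 * (2 * Y)"]) auto
      then show ?thesis by simp
    qed
    also have "\<dots> \<le> 0.05 * (Y ^ 2 / 2)" using Y1 by (simp add: power2_eq_square)
    also have "\<dots> \<le> 0.05 * exp Y"
      using exp_lower_Taylor_quadratic[of Y] Y1 by (intro mult_left_mono) auto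
    finally have "exp Y * (exp 1 * (Y + 1)) \<le> exp Y * (0.05 * exp Y / L)"
      using L by (intro mult_left_mono) (simp_all add: field_simps)
    then show ?thesis by (simp add: ex exp_add mult_ac)
  qed
  finally have "theta x \<le> x * (0.05 / L) + x * (1 + 9.15 / L)" using main a by linarith
  also have "\<dots> = x * (1 + 9.2 / L)" by (simp add: field_simps)
  finally show ?thesis .
qed

section \<open>Chebyshev bound and Mertens sum\<close>

lemma ln_fact_bounds:
  assumes "n > 0"
  shows "real n * ln (real n) - real n + 1 \<le> ln (fact n)"
    and "ln (fact n) \<le> real n * ln (real n) - real n + 1 + ln (real n)"
proof -
  have "real n * ln (real n) - real n + 1 \<le> ln (fact n) \<and>
        ln (fact n) \<le> real n * ln (real n) - real n + 1 + ln (real n)"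
    using assms
  proof (induction n rule: nat_induct_non_zero)
    case (Suc n)
    define d where "d = ln (real (Suc n)) - ln (real n)"
    have "1 + 1 / real n = real (Suc n) / real n" using Suc.hyps by (simp add: field_simps)
    then have "d = ln (1 + 1 / real n)"
      using Suc.hyps ln_div[of "real (Suc n)" "real n"] by (simp add: d_def)
    then have "d \<le> 1 / real n" using Suc.hyps ln_add_one_self_le_self[of "1 / real n"] by simp
    then have d1: "real n * d \<le> 1" using Suc.hyps by (simp add: field_simps)
    have "1 + - (1 / real (Suc n)) = real n / real (Suc n)" by (simp add: field_simps)
    then have "- d = ln (1 + - (1 / real (Suc n)))"
      using Suc.hyps ln_div[of "real n" "real (Suc n)"] by (simp add: d_def)
    also have "\<dots> \<le> - (1 / real (Suc n))"
      by (rule ln_add_one_self_le_self2) (use Suc.hyps in \<open>simp add: field_simps\<close>)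
    finally have "1 / real (Suc n) \<le> d" by simp
    then have d2: "1 \<le> (real n + 1) * d" by (simp add: field_simps)
    have f: "ln (fact (Suc n)) = ln (real (Suc n)) + ln (fact n)"
      by (simp add: ln_mult del: of_nat_Suc)
    have "real (Suc n) * ln (real (Suc n)) = real n * ln (real n) + real n * d + ln (real (Suc n))"
      by (simp add: d_def algebra_simps)
    then show ?case unfolding f using Suc.IH d1 d2 by (simp add: d_def algebra_simps)
  qed simp
  then show "real n * ln (real n) - real n + 1 \<le> ln (fact n)"
    and "ln (fact n) \<le> real n * ln (real n) - real n + 1 + ln (real n)" by auto
qed

text \<open>
  De Polignac's formula; the upper limit \<open>K\<close> is kept free so that several factorials can be expanded
  over the same range.
\<close>

lemma ln_fact_eq_sum_mangoldt:
  assumes "n \<le> K"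
  shows "ln (fact n) = (\<Sum>d=1..K. mangoldt d * real (n div d))"
  using assms
proof (induction n)
  case (Suc n)
  have "(\<Sum>d=1..K. mangoldt d * real (Suc n div d)) = (\<Sum>d=1..K. mangoldt d * real (n div d) + (if d dvd Suc n then mangoldt d else 0))"
    by (rule sum.cong) (auto simp: div_Suc dvd_eq_mod_eq_0 algebra_simps)
  also have "\<dots> = (\<Sum>d=1..K. mangoldt d * real (n div d)) + (\<Sum>d=1..K. if d dvd Suc n then mangoldt d else 0)"
    by (rule sum.distrib)
  also have "(\<Sum>d=1..K. if d dvd Suc n then mangoldt d else 0) = (\<Sum>d\<in>{d \<in> {1..K}. d dvd Suc n}. mangoldt d :: real)"
    by (rule sum.inter_filter[symmetric]) simp
  also have "{d \<in> {1..K}. d dvd Suc n} = {d. d dvd Suc n}"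
  proof -
    have "1 \<le> d \<and> d \<le> K" if "d dvd Suc n" for d
      using that Suc.prems dvd_imp_le[OF that] dvd_pos_nat[OF _ that] by auto
    then show ?thesis by auto
  qed
  also have "(\<Sum>d | d dvd Suc n. mangoldt d) = ln (real (Suc n))"
    using mangoldt_sum[of "Suc n", where 'a = real] by simp
  finally show ?case using Suc by (simp add: ln_mult del: of_nat_Suc)
qed simp

text \<open>
  With \<open>t = 30m div d\<close>, this says that \<open>\<Lambda>(d)\<close> occurs in
  \<open>ln ((30m)! m! / ((15m)! (10m)! (6m)!))\<close> with a nonnegative coefficient, which is positive
  if \<open>5m < d \<le> 30m\<close>.
\<close>

lemma chebyshev_coefficient:
  fixes t :: nat
  shows "t div 2 + t div 3 + t div 5 \<le> t + t div 30"
    and "1 \<le> t \<Longrightarrow> t \<le> 5 \<Longrightarrow> t div 2 + t div 3 + t div 5 + 1 \<le> t + t div 30"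
proof -
  \<comment> \<open>both sides grow by \<open>31\<close> when \<open>t\<close> grows by \<open>30\<close>, so it suffices to check one period\<close>
  define a b where "a = t div 30" and "b = t mod 30"
  have t: "t = 30 * a + b" "b < 30" by (simp_all add: a_def b_def)
  have "b div 2 + b div 3 + b div 5 \<le> b"
  proof -
    have "\<forall>b\<in>{0..<30::nat}. b div 2 + b div 3 + b div 5 \<le> b" by code_simp
    with t(2) show ?thesis by auto
  qed
  moreover have "(30 * a + b) div 2 = 15 * a + b div 2" "(30 * a + b) div 3 = 10 * a + b div 3"
    "(30 * a + b) div 5 = 6 * a + b div 5" "(30 * a + b) div 30 = a"
    using t(2) by simp_all
  ultimately show "t div 2 + t div 3 + t div 5 \<le> t + t div 30" unfolding t(1) by linarith
next
  assume "1 \<le> t" "t \<le> 5"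
  then have "t \<in> {1, 2, 3, 4, 5}" by auto
  then show "t div 2 + t div 3 + t div 5 + 1 \<le> t + t div 30" by auto
qed

text \<open>
  Expand all factorials by de Polignac's formula and keep only the coefficients of the primes between
  \<open>5m\<close> and \<open>30m\<close>; the others are nonnegative.
\<close>

lemma theta_diff_le:
  assumes m: "m > 0"
  shows "theta (real (30 * m)) - theta (real (5 * m)) \<le> ln (fact (30 * m)) + ln (fact m) - ln (fact (15 * m)) - ln (fact (10 * m)) - ln (fact (6 * m))"
proof -
  define c where "c = (\<lambda>d. real (30 * m div d) + real (m div d) - real (15 * m div d) - real (10 * m div d) - real (6 * m div d))"
  have c: "c d \<ge> 0" "5 * m < d \<Longrightarrow> d \<le> 30 * m \<Longrightarrow> c d \<ge> 1" if "d \<ge> 1" for d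
  proof -
    define t where "t = 30 * m div d"
    have e: "15 * m div d = t div 2" "10 * m div d = t div 3" "6 * m div d = t div 5" "m div d = t div 30"
      unfolding t_def div_mult2_eq[symmetric]
      using div_mult_mult2[of 2 "15 * m" d] div_mult_mult2[of 3 "10 * m" d] div_mult_mult2[of 5 "6 * m" d] div_mult_mult2[of 30 m d]
      by (simp_all add: mult_ac)
    show "c d \<ge> 0" using chebyshev_coefficient(1)[of t] unfolding c_def e t_def[symmetric] by linarith
    assume d: "5 * m < d" "d \<le> 30 * m"
    have "1 \<le> t" using d that by (simp add: t_def div_greater_zero_iff Suc_le_eq)
    moreover have "t < 6" unfolding t_def using d that by (intro less_mult_imp_div_less) simp
    ultimately show "c d \<ge> 1" using chebyshev_coefficient(2)[of t] unfolding c_def e t_def[symmetric] by linarith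
  qed
  have "theta (real (30 * m)) - theta (real (5 * m)) = (\<Sum>p | prime p \<and> 5 * m < p \<and> p \<le> 30 * m. ln (real p))"
  proof -
    have "{p. prime p \<and> real p \<le> real (30 * m)} = {p. prime p \<and> real p \<le> real (5 * m)} \<union> {p. prime p \<and> 5 * m < p \<and> p \<le> 30 * m}"
      by auto
    moreover have "finite {p. prime p \<and> 5 * m < p \<and> p \<le> 30 * m}" by (rule finite_subset[of _ "{..30 * m}"]) auto
    ultimately have "theta (real (30 * m)) = theta (real (5 * m)) + (\<Sum>p | prime p \<and> 5 * m < p \<and> p \<le> 30 * m. ln (real p))"
      unfolding theta_def by (simp only:) (intro sum.union_disjoint, auto simp: finite_primes_le)
    then show ?thesis by simp
  qed
  also have "\<dots> \<le> (\<Sum>p | prime p \<and> 5 * m < p \<and> p \<le> 30 * m. mangoldt p * c p)"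
  proof (rule sum_mono)
    fix p assume p: "p \<in> {p. prime p \<and> 5 * m < p \<and> p \<le> 30 * m}"
    have "ln (real p) * 1 \<le> ln (real p) * c p"
      using p by (intro mult_left_mono c) (auto dest: prime_gt_0_nat)
    then show "ln (real p) \<le> mangoldt p * c p" using p by simp
  qed
  also have "\<dots> \<le> (\<Sum>d=1..30*m. mangoldt d * c d)"
    by (intro sum_mono2) (auto intro!: mult_nonneg_nonneg mangoldt_nonneg c dest: prime_gt_0_nat)
  also have "\<dots> = ln (fact (30 * m)) + ln (fact m) - ln (fact (15 * m)) - ln (fact (10 * m)) - ln (fact (6 * m))"
  proof -
    have f: "ln (fact k) = (\<Sum>d=1..30*m. mangoldt d * real (k div d))" if "k \<le> 30 * m" for k
      by (rule ln_fact_eq_sum_mangoldt[OF that])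
    have le: "30 * m \<le> 30 * m" "m \<le> 30 * m" "15 * m \<le> 30 * m" "10 * m \<le> 30 * m" "6 * m \<le> 30 * m" by simp_all
    show ?thesis unfolding f[OF le(1)] f[OF le(2)] f[OF le(3)] f[OF le(4)] f[OF le(5)] c_def
      by (simp only: sum.distrib[symmetric] sum_subtractf[symmetric] distrib_left[symmetric] right_diff_distrib[symmetric])
  qed
  finally show ?thesis .
qed

text \<open>
  The left-hand side is \<open>30 ln 30 - 15 ln 15 - 10 ln 10 - 6 ln 6\<close>, the growth rate in \<open>m\<close> of Chebyshev's
  quotient of factorials.
\<close>

lemma chebyshev_constant: "14 * ln 2 + 9 * ln 3 + 5 * ln 5 \<le> (27.7 :: real)"
proof -
  have "14 * ln a + 9 * ln b + 5 * ln c = ln (a ^ 14 * b ^ 9 * c ^ 5)" if "a > 0" "b > 0" "c > 0" for a b c :: real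
    using that by (simp add: ln_mult ln_realpow)
  from this[of 2 3 5] have eq: "14 * ln 2 + 9 * ln 3 + 5 * ln (5::real) = ln (2 ^ 14 * 3 ^ 9 * 5 ^ 5)"
    by (simp only: zero_less_numeral)
  have "3 * ln (2 ^ 14 * 3 ^ 9 * 5 ^ 5 :: real) \<le> 83"
    using ln_le_of_power_le[of "2 ^ 14 * 3 ^ 9 * 5 ^ 5" 3 83] by (simp add: power_divide)
  then show ?thesis unfolding eq by simp
qed

lemma theta_step:
  assumes m: "m > 0"
  shows "theta (real (30 * m)) \<le> theta (real (5 * m)) + 27.7 * real m + 2 * ln (30 * real m)"
proof -
  define M where "M = ln (real m)"
  have l: "ln (30 * real m) = ln 2 + ln 3 + ln 5 + M" "ln (15 * real m) = ln 3 + ln 5 + M"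
    "ln (10 * real m) = ln 2 + ln 5 + M" "ln (6 * real m) = ln 2 + ln 3 + M"
    using m ln_mult[of 30 "real m"] ln_mult[of 15 "real m"] ln_mult[of 10 "real m"] ln_mult[of 6 "real m"]
      ln_mult[of 6 "5::real"] ln_mult[of 2 "3::real"] ln_mult[of 3 "5::real"] ln_mult[of 2 "5::real"]
    by (simp_all add: M_def)
  have M0: "M \<ge> 0" using m by (simp add: M_def)
  have "theta (real (30 * m)) - theta (real (5 * m)) \<le>
     (30 * real m * ln (30 * real m) - 30 * real m + 1 + ln (30 * real m)) + (real m * M - real m + 1 + M)
     - (15 * real m * ln (15 * real m) - 15 * real m + 1) - (10 * real m * ln (10 * real m) - 10 * real m + 1)
     - (6 * real m * ln (6 * real m) - 6 * real m + 1)"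
    using theta_diff_le[OF m] ln_fact_bounds(2)[of "30 * m"] ln_fact_bounds(2)[of m]
      ln_fact_bounds(1)[of "15 * m"] ln_fact_bounds(1)[of "10 * m"] ln_fact_bounds(1)[of "6 * m"] m
    by (simp add: M_def)
  also have "\<dots> = (14 * ln 2 + 9 * ln 3 + 5 * ln 5) * real m + ln (30 * real m) + M - 1"
    unfolding l by (simp add: algebra_simps)
  also have "\<dots> \<le> 27.7 * real m + ln (30 * real m) + M - 1"
    by (intro add_right_mono diff_right_mono mult_right_mono chebyshev_constant) simp
  also have "M \<le> ln (30 * real m)" using m by (simp add: M_def)
  finally show ?thesis by simp
qed

text \<open>
  Iterating \<open>theta_step\<close> divides the argument by \<open>6\<close>, which gives the slope
  \<open>27.7 / 25 = 1.108\<close>; the excess of \<open>1.11\<close> absorbs the logarithmic terms for \<open>n \<ge> 10^5\<close>, and the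
  constant \<open>10^10\<close> covers the smaller \<open>n\<close>.
\<close>

lemma theta_le_chebyshev: "theta (real n) \<le> 1.11 * real n + 10 ^ 10"
proof (induction n rule: less_induct)
  case (less n)
  show ?case
  proof (cases "n < 10 ^ 5")
    case True
    show ?thesis
    proof (cases "n = 0")
      case False
      then have "theta (real n) \<le> real n * ln (real n)" by (intro theta_le_trivial) simp
      also have "\<dots> \<le> 10 ^ 5 * 10 ^ 5"
      proof (rule mult_mono)
        have "ln (real n) \<le> real n" using False ln_le_minus_one[of "real n"] by simp
        then show "ln (real n) \<le> 10 ^ 5" using True by simp
      qed (use True False in auto)
      finally show ?thesis by simp
    next
      case True
      have "theta 0 = 0" unfolding theta_def by (rule sum.neutral) (auto dest: prime_gt_0_nat)
      then show ?thesis using True by simp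
    qed
  next
    case False
    define m where "m = n div 30 + 1"
    have m: "m > 0" "n \<le> 30 * m" "30 * m \<le> n + 30" "5 * m < n" using False by (auto simp: m_def)
    have r: "real m \<le> real n / 30 + 1" using m(3) by simp
    have big: "real n \<ge> 10 ^ 5" using False by simp
    have "theta (real n) \<le> theta (real (30 * m))" by (rule theta_mono) (use m in simp)
    also have "\<dots> \<le> theta (real (5 * m)) + 27.7 * real m + 2 * ln (30 * real m)" by (rule theta_step[OF m(1)])
    also have "theta (real (5 * m)) \<le> 1.11 * real (5 * m) + 10 ^ 10" by (rule less.IH[OF m(4)])
    also have "ln (30 * real m) \<le> 2 * real n / 10 ^ 4 + 9"
    proof -
      have "ln (30 * real m) \<le> ln (2 * real n)" using m r big by (subst ln_le_cancel_iff) auto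
      also have "\<dots> = ln (2 * real n / 10 ^ 4) + ln (10 ^ 4)" using big by (subst ln_div) auto
      also have "ln (2 * real n / 10 ^ 4) \<le> 2 * real n / 10 ^ 4 - 1" using big by (intro ln_le_minus_one) simp
      also have "ln (10 ^ 4 :: real) \<le> 10"
        using ln_le_of_power_le[of "10 ^ 4" 1 10] by (simp add: power_divide)
      finally show ?thesis by simp
    qed
    finally have "theta (real n) \<le> 1.11 * real (5 * m) + 10 ^ 10 + 27.7 * real m + 2 * (2 * real n / 10 ^ 4 + 9)" by simp
    then show ?thesis using r big by simp
  qed
qed

text \<open>
  The easy half of the Euler product: numbers with all prime factors in \<open>insert p P\<close> are uniquely
  \<open>p^k * r\<close> with the prime factors of \<open>r\<close> in \<open>P\<close>, and the sum over \<open>k\<close> is geometric.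
\<close>

lemma sum_inverse_smooth_le:
  assumes "finite P" "\<And>p. p \<in> P \<Longrightarrow> prime p"
  shows "finite F \<Longrightarrow> (\<And>m. m \<in> F \<Longrightarrow> m > 0 \<and> prime_factors m \<subseteq> P) \<Longrightarrow> (\<Sum>m\<in>F. 1 / real m) \<le> (\<Prod>p\<in>P. 1 / (1 - 1 / real p))"
  using assms
proof (induction P arbitrary: F rule: finite_induct)
  case empty
  have "F \<subseteq> {1}"
  proof
    fix m assume "m \<in> F"
    then have "m > 0" "prime_factors m = {}" using empty.prems by auto
    then show "m \<in> {1}" by (simp add: prime_factorization_empty_iff)
  qed
  then have "(\<Sum>m\<in>F. 1 / real m) \<le> (\<Sum>m\<in>{1}. 1 / real m)" by (intro sum_mono2) auto
  then show ?case by simp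
next
  case (insert p P)
  have p: "prime p" using insert.prems by simp
  have p1: "real p > 1" using prime_gt_1_nat[OF p] by simp
  let ?h = "\<lambda>m. (multiplicity p m, m div p ^ multiplicity p m)"
  have decomp: "m = p ^ multiplicity p m * (m div p ^ multiplicity p m)" for m
    by (simp add: multiplicity_dvd)
  have inj: "inj_on ?h F"
    by (rule inj_on_inverseI[where g = "\<lambda>(k, r). p ^ k * r"]) (simp add: multiplicity_dvd)
  define F' where "F' = (\<lambda>m. m div p ^ multiplicity p m) ` F"
  define K where "K = Max (insert 0 (multiplicity p ` F))"
  have finF': "finite F'" unfolding F'_def using insert.prems by simp
  have sub: "?h ` F \<subseteq> {..K} \<times> F'" using insert.prems(1) by (auto simp: F'_def K_def intro!: Max_ge)
  have F': "m > 0 \<and> prime_factors m \<subseteq> P" if mF: "m \<in> F'" for m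
  proof -
    obtain k where k: "k \<in> F" "m = k div p ^ multiplicity p k" using mF unfolding F'_def by blast
    have k0: "k > 0" "prime_factors k \<subseteq> insert p P" using insert.prems(2)[OF k(1)] by auto
    have km: "p ^ multiplicity p k * m = k" unfolding k(2) by (rule decomp[symmetric])
    have m0: "m > 0"
    proof (rule Nat.gr0I)
      assume "m = 0"
      then have "k = 0" using km by simp
      then show False using k0(1) by simp
    qed
    have "m dvd k" using dvd_triv_right[of m "p ^ multiplicity p k"] unfolding km .
    then have "prime_factors m \<subseteq> prime_factors k" using k0 by (intro dvd_prime_factors) auto
    moreover have "\<not> p dvd m" unfolding k(2) using k0(1) prime_gt_1_nat[OF p] by (intro multiplicity_decompose) auto
    ultimately show ?thesis using m0 k0(2) by auto
  qed
  have "(\<Sum>m\<in>F. 1 / real m) = (\<Sum>m\<in>F. (\<lambda>(k, r). (1 / real p) ^ k * (1 / real r)) (?h m))"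
  proof (rule sum.cong[OF refl])
    fix m
    have "1 / real m = 1 / real (p ^ multiplicity p m * (m div p ^ multiplicity p m))" by (rule arg_cong[OF decomp])
    also have "\<dots> = (1 / real p) ^ multiplicity p m * (1 / real (m div p ^ multiplicity p m))"
      unfolding of_nat_mult of_nat_power by (simp add: power_divide)
    finally show "1 / real m = (\<lambda>(k, r). (1 / real p) ^ k * (1 / real r)) (?h m)" by simp
  qed
  also have "\<dots> = (\<Sum>z\<in>?h ` F. (\<lambda>(k, r). (1 / real p) ^ k * (1 / real r)) z)"
    by (rule sum.reindex_cong[OF inj, symmetric]) auto
  also have "\<dots> \<le> (\<Sum>z\<in>{..K} \<times> F'. (\<lambda>(k, r). (1 / real p) ^ k * (1 / real r)) z)"
    by (intro sum_mono2 sub) (auto simp: finF')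
  also have "\<dots> = (\<Sum>k\<le>K. (1 / real p) ^ k) * (\<Sum>r\<in>F'. 1 / real r)"
    by (simp add: sum_product sum.cartesian_product)
  also have "\<dots> \<le> 1 / (1 - 1 / real p) * (\<Prod>p\<in>P. 1 / (1 - 1 / real p))"
  proof (rule mult_mono)
    show "(\<Sum>k\<le>K. (1 / real p) ^ k) \<le> 1 / (1 - 1 / real p)"
    proof -
      have "(\<Sum>k\<le>K. (1 / real p) ^ k) \<le> (\<Sum>k. (1 / real p) ^ k)"
        using p1 by (intro sum_le_suminf summable_geometric) auto
      then show ?thesis using p1 by (subst (asm) suminf_geometric) auto
    qed
    show "(\<Sum>r\<in>F'. 1 / real r) \<le> (\<Prod>p\<in>P. 1 / (1 - 1 / real p))"
      by (rule insert.IH[OF finF' F']) (use insert.prems in auto)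
  qed (use p1 in \<open>auto intro!: sum_nonneg\<close>)
  finally show ?case using insert.hyps by simp
qed

lemma neg_ln_one_minus_le:
  assumes x: "0 \<le> x" "x < (1::real)"
  shows "- ln (1 - x) \<le> x + x ^ 2 / (2 * (1 - x))"
proof -
  let ?g = "\<lambda>x. x + x ^ 2 / (2 * (1 - x)) + ln (1 - x)"
  have "?g 0 \<le> ?g x"
  proof (rule DERIV_nonneg_imp_nondecreasing[OF x(1)])
    fix u assume u: "0 \<le> u" "u \<le> x"
    have u1: "1 - u > 0" using u x by simp
    have "(?g has_real_derivative (1 + (2 * u * (2 * (1 - u)) - u ^ 2 * (- 2)) / (2 * (1 - u)) ^ 2 - 1 / (1 - u))) (at u)"
      using u1 by (auto intro!: derivative_eq_intros simp: power2_eq_square)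
    moreover have "1 + (2 * u * (2 * (1 - u)) - u ^ 2 * (- 2)) / (2 * (1 - u)) ^ 2 - 1 / (1 - u) = u ^ 2 / (2 * (1 - u) ^ 2)"
    proof -
      have "1 + (2 * (1 - v) * (2 * v) - (1 - v) ^ 2 * (- 2)) / (2 * v) ^ 2 - 1 / v = (1 - v) ^ 2 / (2 * v ^ 2)" if "v > 0" for v :: real
        using that by (simp add: field_simps power2_eq_square)
      from this[OF u1] show ?thesis by simp
    qed
    ultimately show "\<exists>y. (?g has_real_derivative y) (at u) \<and> 0 \<le> y"
      by (intro exI[of _ "u ^ 2 / (2 * (1 - u) ^ 2)"]) auto
  qed
  then show ?thesis by simp
qed

text \<open>
  Take logarithms in \<open>ln n \<le> (\<Sum>m\<le>n. 1/m) \<le> (\<Prod>p\<le>n. 1 / (1 - 1/p))\<close>.  Replacing \<open>- ln (1 - 1/p)\<close> by \<open>1/p\<close> costs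
  at most \<open>1 / (2p (p - 1))\<close> for each prime, in total at most \<open>1/2\<close> by telescoping.
\<close>

lemma sum_inverse_primes_ge:
  assumes n: "n \<ge> 2"
  shows "(\<Sum>p | prime p \<and> p \<le> n. 1 / real p) \<ge> ln (ln (real n)) - 1 / 2"
proof -
  let ?P = "{p. prime p \<and> p \<le> n}"
  have fin: "finite ?P" by (rule finite_subset[of _ "{..n}"]) auto
  have p2: "real p \<ge> 2" if "p \<in> ?P" for p using that prime_ge_2_nat[of p] by auto
  have "ln (real n) \<le> ln (real n + 1)" using n by simp
  also have "\<dots> \<le> harm n" by (rule ln_le_harm)
  also have "harm n = (\<Sum>m\<in>{1..n}. 1 / real m)" by (simp add: harm_def divide_inverse)
  also have "\<dots> \<le> (\<Prod>p\<in>?P. 1 / (1 - 1 / real p))"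
  proof (rule sum_inverse_smooth_le[OF fin])
    fix m assume m: "m \<in> {1..n}"
    have "p \<le> n" if "p \<in> prime_factors m" for p
      using that m dvd_imp_le[of p m] in_prime_factors_imp_dvd[of p m] by simp
    then show "m > 0 \<and> prime_factors m \<subseteq> ?P" using m by auto
  qed auto
  finally have le: "ln (real n) \<le> (\<Prod>p\<in>?P. 1 / (1 - 1 / real p))" .
  have pos: "1 / (1 - 1 / real p) > 0" if "p \<in> ?P" for p using p2[OF that] by (simp add: field_simps)
  have "ln (ln (real n)) \<le> ln (\<Prod>p\<in>?P. 1 / (1 - 1 / real p))"
    using le n by (subst ln_le_cancel_iff) (auto intro!: prod_pos pos)
  also have "\<dots> = (\<Sum>p\<in>?P. ln (1 / (1 - 1 / real p)))"
    by (rule ln_prod) (use fin pos in auto)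
  also have "\<dots> \<le> (\<Sum>p\<in>?P. 1 / real p + 1 / (2 * real p * (real p - 1)))"
  proof (rule sum_mono)
    fix p assume p: "p \<in> ?P"
    have "ln (1 / (1 - 1 / real p)) = - ln (1 - 1 / real p)" using p2[OF p] by (simp add: ln_div)
    also have "\<dots> \<le> 1 / real p + (1 / real p) ^ 2 / (2 * (1 - 1 / real p))"
      by (rule neg_ln_one_minus_le) (use p2[OF p] in auto)
    also have "(1 / real p) ^ 2 / (2 * (1 - 1 / real p)) = 1 / (2 * real p * (real p - 1))"
      using p2[OF p] by (simp add: field_simps power2_eq_square)
    finally show "ln (1 / (1 - 1 / real p)) \<le> 1 / real p + 1 / (2 * real p * (real p - 1))" .
  qed
  also have "\<dots> = (\<Sum>p\<in>?P. 1 / real p) + (\<Sum>p\<in>?P. 1 / (2 * real p * (real p - 1)))" by (rule sum.distrib)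
  also have "(\<Sum>p\<in>?P. 1 / (2 * real p * (real p - 1))) \<le> (\<Sum>m\<in>{2..n}. 1 / (2 * real m * (real m - 1)))"
    by (intro sum_mono2) (auto dest: prime_ge_2_nat)
  also have "\<dots> = 1 / 2 - 1 / (2 * real n)" using n
  proof (induction n rule: dec_induct)
    case (step k)
    then have set: "{2..Suc k} = insert (Suc k) {2..k}" by auto
    have "1 / 2 - 1 / (2 * z) + 1 / (2 * (z + 1) * z) = 1 / 2 - 1 / (2 * (z + 1))" if "z > 0" for z :: real
    proof -
      have nz: "2 * z \<noteq> 0" "2 * (z + 1) \<noteq> 0" using that by auto
      have "1 / (2 * z) - 1 / (2 * (z + 1)) = (1 * (2 * (z + 1)) - 1 * (2 * z)) / (2 * z * (2 * (z + 1)))"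
        by (rule diff_frac_eq[OF nz])
      also have "\<dots> = 2 / (2 * (2 * (z + 1) * z))" by (simp add: algebra_simps)
      also have "\<dots> = 1 / (2 * (z + 1) * z)" 
      proof -
        have "2 / (2 * X) = 1 / X" for X :: real by simp
        then show ?thesis .
      qed
      finally show ?thesis by simp
    qed
    from this[of "real k"] show ?case using step by (simp add: set add.commute)
  qed simp
  also have "\<dots> \<le> 1 / 2" by simp
  finally show ?thesis by simp
qed

lemma multiplicity_fact_ge:
  assumes p: "prime p"
  shows "multiplicity p (fact n :: nat) \<ge> n div p"
proof (induction n)
  case (Suc n)
  have "multiplicity p (fact (Suc n) :: nat) = multiplicity p (Suc n) + multiplicity p (fact n :: nat)"
    unfolding fact_Suc of_nat_id using p by (intro prime_elem_multiplicity_mult_distrib) auto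
  moreover have "multiplicity p (Suc n) \<ge> 1" if "p dvd Suc n"
    using that p by (intro multiplicity_geI) (auto dest: prime_gt_1_nat)
  ultimately show ?case using Suc by (auto simp: div_Suc dvd_eq_mod_eq_0)
qed simp

section \<open>Bounding the constant c8\<close>

text \<open>
  The integrand is real and positive; where the integral does not exist it has the default value \<open>0\<close>,
  which satisfies the claim as well.
\<close>

lemma Re_Ei_nonneg: "Re (Ei 1 (of_real b)) \<ge> 0"
proof -
  let ?f = "\<lambda>t::real. exp (- (of_real t * of_real b)) * of_real t powr (- 1) :: complex"
  have Re: "Re (?f t) \<ge> 0" if "t \<in> {1..}" for t
  proof -
    have e: "exp (- (of_real t * of_real b)) = (of_real (exp (- (t * b))) :: complex)"
      by (simp flip: exp_of_real)
    have p: "of_real t powr (- 1) = (of_real (t powr (- 1)) :: complex)"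
      using powr_of_real[of t "- 1"] that by simp
    have "?f t = of_real (exp (- (t * b)) * t powr (- 1))"
      unfolding e p by (rule of_real_mult[symmetric])
    then show ?thesis by (metis Re_complex_of_real exp_ge_zero mult_nonneg_nonneg powr_ge_zero)
  qed
  show ?thesis
  proof (cases "?f integrable_on {1..}")
    case True
    have "Re (integral {1..} ?f) = integral {1..} (Re \<circ> ?f)"
      by (rule integral_linear[OF True bounded_linear_Re, symmetric])
    also have "\<dots> \<ge> 0"
      using integrable_linear[OF True bounded_linear_Re] by (rule Henstock_Kurzweil_Integration.integral_nonneg) (use Re in simp)
    finally show ?thesis by (simp add: Ei_def)
  next
    case False
    then show ?thesis by (simp add: Ei_def not_integrable_integral)
  qed
qed

lemma c5_le: "c5 \<le> - 1.587"
proof -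
  let ?l = "ln (2::real)"
  have l: "2 / 3 \<le> ?l" "?l \<le> 25 / 36" by (rule ln2_ge_two_thirds, rule ln2_le_25_over_36)
  have "?l * (8337 * ?l - 3965) \<le> 25 / 36 * (8337 * (25 / 36) - 3965)"
    using l by (intro mult_mono) auto
  then have num: "8337 * ?l ^ 2 - 3965 * ?l - 1586 \<le> - 318.9"
    by (simp add: power2_eq_square algebra_simps)
  have "?l ^ 3 \<le> (25 / 36) ^ 3" using l by (intro power_mono) auto
  then have "1.587 * (600 * ?l ^ 3) \<le> 318.9" by (simp add: power_divide)
  with num have "8337 * ?l ^ 2 - 3965 * ?l - 1586 \<le> - 1.587 * (600 * ?l ^ 3)" by simp
  moreover have "600 * ?l ^ 3 > 0" using l by simp
  ultimately show ?thesis unfolding c5_def by (simp only: pos_divide_le_eq)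
qed

text \<open>
  Both numerator and denominator are monotone in \<open>ln 29\<close>, which lies between \<open>3.3\<close> and \<open>3.4\<close>.
\<close>

lemma E_const_le: "E_const \<le> - 0.11"
proof -
  let ?a = "ln (29::real)"
  have a1: "3.3 \<le> ?a"
  proof -
    have "exp (33::real) = exp 1 ^ 33" by (simp add: exp_of_nat_mult[symmetric])
    also have "\<dots> \<le> 2.72 ^ 33" using e_less_272 by (intro power_mono) auto
    also have "\<dots> \<le> 29 ^ 10" by (simp add: power_divide)
    finally have "33 \<le> ln (29 ^ 10 :: real)" by (subst ln_ge_iff) auto
    then show ?thesis using ln_realpow[of "29::real" 10] by simp
  qed
  have a2: "?a \<le> 3.4"
    using ln_le_of_power_le[of 29 5 17] by (simp add: power_divide)
  have "3.3 * (131874 * 3.3 - 238693) \<le> ?a * (131874 * ?a - 238693)"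
    using a1 by (intro mult_mono) auto
  then have num: "492900 \<le> 131874 * ?a ^ 2 - 238693 * ?a - 155428"
    by (simp add: power2_eq_square algebra_simps)
  have "?a ^ 3 \<le> 3.4 ^ 3" using a1 a2 by (intro power_mono) auto
  then have "0.11 * (3292800 * ?a ^ 3) \<le> 29 * 492900" by (simp add: power_divide)
  also have "\<dots> \<le> 29 * (131874 * ?a ^ 2 - 238693 * ?a - 155428)" using num by simp
  finally have *: "0.11 * (3292800 * ?a ^ 3) \<le> 29 * (131874 * ?a ^ 2 - 238693 * ?a - 155428)" .
  have "3292800 * ?a ^ 3 > 0" using a1 by simp
  then have "0.11 \<le> 29 * (131874 * ?a ^ 2 - 238693 * ?a - 155428) / (3292800 * ?a ^ 3)"
    using * by (simp only: pos_le_divide_eq)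
  then show ?thesis unfolding E_const_def by simp
qed

text \<open>
  The line is the tangent at \<open>x = 9/4\<close> of the convex function \<open>1 / (4x/9 - 3/16)\<close>, where
  \<open>4x/9 - 3/16\<close> is an upper bound for \<open>ln x\<close> obtained from its own tangent at \<open>9/4\<close> and
  \<open>ln (9/4) \<le> 13/16\<close>.
\<close>

lemma inverse_ln_ge_linear:
  fixes x :: real
  assumes x: "2 \<le> x" "x \<le> 2.7"
  shows "1 / ln x \<ge> (3152 - 1024 * (x - 1)) / 1521"
proof -
  have l: "ln (9 / 4 :: real) \<le> 13 / 16"
    using ln_le_of_power_le[of "9 / 4" 16 13] by (simp add: power_divide)
  have "ln x = ln (x / (9 / 4)) + ln (9 / 4)" using x by (subst ln_div) auto
  also have "\<dots> \<le> (x / (9 / 4) - 1) + 13 / 16"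
    using x by (intro add_mono l ln_le_minus_one) auto
  finally have le: "ln x \<le> 4 * x / 9 - 3 / 16" by simp
  have pos: "ln x > 0" using x by simp
  have "(3152 - 1024 * (x - 1)) / 1521 * ln x \<le> (3152 - 1024 * (x - 1)) / 1521 * (4 * x / 9 - 3 / 16)"
    using x by (intro mult_left_mono le) auto
  also have "\<dots> = 1 - (64 * x / 117 - 16 / 13) ^ 2"
    by (simp add: power2_eq_square field_simps)
  also have "\<dots> \<le> 1" by simp
  finally show ?thesis using pos by (simp only: pos_le_divide_eq)
qed

text \<open>
  The integrand is negative on the whole interval, so the part beyond \<open>2.7\<close> may be dropped.  On the
  rest, replacing \<open>1 / ln x\<close> by the linear lower bound leaves a Laurent polynomial in \<open>x - 1\<close>, which is
  integrated exactly.
\<close>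

lemma c6_le: "c6 \<le> - 8.303"
proof -
  define N where "N = (\<lambda>x::real. 1200 * x ^ 3 - 7565 * x ^ 2 - 2744 * x - 407)"
  let ?g = "\<lambda>x::real. N x / (1200 * (x - 1) ^ 4 * ln x)"
  define h where "h = (\<lambda>u::real. 29994432 / u ^ 4 + 35247264 / u ^ 3 - 2118896 / u ^ 2 - 7842560 / u + 1228800)"
  define F where "F = (\<lambda>u::real. - 29994432 / (3 * u ^ 3) - 35247264 / (2 * u ^ 2) + 2118896 / u - 7842560 * ln u + 1228800 * u)"
  \<comment> \<open>with \<open>u = x - 1\<close>, the function \<open>h\<close> is \<open>1521 * 1200\<close> times the absolute value of the minorant, and \<open>F\<close> is its antiderivative\<close>
  have e: "2.7 \<le> exp (1::real)" "exp (1::real) \<le> 3" using exp_1_ge exp_le by auto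
  have N0: "N x \<le> 0" if "2 \<le> x" "x \<le> 3" for x
  proof -
    have "1200 * x ^ 3 = 1200 * x * x ^ 2" by (simp add: power2_eq_square power3_eq_cube)
    also have "\<dots> \<le> 7565 * x ^ 2" using that by (intro mult_right_mono) auto
    finally show ?thesis unfolding N_def using that by simp
  qed
  have cont: "continuous_on {2..exp 1} ?g"
    unfolding N_def by (intro continuous_intros) auto
  have int: "?g integrable_on {2..exp 1}" by (rule integrable_continuous_interval[OF cont])
  have int1: "?g integrable_on {2..2.7}" and int2: "?g integrable_on {2.7..exp 1}"
    by (rule integrable_subinterval_real[OF int], use e in auto)+
  have "c6 = integral {2..exp 1} ?g" by (simp add: c6_def N_def)
  also have "\<dots> = integral {2..2.7} ?g + integral {2.7..exp 1} ?g"
    by (rule Henstock_Kurzweil_Integration.integral_combine[symmetric, OF _ _ int]) (use e in auto)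
  also have "integral {2.7..exp 1} ?g \<le> integral {2.7..exp 1} (\<lambda>x::real. 0::real)"
    by (rule Henstock_Kurzweil_Integration.integral_le[OF int2]) (use e in \<open>auto intro!: divide_nonpos_nonneg N0\<close>)
  also have "integral {2.7..exp 1} (\<lambda>x::real. 0::real) = (0::real)" by simp
  also have "integral {2..2.7} ?g \<le> - (1 / (1521 * 1200)) * F (2.7 - 1) - - (1 / (1521 * 1200)) * F (2 - 1)"
  proof (rule has_integral_le[OF integrable_integral[OF int1]])
    show "((\<lambda>x. - (1 / (1521 * 1200)) * h (x - 1)) has_integral
        (- (1 / (1521 * 1200)) * F (2.7 - 1) - - (1 / (1521 * 1200)) * F (2 - 1))) {2..2.7}"
    proof (rule fundamental_theorem_of_calculus[where f = "\<lambda>x. - (1 / (1521 * 1200)) * F (x - 1)"])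
      fix x :: real assume x: "x \<in> {2..2.7}"
      have "(F has_real_derivative h u) (at u)" if "u > 0" for u
        unfolding F_def h_def using that
        by (auto intro!: derivative_eq_intros simp: field_simps eval_nat_numeral)
      from this[of "x - 1"] x have "(F has_real_derivative h (x - 1)) (at (x - 1))" by simp
      then have "((\<lambda>x. F (x - 1)) has_real_derivative h (x - 1) * 1) (at x)"
        by (rule DERIV_chain2) (auto intro!: derivative_eq_intros)
      from DERIV_cmult[OF this, of "- (1 / (1521 * 1200))"]
      show "((\<lambda>x. - (1 / (1521 * 1200)) * F (x - 1)) has_vector_derivative - (1 / (1521 * 1200)) * h (x - 1)) (at x within {2..2.7})"
        by (simp add: has_real_derivative_iff_has_vector_derivative has_vector_derivative_at_within)
    qed simp
    fix x :: real assume "x \<in> {2..2.7}"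
    then have x: "2 \<le> x" "x \<le> 2.7" by auto
    define u where "u = x - 1"
    have u: "u > 0" using x by (simp add: u_def)
    have Nx: "N x = 1200 * u ^ 3 - 3965 * u ^ 2 - 14274 * u - 9516"
      by (simp add: N_def u_def eval_nat_numeral algebra_simps)
    have "?g x = N x / (1200 * u ^ 4) * (1 / ln x)" by (simp add: u_def)
    also have "\<dots> \<le> N x / (1200 * u ^ 4) * ((3152 - 1024 * u) / 1521)"
      unfolding u_def using x by (intro mult_left_mono_neg inverse_ln_ge_linear divide_nonpos_nonneg N0) auto
    also have "\<dots> = - (1 / (1521 * 1200)) * h u"
      unfolding h_def Nx using u by (simp add: field_simps eval_nat_numeral)
    finally show "?g x \<le> - (1 / (1521 * 1200)) * h (x - 1)" by (simp only: u_def)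
  qed
  also have "- (1 / (1521 * 1200)) * F (2.7 - 1) - - (1 / (1521 * 1200)) * F (2 - 1) + 0 \<le> - 8.303"
  proof -
    have l: "ln (17 / 10 :: real) \<le> 8 / 15"
      using ln_le_of_power_le[of "17 / 10" 15 8] by (simp add: power_divide)
    show ?thesis unfolding F_def using l by (simp add: field_simps)
  qed
  finally show ?thesis by simp
qed

text \<open>
  The true value is about \<open>-11.87\<close>; the exponential integrals and some accuracy in \<open>c6\<close> are given away.
\<close>

lemma c8_le: "c8 \<le> - 10"
proof -
  have "c7 \<le> c6"
    unfolding c7_def using Re_Ei_nonneg[of 1] Re_Ei_nonneg[of 2] Re_Ei_nonneg[of 3] by simp
  then show ?thesis unfolding c8_def using c5_le c6_le E_const_le by simp
qed

section \<open>The mean exponent in n!\<close>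

text \<open>
  Only the contribution of \<open>n div p\<close> to each exponent is kept; rounding costs at most \<open>1\<close> per prime.
\<close>

lemma Upsilon_ge:
  assumes n: "n \<ge> 2"
  shows "real (Upsilon n) \<ge> real n * (ln (ln (real n)) - 1 / 2) - real (prime_pi n)"
proof -
  let ?P = "{p. prime p \<and> p \<le> n}"
  have fin: "finite ?P" by (rule finite_subset[of _ "{..n}"]) auto
  have "real n * (ln (ln (real n)) - 1 / 2) \<le> real n * (\<Sum>p\<in>?P. 1 / real p)"
    using sum_inverse_primes_ge[OF n] by (intro mult_left_mono) auto
  also have "\<dots> = (\<Sum>p\<in>?P. real n / real p)" by (simp add: sum_distrib_left)
  also have "\<dots> \<le> (\<Sum>p\<in>?P. real (multiplicity p (fact n :: nat)) + 1)"
  proof (rule sum_mono)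
    fix p assume p: "p \<in> ?P"
    then have p0: "p > 0" by (auto dest: prime_gt_0_nat)
    have "n \<le> (n div p + 1) * p"
      using div_mult_mod_eq[of n p] mod_less_divisor[OF p0, of n] unfolding distrib_right by linarith
    then have "real n \<le> real ((n div p + 1) * p)" by (rule of_nat_mono)
    then have "real n / real p \<le> real (n div p) + 1"
      using p0 by (simp add: pos_divide_le_eq algebra_simps)
    also have "n div p \<le> multiplicity p (fact n :: nat)" using p by (intro multiplicity_fact_ge) auto
    finally show "real n / real p \<le> real (multiplicity p (fact n :: nat)) + 1" by simp
  qed
  also have "\<dots> = real (Upsilon n) + real (prime_pi n)"
    by (simp add: sum.distrib Upsilon_def prime_pi_def)
  finally show ?thesis by simp
qed

text \<open>
  Primes up to \<open>z\<close> are counted trivially, and each larger one contributes at least \<open>ln z\<close> to \<open>\<theta>\<close>.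
\<close>

lemma prime_pi_le_theta:
  assumes z: "1 < z"
  shows "real (prime_pi n) \<le> z + theta (real n) / ln z"
proof -
  let ?A = "{p. prime p \<and> real p \<le> z}" and ?B = "{p. prime p \<and> p \<le> n \<and> z < real p}"
  have fin: "finite ?B" by (rule finite_subset[of _ "{..n}"]) auto
  have lnz: "ln z > 0" using z by simp
  have "card ?A \<le> card {1..nat \<lfloor>z\<rfloor>}"
    by (intro card_mono) (auto simp: le_nat_floor Suc_le_eq dest: prime_gt_0_nat)
  then have A: "real (card ?A) \<le> z" using z by (simp add: le_nat_iff) linarith
  have "real (card ?B) * ln z = (\<Sum>p\<in>?B. ln z)" by simp
  also have "\<dots> \<le> (\<Sum>p\<in>?B. ln (real p))" using z by (intro sum_mono) auto
  also have "\<dots> \<le> theta (real n)"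
    unfolding theta_def by (intro sum_mono2 finite_primes_le) (auto dest: prime_gt_0_nat)
  finally have B: "real (card ?B) \<le> theta (real n) / ln z" using lnz by (simp add: pos_le_divide_eq)
  have "prime_pi n \<le> card (?A \<union> ?B)"
    unfolding prime_pi_def by (intro card_mono) (auto simp: finite_primes_le fin)
  also have "\<dots> \<le> card ?A + card ?B" by (rule card_Un_le)
  finally show ?thesis using A B by linarith
qed

lemma exp_ge_square:
  assumes L: "L \<ge> (10 :: real)"
  shows "exp L \<ge> 218 * L ^ 2"
proof -
  have "exp (10::real) = exp 1 ^ 10" by (simp add: exp_of_nat_mult[symmetric])
  also have "\<dots> \<ge> 2.716 ^ 10" by (rule power_mono[OF exp_1_ge]) simp
  finally have e: "exp (10::real) \<ge> 21800" by (rule order_trans[rotated]) (simp add: power_divide)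
  have "exp ((L - 10) / 2) \<ge> 1 + (L - 10) / 2" by (rule exp_ge_add_one_self)
  then have "L / 10 \<le> exp ((L - 10) / 2)" using L by (simp add: field_simps)
  then have "(L / 10) ^ 2 \<le> exp ((L - 10) / 2) ^ 2" using L by (intro power_mono) auto
  also have "\<dots> = exp (L - 10)" by (simp add: exp_of_nat_mult[symmetric])
  finally have "21800 * (L / 10) ^ 2 \<le> exp 10 * exp (L - 10)"
    using e by (intro mult_mono) auto
  then show ?thesis by (simp add: exp_add[symmetric] power_divide)
qed

text \<open>
  Apply the previous bound with \<open>z = n / (ln n)\<^sup>2\<close>, so that \<open>ln z = l - 2 L\<close> differs from \<open>l = e^L\<close> by a
  negligible factor.
\<close>

lemma prime_pi_le:
  assumes L: "L \<ge> 10" "L = ln (ln (real n))" and n: "n \<ge> 2"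
    and d: "theta (real n) \<le> real n * (1 + d)" "0 \<le> d" "d \<le> 1"
  shows "real (prime_pi n) * ln (real n) \<le> real n * (1 + d + 0.03 / L)"
proof -
  define l where "l = ln (real n)"
  have l0: "l > 0" using n by (simp add: l_def)
  have lL: "l = exp L" using l0 by (simp add: L(2) l_def)
  have nl: "real n = exp l" using n by (simp add: l_def)
  have big: "l \<ge> 218 * L ^ 2" unfolding lL by (rule exp_ge_square[OF L(1)])
  have LL: "L ^ 2 \<ge> 10 * L" using L by (simp add: power2_eq_square mult_right_mono)
  define z where "z = exp (l - 2 * L)"
  have pos: "l - 2 * L > 0" using big LL L by linarith
  have zn: "z = real n / l ^ 2" unfolding z_def nl lL by (simp add: exp_diff exp_of_nat_mult[symmetric])
  have "real (prime_pi n) \<le> z + theta (real n) / ln z" by (rule prime_pi_le_theta) (use pos in \<open>simp add: z_def\<close>)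
  also have "\<dots> \<le> z + real n * (1 + d) / (l - 2 * L)"
    unfolding z_def ln_exp using pos d by (intro add_left_mono divide_right_mono) auto
  finally have "real (prime_pi n) * l \<le> (z + real n * (1 + d) / (l - 2 * L)) * l"
    using l0 by (intro mult_right_mono) auto
  also have "\<dots> = real n * (1 / l + (1 + d) * (l / (l - 2 * L)))"
    using l0 pos by (simp add: zn power2_eq_square distrib_left distrib_right)
  also have "\<dots> \<le> real n * (0.001 / L + (1 + d) * (1 + 0.01 / L))"
  proof (intro mult_left_mono add_mono)
    have "1000 * L \<le> l" using big LL L by linarith
    then show "1 / l \<le> 0.001 / L" using L l0 by (simp add: field_simps)
    have "200 * L ^ 2 \<le> l - 2 * L" using big LL L(1) by linarith
    then have "2 * L * L \<le> 0.01 * (l - 2 * L)" by (simp add: power2_eq_square)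
    then have "2 * L / (l - 2 * L) \<le> 0.01 / L" using L pos by (simp add: field_simps)
    moreover have "l / (l - 2 * L) = 1 + 2 * L / (l - 2 * L)" using pos by (simp add: field_simps)
    ultimately show "l / (l - 2 * L) \<le> 1 + 0.01 / L" by simp
  qed (use d in auto)
  also have "\<dots> \<le> real n * (1 + d + 0.03 / L)"
  proof (rule mult_left_mono)
    have "d * (0.01 / L) \<le> 1 * (0.01 / L)" using d L by (intro mult_right_mono) auto
    moreover have "(1 + d) * (1 + e) = 1 + d + e + d * e" for e :: real by (simp add: algebra_simps)
    note this[of "0.01 / L"]
    moreover have "0.001 / L + (0.01 / L + 0.01 / L) \<le> 0.03 / L" using L by (simp add: field_simps)
    ultimately show "0.001 / L + (1 + d) * (1 + 0.01 / L) \<le> 1 + d + 0.03 / L" by linarith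
  qed simp
  finally show ?thesis by (simp add: l_def)
qed

text \<open>
  The two ranges of \<open>L\<close> use the two bounds for \<open>\<theta>\<close>: the relative error \<open>d\<close> is \<open>0.1101\<close> for \<open>L \<le> 95\<close> and
  \<open>9.2 / L\<close> beyond; in both cases \<open>d * (L - 10) \<le> 9.36\<close>.
\<close>

lemma prime_pi_ln_ln_le:
  assumes n: "n \<ge> 2" and L: "L > 10" "L = ln (ln (real n))"
  shows "real (prime_pi n) * ln (real n) * (L - 10) \<le> real n * (L - 0.6)"
    and "real (prime_pi n) \<le> 0.1 * real n"
proof -
  define l where "l = ln (real n)"
  have l0: "l > 0" using n by (simp add: l_def)
  have lL: "l = exp L" using l0 by (simp add: L(2) l_def)
  have nl: "real n = exp l" using n by (simp add: l_def)
  have big: "l \<ge> 218 * L ^ 2" unfolding lL by (rule exp_ge_square) (use L in simp)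
  have l21800: "l \<ge> 21800"
  proof -
    have "L ^ 2 \<ge> 10 ^ 2" using L by (intro power_mono) auto
    then show ?thesis using big by simp
  qed
  have "\<exists>d\<ge>0. d \<le> 1 \<and> theta (real n) \<le> real n * (1 + d) \<and> d * (L - 10) \<le> 9.36"
  proof (cases "L \<le> 95")
    case True
    have "10 ^ 14 \<le> real n"
    proof -
      have "10 ^ 7 \<le> 218 * (10900::real) ^ 2" by simp
      also have "\<dots> \<le> 218 * (l / 2) ^ 2" using l21800 by (intro mult_left_mono power_mono) auto
      also have "\<dots> \<le> exp (l / 2)" by (rule exp_ge_square) (use l21800 in simp)
      finally have "(10 ^ 7) ^ 2 \<le> exp (l / 2) ^ 2" by (intro power_mono) auto
      also have "\<dots> = real n" unfolding nl by (simp add: exp_of_nat_mult[symmetric])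
      finally show ?thesis by simp
    qed
    then have "10 ^ 10 \<le> 0.0001 * real n" by simp
    then have "theta (real n) \<le> real n * (1 + 0.1101)" using theta_le_chebyshev[of n] by simp
    moreover have "0.1101 * (L - 10) \<le> 9.36" using True by simp
    ultimately show ?thesis by (intro exI[of _ "0.1101"]) simp
  next
    case False
    have "theta (real n) \<le> real n * (1 + 9.2 / L)"
      by (rule theta_le_sharp) (use False in \<open>simp_all add: nl lL\<close>)
    moreover have "9.2 / L * (L - 10) \<le> 9.36" using L by (simp add: field_simps)
    moreover have "0 \<le> 9.2 / L" "9.2 / L \<le> 1" using False by auto
    ultimately show ?thesis by blast
  qed
  then obtain d where d: "0 \<le> d" "d \<le> 1" "theta (real n) \<le> real n * (1 + d)" "d * (L - 10) \<le> 9.36" by blast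
  have pi: "real (prime_pi n) * l \<le> real n * (1 + d + 0.03 / L)"
    unfolding l_def by (rule prime_pi_le) (use L n d in auto)
  then have "real (prime_pi n) * l * (L - 10) \<le> real n * (1 + d + 0.03 / L) * (L - 10)"
    using L by (intro mult_right_mono) auto
  also have "\<dots> = real n * (L - 10 + d * (L - 10) + 0.03 / L * (L - 10))" by (simp add: algebra_simps)
  also have "\<dots> \<le> real n * (L - 10 + 9.36 + 0.04)"
  proof (intro mult_left_mono add_mono d order_refl)
    show "0.03 / L * (L - 10) \<le> 0.04" using L by (simp add: field_simps)
  qed simp
  finally show "real (prime_pi n) * ln (real n) * (L - 10) \<le> real n * (L - 0.6)" by (simp add: l_def)
  have "0.03 / L \<le> 1" using L by simp
  then have "real n * (1 + d + 0.03 / L) \<le> real n * 3" using d by (intro mult_left_mono) auto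
  then have "real (prime_pi n) * 21800 \<le> real n * 3"
    using pi mult_left_mono[OF l21800, of "real (prime_pi n)"] by linarith
  then show "real (prime_pi n) \<le> 0.1 * real n" by simp
qed

theorem theorem1p5:
  fixes n :: nat
  assumes "n \<ge> 2"
  shows "Upsilon_mean n >
      (real n - 1) * kappa n / real n * ln (real n) * ln (ln (real n))
    + c8 * (real n - 1) * kappa n * ln (real n) / real n
    - 16381 * kappa n / (5000 * ln (real n))
    - 6 * kappa n / (ln (real n))^2
    - 54281 * kappa n / (800 * (ln (real n))^3)
    - c10 * kappa n * (ln (real n))^2 / real n"
proof -
  define l L a k where "l = ln (real n)" and "L = ln l" and "a = (real n - 1) / real n" and "k = kappa n"
  have l: "l > 0" using assms by (simp add: l_def)
  have a: "0 < a" "a \<le> 1" using assms by (auto simp: a_def)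
  have k: "0 < k" "k \<le> 1" using l by (auto simp: k_def kappa_def l_def[symmetric])
  have c10: "c10 > 0" unfolding c10_def by (intro add_pos_pos) auto
  have "c8 * (a * k * l) \<le> - 10 * (a * k * l)"
    using c8_le a k l by (intro mult_right_mono) auto
  moreover have "16381 * k / (5000 * l) > 0" "6 * k / l ^ 2 > 0" "54281 * k / (800 * l ^ 3) > 0" "c10 * k * l ^ 2 / real n > 0"
    using k l c10 assms by auto
  ultimately have "a * k * l * L + c8 * (a * k * l) - 16381 * k / (5000 * l) - 6 * k / l ^ 2
      - 54281 * k / (800 * l ^ 3) - c10 * k * l ^ 2 / real n < a * k * l * L + - 10 * (a * k * l)" by linarith
  also have "\<dots> = (a * k) * (l * (L - 10))" by (simp add: algebra_simps)
  also have "\<dots> \<le> Upsilon_mean n"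
  proof (cases "L > 10")
    case False
    then have "(a * k) * (l * (L - 10)) \<le> 0" using a k l by (intro mult_nonneg_nonpos) auto
    also have "0 \<le> Upsilon_mean n" by (simp add: Upsilon_mean_def)
    finally show ?thesis .
  next
    case True
    have "prime_pi n > 0"
    proof -
      have "finite {p. prime p \<and> p \<le> n}" by (rule finite_subset[of _ "{..n}"]) auto
      moreover have "2 \<in> {p. prime p \<and> p \<le> n}" using assms by simp
      ultimately show ?thesis unfolding prime_pi_def by (metis card_gt_0_iff empty_iff)
    qed
    have "real (prime_pi n) * l * (L - 10) \<le> real n * (L - 0.6)" "real (prime_pi n) \<le> 0.1 * real n"
      using prime_pi_ln_ln_le[OF assms True] by (auto simp: L_def l_def)
    then have "real (prime_pi n) * l * (L - 10) \<le> real n * (L - 1 / 2) - real (prime_pi n)"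
      by (simp add: algebra_simps)
    also have "\<dots> \<le> real (Upsilon n)" using Upsilon_ge[OF assms] by (simp add: L_def l_def)
    finally have "l * (L - 10) \<le> Upsilon_mean n"
      using \<open>prime_pi n > 0\<close> by (simp add: Upsilon_mean_def pos_le_divide_eq mult_ac)
    moreover have "(a * k) * (l * (L - 10)) \<le> 1 * (l * (L - 10))"
      using a k l True by (intro mult_right_mono mult_le_one) auto
    ultimately show ?thesis by simp
  qed
  finally show ?thesis by (simp add: l_def L_def a_def k_def mult_ac)
qed

end
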